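(* Let $p$ and $\ell>2$ be primes with $p$ primitive modulo $\ell$, let $t\ge 1$ be an integer, put $q=p^{(\ell-1)t}$, $k=\frac{q-1}{\ell}$, and assume that $\sqrt q=p^{(\ell-1)t/2}\neq \ell-1$ whenever $t$ is odd. Let $L$ be the Laplacian matrix and $C$ the critical group of the graph $G(p,\ell,t)$, and let $d=v_p(\ell-1)$ be the $p$-adic valuation of $\ell-1$. For $1\le i\le k-1$ let $$\mathfrak{min}(i)=\min\{c(i+mk,nk)\;:\;0\le m\le \ell-1,\ 0<n\le \ell-1\},$$ where $c(a,b)$ is the number of carries when adding the $p$-adic expansions of $a$ and $b$ modulo $q-1$. For an integer $j>0$ let $e_j$ be the multiplicity of $p^j$ as a $p$-elementary divisor of $C$, and let $e_0$ be the $p$-rank of $L$ (the rank of $L$ over $\mathbb{F}_p$). Then: 1. $e_0=|\{i : 1\le i\le k-1,\ \mathfrak{min}(i)=0\}|+2$ and $e_{(\ell-1)t+d}=|\{i : 1\le i\le k-1,\ \mathfrak{min}(i)=0\}|$. 2. $e_j=|\{i : 1\le i\le k-1,\ \mathfrak{min}(i)=j\}|$ for $0<j<\frac{(\ell-1)t}{2}$. 3. $e_j=e_{(\ell-1)t+d-j}$ for $0<j<\frac{(\ell-1)t}{2}$. 4. If $p\nmid \ell-1$, then $e_{\frac{(\ell-1)t}{2}}=q+1-2\sum_{0\le j<\frac{(\ell-1)t}{2}}e_j$. 5. If $p\mid \ell-1$, then (a) $e_{\frac{(\ell-1)t}{2}+d}=k+2-\sum_{0\le j<\frac{(\ell-1)t}{2}}e_j$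 and (b) $e_{\frac{(\ell-1)t}{2}}=(\ell-1)k-\sum_{0\le j<\frac{(\ell-1)t}{2}}e_j$. 6. $e_j=0$ for all other $j$.
   Context: Graph: let $K=\mathbb{F}_q$ and let $S$ be the unique subgroup of $K^\times$ of order $k=(q-1)/\ell$. The graph $G(p,\ell,t)$ has vertex set $K$, with $x,y\in K$ adjacent iff $x-y\in S$. It is an undirected $k$-regular graph; with $A$ its adjacency matrix, its Laplacian is $L=kI-A$. The critical group $C$ is the (finite) torsion subgroup of the cokernel $\mathbb{Z}^K/L\mathbb{Z}^K$. The multiplicity of $p^j$ ($j>0$) as a $p$-elementary divisor of $C$ is the number of summands $\mathbb{Z}/p^j\mathbb{Z}$ in a decomposition of the Sylow $p$-subgroup of $C$ into cyclic groups of prime power order. Carries: an integer $a$ not divisible by $q-1$ has a unique expansion $a\equiv\sum_{i=0}^{(\ell-1)t-1}a_ip^i \pmod{q-1}$ with $0\le a_i\le p-1$ and not all $a_i$ equal to $0$; put $s(a)=\sum_i a_i$. For $a,b$ with none of $a,b,a+b$ divisible by $q-1$, the number of carries when adding $a$ and $b$ modulo $q-1$ (with the carry out of the top digit being added to the lowest digit) is $c(a,b)=\frac{s(a)+s(b)-s(a+b)}{p-1}$. *)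

theory Defs
  imports
    "HOL-Analysis.Analysis"
    "HOL-Algebra.Product_Groups"
    "HOL-Number_Theory.Number_Theory"
begin

definition mult_group :: "'a::field monoid" where
  "mult_group = \<lparr>carrier = UNIV - {0}, monoid.mult = (*), one = 1\<rparr>"

definition adjacent :: "'a::field set \<Rightarrow> 'a \<Rightarrow> 'a \<Rightarrow> bool" where
  "adjacent S x y \<longleftrightarrow> x - y \<in> S"

definition adjacency_matrix :: "('n \<Rightarrow> 'n \<Rightarrow> bool) \<Rightarrow> int ^ 'n::finite ^ 'n" where
  "adjacency_matrix E = (\<chi> x y. if E x y then 1 else 0)"

definition regular_laplacian :: "nat \<Rightarrow> ('n \<Rightarrow> 'n \<Rightarrow> bool) \<Rightarrow> int ^ 'n::finite ^ 'n" where
  "regular_laplacian k E = mat (int k) - adjacency_matrix E"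

definition int_vec_group :: "(int ^ 'n::finite) monoid" where
  "int_vec_group = \<lparr>carrier = UNIV, monoid.mult = (+), one = 0\<rparr>"

definition cokernel :: "int ^ 'n::finite ^ 'm::finite \<Rightarrow> (int ^ 'm) set monoid" where
  "cokernel M = int_vec_group Mod (range ((*v) M))"

definition torsion_part :: "'g monoid \<Rightarrow> 'g monoid" where
  "torsion_part G = G\<lparr>carrier := {x \<in> carrier G. \<exists>n::nat. n > 0 \<and> x [^]\<^bsub>G\<^esub> n = \<one>\<^bsub>G\<^esub>}\<rparr>"

definition critical_group :: "int ^ 'n::finite ^ 'n \<Rightarrow> (int ^ 'n) set monoid" where
  "critical_group L = torsion_part (cokernel L)"

(* Meant for finite abelian groups, where the Sylow p-subgroup is unique. *)
definition sylow_part :: "nat \<Rightarrow> 'g monoid \<Rightarrow> 'g monoid" where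
  "sylow_part p G =
     G\<lparr>carrier := (THE P. subgroup P G \<and> card P = p ^ multiplicity p (order G))\<rparr>"

(* Meant for finite abelian groups: the orders, with repetitions, of the summands in a
   decomposition into cyclic groups of prime power order. Prime powers here are greater
   than 1, so there are no trivial summands. *)
definition elementary_divisors :: "'g monoid \<Rightarrow> nat multiset" where
  "elementary_divisors G =
     (THE M. (\<forall>n \<in># M. primepow n) \<and>
        (\<exists>ns. mset ns = M \<and>
           G \<cong> product_group {..<length ns} (\<lambda>i. integer_mod_group (ns ! i))))"

definition elem_div_mult :: "nat \<Rightarrow> nat \<Rightarrow> 'g monoid \<Rightarrow> nat" where
  "elem_div_mult p j G = count (elementary_divisors (sylow_part p G)) (p ^ j)"

(* The prime field is passed as a type 'f; it is meant to have a prime number of elements,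
   so that of_int is reduction modulo that prime. *)
definition rank_over :: "'f::field itself \<Rightarrow> int ^ 'n::finite ^ 'm::finite \<Rightarrow> nat" where
  "rank_over _ M = rank (map_matrix of_int M :: 'f ^ 'n ^ 'm)"

(* With q = p ^ N and a not divisible by q - 1, the residue a mod (q - 1) lies in {1..q - 2},
   so its ordinary base-p digits are the unique digits, not all 0, of an expansion of a
   modulo q - 1. *)
definition digit :: "nat \<Rightarrow> nat \<Rightarrow> nat \<Rightarrow> nat \<Rightarrow> nat" where
  "digit p N a i = (a mod (p ^ N - 1)) div p ^ i mod p"

definition digit_sum :: "nat \<Rightarrow> nat \<Rightarrow> nat \<Rightarrow> nat" where
  "digit_sum p N a = (\<Sum>i<N. digit p N a i)"

(* The number of carries when adding a and b modulo p ^ N - 1, the top carry going to the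
   lowest digit: each carry lowers the total digit sum by p - 1. For a, b, a + b not divisible
   by p ^ N - 1 the subtraction does not truncate and the division is exact. *)
definition carries :: "nat \<Rightarrow> nat \<Rightarrow> nat \<Rightarrow> nat \<Rightarrow> nat" where
  "carries p N a b = (digit_sum p N a + digit_sum p N b - digit_sum p N (a + b)) div (p - 1)"

definition min_carries :: "nat \<Rightarrow> nat \<Rightarrow> nat \<Rightarrow> nat \<Rightarrow> nat" where
  "min_carries p l t i =
     (let N = (l - 1) * t; k = (p ^ N - 1) div l
      in Min {carries p N (i + m * k) (n * k) | m n. m \<le> l - 1 \<and> 0 < n \<and> n \<le> l - 1})"

end

theory Submission
  imports Defs "HOL-Computational_Algebra.Polynomial_Factorial"
begin

text \<open>
  Let \<open>R\<close> be the localization of \<open>\<int>[\<zeta>]\<close>, \<open>\<zeta>\<close> a primitive \<open>(q - 1)\<close>-st root of unity, at a prime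
  above \<open>p\<close>. It is a discrete valuation ring with uniformizer \<open>p\<close> and residue field \<open>K\<close>, so the
  \<open>p\<close>-elementary divisors of \<open>L\<close> can be computed over \<open>R\<close>. The powers \<open>T\<^sup>-\<^sup>a\<close> of the Teichmueller
  character, together with the indicator of 0, form a basis of \<open>R\<^sup>K\<close>. The subspace spanned by
  the \<open>T\<^sup>-\<^sup>a\<close> with \<open>a \<equiv> i (mod k)\<close> is invariant under \<open>L\<close>. Write \<open>g\<^sub>a\<close> for the Gauss sum of
  \<open>T\<^sup>-\<^sup>a\<close>. Since \<open>p\<close> is primitive modulo \<open>l\<close>, the Frobenius permutes the characters of order \<open>l\<close>
  transitively, so that their Gauss sums share one value \<open>\<gamma>\<close>, and \<open>\<gamma>\<^sup>2 = q\<close>. Hence the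
  matrix of \<open>l L\<close> on the block of \<open>i \<noteq> 0\<close> is \<open>(\<gamma>\<^sup>2 + \<gamma>) I - \<gamma> (g\<^sub>a / g\<^sub>b)\<^sub>b\<^sub>a\<close>, a rank one perturbation of
  a scalar matrix. If the valuation of \<open>g\<^sub>a\<close> is least at \<open>a = lo\<close> and greatest at \<open>a = hi\<close>, then
  the entry \<open>\<gamma> g\<^bsub>lo\<^esub> / g\<^bsub>hi\<^esub>\<close> divides all others, and its valuation is the minimal number of carries by
  Stickelberger's theorem. Clearing its row and column leaves one further entry determined by the
  determinant, and \<open>\<gamma>\<^sup>2 + \<gamma>\<close>, of valuation \<open>h\<close>, in the remaining \<open>l - 2\<close> places. The block of \<open>i = 0\<close> is
  diagonalized by hand.

  Stickelberger's theorem is derived from the cocycle \<open>g\<^sub>a g\<^sub>b / g\<^bsub>a+b\<^esub>\<close> alone: the valuation \<open>f\<close> of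
  \<open>g\<^sub>a\<close> is additive as long as no carry occurs, because the Jacobi sum of \<open>a\<close> and 1 is
  \<open>- (a + 1)\<close> modulo \<open>p\<close>, and it is invariant under \<open>a \<mapsto> p a\<close>. So \<open>f a\<close> is \<open>f 1\<close> times the digit sum of
  \<open>a\<close>, and \<open>f a + f (- a) = v(q)\<close> fixes \<open>f 1 = 1 / (p - 1)\<close>.
\<close>

section \<open>Diagonalization of integer matrices\<close>

text \<open>Diagonal forms over the integers and over \<open>R\<close> are compared by counting.
  Take the lattice vectors \<open>y\<close> for which \<open>p^n\<close> divides \<open>L y\<close>
  and reduce them modulo \<open>p\<close>. For a diagonal \<open>L\<close> the number of residue
  vectors is \<open>q\<close> to the number of diagonal entries divisible by \<open>p^n\<close>, and
  it does not change under an invertible change of coordinates. Zero entries occur in every such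
  count and cancel on passing from \<open>n\<close> to \<open>n + 1\<close>.

  The hypothesis on the square root of \<open>q\<close> enters through size alone. It yields
  \<open>l - 1 < p ^ h\<close>, hence \<open>d < h\<close>, so that \<open>\<gamma> + 1 - l\<close>
  has valuation \<open>d\<close> for either square root \<open>\<gamma>\<close> of \<open>q\<close>;
  the sign of \<open>\<gamma>\<close> is never determined.

  On a block with \<open>i \<noteq> 0\<close> the product of the two exceptional entries is
  \<open>(\<gamma>\<^sup>2 + \<gamma>) * \<gamma> * (\<gamma> + 1 - l)\<close>, of valuation
  \<open>2 * h + d\<close>. This is the source of the symmetry between \<open>e j\<close> and
  \<open>e (2 * h + d - j)\<close>. The first of the two has valuation at most \<open>h\<close>, so
  that below \<open>h\<close> it alone accounts for the multiplicities, apart from two units in the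
  block of 0.\<close>

definition unimodular_equiv :: "int^'n^'n::finite \<Rightarrow> int^'n^'n \<Rightarrow> bool" where
  "unimodular_equiv A B \<longleftrightarrow> (\<exists>P P' Q Q'. P ** P' = mat 1 \<and> P' ** P = mat 1 \<and>
     Q ** Q' = mat 1 \<and> Q' ** Q = mat 1 \<and> B = P ** A ** Q)"

lemma unimodular_equiv_refl: "unimodular_equiv A A"
  unfolding unimodular_equiv_def by (intro exI[of _ "mat 1"]) simp

lemma unimodular_equiv_trans:
  assumes "unimodular_equiv A B" "unimodular_equiv B C"
  shows "unimodular_equiv A C"
proof -
  obtain P P' Q Q' where 1: "P ** P' = mat 1" "P' ** P = mat 1"
     "Q ** Q' = mat 1" "Q' ** Q = mat 1" "B = P ** A ** Q"
    using assms(1) unfolding unimodular_equiv_def by blast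
  obtain R R' S S' where 2: "R ** R' = mat 1" "R' ** R = mat 1"
     "S ** S' = mat 1" "S' ** S = mat 1" "C = R ** B ** S"
    using assms(2) unfolding unimodular_equiv_def by blast
  have "(R ** P) ** (P' ** R') = R ** (P ** P') ** R'" "(P' ** R') ** (R ** P) = P' ** (R' ** R) ** P"
    "(Q ** S) ** (S' ** Q') = Q ** (S ** S') ** Q'" "(S' ** Q') ** (Q ** S) = S' ** (Q' ** Q) ** S"
    "C = (R ** P) ** A ** (Q ** S)"
    by (simp_all only: 2(5) 1(5) matrix_mul_assoc)
  then show ?thesis
    unfolding unimodular_equiv_def using 1 2 by (metis matrix_mul_rid)
qed

lemma unimodular_equiv_transpose:
  assumes "unimodular_equiv A B"
  shows "unimodular_equiv (transpose A) (transpose B)"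
proof -
  obtain P P' Q Q' where 1: "P ** P' = mat 1" "P' ** P = mat 1"
     "Q ** Q' = mat 1" "Q' ** Q = mat 1" "B = P ** A ** Q"
    using assms(1) unfolding unimodular_equiv_def by blast
  have "transpose B = transpose Q ** transpose A ** transpose P"
    by (simp add: 1 matrix_transpose_mul matrix_mul_assoc)
  moreover have "transpose Q ** transpose Q' = mat 1" "transpose Q' ** transpose Q = mat 1"
    "transpose P ** transpose P' = mat 1" "transpose P' ** transpose P = mat 1"
    by (metis 1 matrix_transpose_mul transpose_mat)+
  ultimately show ?thesis unfolding unimodular_equiv_def by blast
qed

text \<open>The matrix \<open>E\<close> is nonzero only in row \<open>j\<close>, and
  \<open>c j = 0\<close> makes its square vanish. So \<open>mat 1 + E\<close> has the inverse
  \<open>mat 1 - E\<close>, and one such step can clear a whole row.\<close>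

lemma unimodular_equiv_column_op:
  fixes A :: "int^'n^'n::finite"
  assumes "c j = 0"
  shows "unimodular_equiv A (\<chi> r s. A $ r $ s + A $ r $ j * c s)"
proof -
  define E :: "int^'n^'n" where "E = (\<chi> r s. if r = j then c s else 0)"
  define F :: "int^'n^'n" where "F = (\<chi> r s. if r = j then - c s else 0)"
  have EF: "E ** F = 0" "F ** E = 0" "E + F = 0"
    using assms by (auto simp: E_def F_def matrix_matrix_mult_def vec_eq_iff intro!: sum.neutral)
  have rdistrib: "(X + Y) ** Z = X ** Z + Y ** Z" for X Y Z :: "int^'n^'n"
    by (simp add: vec_eq_iff matrix_matrix_mult_def sum.distrib algebra_simps)
  have 1: "(mat 1 + E) ** (mat 1 + F) = mat 1" "(mat 1 + F) ** (mat 1 + E) = mat 1"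
    using EF by (simp_all add: matrix_add_ldistrib rdistrib add.commute add.assoc)
  have 2: "A ** (mat 1 + E) = (\<chi> r s. A $ r $ s + A $ r $ j * c s)"
  proof -
    have "(\<Sum>k\<in>UNIV. A $ r $ k * (if k = j then c s else 0)) = A $ r $ j * c s" for r s
      by (simp add: if_distrib[of "\<lambda>x. _ * x"] cong: if_cong)
    then have "A ** E = (\<chi> r s. A $ r $ j * c s)"
      by (simp add: E_def matrix_matrix_mult_def vec_eq_iff)
    then show ?thesis
      by (simp add: matrix_add_ldistrib vec_eq_iff)
  qed
  show ?thesis unfolding unimodular_equiv_def
    by (intro exI[of _ "mat 1"] exI[of _ "mat 1 + E"] exI[of _ "mat 1 + F"]) (simp add: 1 2)
qed

lemma unimodular_equiv_row_op:
  fixes A :: "int^'n^'n::finite"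
  assumes "c i = 0"
  shows "unimodular_equiv A (\<chi> r s. A $ r $ s + c r * A $ i $ s)"
proof -
  have "transpose (\<chi> r s. transpose A $ r $ s + transpose A $ r $ i * c s)
      = (\<chi> r s. A $ r $ s + c r * A $ i $ s)"
    by (simp add: transpose_def vec_eq_iff mult.commute)
  with unimodular_equiv_transpose[OF unimodular_equiv_column_op[where A = "transpose A" and c = c and j = i]] assms
  show ?thesis by (simp add: transpose_transpose)
qed

definition split_off :: "'n set \<Rightarrow> int^'n^'n::finite \<Rightarrow> bool" where
  "split_off I A \<longleftrightarrow> (\<forall>r s. r \<noteq> s \<longrightarrow> r \<in> I \<or> s \<in> I \<longrightarrow> A $ r $ s = 0)"

text \<open>The pivot is an entry of least absolute value among all equivalent matrices, so that
  division with remainder must leave remainder 0.\<close>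

lemma split_off_step:
  fixes A :: "int^'n^'n::finite"
  assumes A: "split_off I A" and i: "i \<notin> I"
  shows "\<exists>B J. unimodular_equiv A B \<and> split_off J B \<and> I \<subset> J"
proof (cases "\<exists>r s. r \<notin> I \<and> s \<notin> I \<and> A $ r $ s \<noteq> 0")
  case False
  then have "split_off (insert i I) A" using A i unfolding split_off_def by auto
  then show ?thesis using unimodular_equiv_refl i by (intro exI[of _ A] exI[of _ "insert i I"]) auto
next
  case True
  define Pr where "Pr = (\<lambda>(B, r, s). unimodular_equiv A B \<and> split_off I B \<and> r \<notin> I \<and> s \<notin> I
      \<and> B $ r $ s \<noteq> 0)"
  define f where "f = (\<lambda>(B :: int^'n^'n, r, s). nat \<bar>B $ r $ s\<bar>)"
  have "\<exists>x. Pr x" unfolding Pr_def using True A unimodular_equiv_refl by auto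
  then obtain B r s where min: "Pr (B, r, s)" and least: "\<And>y. Pr y \<Longrightarrow> f (B, r, s) \<le> f y"
    using ex_has_least_nat[of Pr _ f] by (metis surj_pair)
  have smaller: "C $ r' $ s' = 0" if "unimodular_equiv A C" "split_off I C" "r' \<notin> I" "s' \<notin> I"
      "\<bar>C $ r' $ s'\<bar> < \<bar>B $ r $ s\<bar>" for C r' s'
  proof (rule ccontr)
    assume "C $ r' $ s' \<noteq> 0"
    then have "nat \<bar>B $ r $ s\<bar> \<le> nat \<bar>C $ r' $ s'\<bar>"
      using least[of "(C, r', s')"] that by (auto simp: Pr_def f_def)
    then show False using that(5) by linarith
  qed
  have B: "unimodular_equiv A B" "split_off I B" "r \<notin> I" "s \<notin> I" "B $ r $ s \<noteq> 0"
    using min by (auto simp: Pr_def)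
  have clear_row: "\<exists>D. unimodular_equiv A D \<and> split_off I D \<and> (\<forall>r'. D $ r' $ s' = C $ r' $ s') \<and>
      (\<forall>s''. s'' \<noteq> s' \<longrightarrow> D $ r $ s'' = 0)"
    if C: "unimodular_equiv A C" "split_off I C" "C $ r $ s' = B $ r $ s" "s' \<notin> I" for C s'
  proof -
    define c where "c = (\<lambda>u. if u = s' then 0 else - (C $ r $ u div C $ r $ s'))"
    define D :: "int^'n^'n" where "D = (\<chi> a b. C $ a $ b + C $ a $ s' * c b)"
    have "c s' = 0" by (simp add: c_def)
    then have "unimodular_equiv A D"
      unfolding D_def using C unimodular_equiv_column_op unimodular_equiv_trans by blast
    have "C $ r $ b = 0" if "b \<in> I" for b
      using C(2) B(3) that unfolding split_off_def by metis
    then have "c b = 0" if "b \<in> I" for b using that by (simp add: c_def)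
    moreover have "C $ a $ s' = 0" if "a \<in> I" for a
      using C(2,4) that unfolding split_off_def by metis
    ultimately have so: "split_off I D" using C(2) by (auto simp: split_off_def D_def)
    have Drow: "D $ r $ u = C $ r $ u mod B $ r $ s" if "u \<noteq> s'" for u
      using that C by (simp add: D_def c_def minus_div_mult_eq_mod[symmetric] algebra_simps)
    have "D $ r $ u = 0" if "u \<noteq> s'" for u
    proof (cases "u \<in> I")
      case True
      then show ?thesis using so B(3) unfolding split_off_def by metis
    next
      case False
      then show ?thesis
        using smaller[OF \<open>unimodular_equiv A D\<close> so B(3) False] Drow[OF that] B(5)
        by (simp add: abs_mod_less)
    qed
    moreover have "\<forall>r'. D $ r' $ s' = C $ r' $ s'" by (simp add: D_def c_def)
    ultimately show ?thesis using so \<open>unimodular_equiv A D\<close> by blast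
  qed
  \<comment> \<open>The pivot is moved onto the diagonal: once row \<open>r\<close> is zero outside
    column \<open>s\<close>, adding column \<open>s\<close> to column \<open>r\<close> puts the
    value of the pivot at \<open>(r, r)\<close>. The row is then cleared again, because its entry in
    column \<open>s\<close> is still there.\<close>
  have "\<exists>D. unimodular_equiv A D \<and> split_off I D \<and> D $ r $ r = B $ r $ s"
  proof (cases "r = s")
    case True
    then show ?thesis using B by blast
  next
    case False
    obtain D where D: "unimodular_equiv A D" "split_off I D" "\<forall>r'. D $ r' $ s = B $ r' $ s"
      "\<forall>s''. s'' \<noteq> s \<longrightarrow> D $ r $ s'' = 0"
      using clear_row[OF B(1,2) refl B(4)] by blast
    define c where "c = (\<lambda>u. if u = r then 1 else 0 :: int)"
    define F :: "int^'n^'n" where "F = (\<chi> a b. D $ a $ b + D $ a $ s * c b)"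
    have "c s = 0" using False by (simp add: c_def)
    then have 1: "unimodular_equiv A F"
      unfolding F_def using D unimodular_equiv_column_op unimodular_equiv_trans by blast
    have "D $ a $ s = 0" if "a \<in> I" for a
      using D(2) B(4) that unfolding split_off_def by metis
    then have 2: "split_off I F" using D(2) B(3) by (auto simp: split_off_def F_def c_def)
    have "F $ r $ r = B $ r $ s" using D False by (simp add: F_def c_def)
    with 1 2 show ?thesis by blast
  qed
  then obtain C where C: "unimodular_equiv A C" "split_off I C" "C $ r $ r = B $ r $ s" by blast
  obtain D where D: "unimodular_equiv A D" "split_off I D" "D $ r $ r = B $ r $ s"
    "\<And>u. u \<noteq> r \<Longrightarrow> D $ r $ u = 0"
    using clear_row[OF C B(3)] C by metis
  define c where "c = (\<lambda>u. if u = r then 0 else - (D $ u $ r div D $ r $ r))"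
  define F :: "int^'n^'n" where "F = (\<chi> a b. D $ a $ b + c a * D $ r $ b)"
  have "c r = 0" by (simp add: c_def)
  then have F1: "unimodular_equiv A F"
    unfolding F_def using D unimodular_equiv_row_op unimodular_equiv_trans by blast
  have "D $ b $ r = 0" if "b \<in> I" for b
    using D(2) B(3) that unfolding split_off_def by metis
  then have "c b = 0" if "b \<in> I" for b using that by (simp add: c_def)
  moreover have "D $ r $ a = 0" if "a \<in> I" for a
    using D(2) B(3) that unfolding split_off_def by metis
  ultimately have F2: "split_off I F" using D(2) by (auto simp: split_off_def F_def)
  have Fr: "F $ r $ u = 0" if "u \<noteq> r" for u using D that by (simp add: F_def c_def)
  have Fcol: "F $ u $ r = D $ u $ r mod B $ r $ s" if "u \<noteq> r" for u
    using that D by (simp add: F_def c_def minus_div_mult_eq_mod[symmetric] algebra_simps)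
  have Fc: "F $ u $ r = 0" if "u \<noteq> r" for u
  proof (cases "u \<in> I")
    case True
    then show ?thesis using F2 B(3) unfolding split_off_def by metis
  next
    case False
    then show ?thesis using smaller[OF F1 F2 False B(3)] Fcol[OF that] B(5)
      by (simp add: abs_mod_less)
  qed
  have "split_off (insert r I) F"
    using F2 Fr Fc unfolding split_off_def by (metis insert_iff)
  then show ?thesis using F1 B(3) by (intro exI[of _ F] exI[of _ "insert r I"]) auto
qed

text \<open>No divisibility chain among the diagonal entries is asked for: the Sylow subgroup
  depends only on the power of \<open>p\<close> in each entry.\<close>

lemma int_matrix_diagonalizable:
  fixes A :: "int^'n^'n::finite"
  shows "\<exists>d. unimodular_equiv A (\<chi> i j. if i = j then d i else 0)"
proof -
  have "\<exists>B. unimodular_equiv A B \<and> split_off UNIV B" if "split_off I A" for I and A :: "int^'n^'n"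
    using that
  proof (induction "card (UNIV - I)" arbitrary: A I rule: less_induct)
    case less
    show ?case
    proof (cases "I = UNIV")
      case True
      then show ?thesis using less.prems unimodular_equiv_refl by blast
    next
      case False
      then obtain i where "i \<notin> I" by blast
      from split_off_step[OF less.prems this]
      obtain B J where "unimodular_equiv A B" "split_off J B" "I \<subset> J" by metis
      moreover from this have "card (UNIV - J) < card (UNIV - I)"
        by (intro psubset_card_mono) auto
      ultimately show ?thesis using less.hyps[of J B] unimodular_equiv_trans by metis
    qed
  qed
  from this[of "{}" A] obtain B where B: "unimodular_equiv A B" "split_off UNIV B"
    by (auto simp: split_off_def)
  have eq: "(\<chi> i j. if i = j then B $ i $ i else 0) = B"
    using B(2) by (auto simp: split_off_def vec_eq_iff)
  show ?thesis
    by (rule exI[of _ "\<lambda>i. B $ i $ i"]) (simp only: eq B(1))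
qed

section \<open>Elementary divisors of the critical group\<close>

lemma carrier_int_vec_group: "carrier int_vec_group = UNIV"
  and mult_int_vec_group: "x \<otimes>\<^bsub>int_vec_group\<^esub> y = x + y"
  and one_int_vec_group: "\<one>\<^bsub>int_vec_group\<^esub> = 0"
  by (simp_all add: int_vec_group_def)

lemmas int_vec_group_simps = carrier_int_vec_group mult_int_vec_group one_int_vec_group

lemma comm_group_int_vec_group: "comm_group (int_vec_group :: (int^'n::finite) monoid)"
proof (rule comm_groupI)
  fix x :: "int^'n"
  show "\<exists>y\<in>carrier int_vec_group. y \<otimes>\<^bsub>int_vec_group\<^esub> x = \<one>\<^bsub>int_vec_group\<^esub>"
    by (rule bexI[of _ "- x"]) (simp_all add: int_vec_group_simps)
qed (simp_all add: int_vec_group_simps algebra_simps)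

lemma subgroup_range_matrix: "subgroup (range ((*v) M)) int_vec_group"
  for M :: "int^'n::finite^'m::finite"
proof -
  interpret G: comm_group "int_vec_group :: (int^'m) monoid" by (rule comm_group_int_vec_group)
  have inv: "inv\<^bsub>int_vec_group\<^esub> x = - x" for x :: "int^'m"
    by (rule G.inv_equality) (simp_all add: int_vec_group_simps)
  show ?thesis
  proof (rule G.subgroupI)
    show "range ((*v) M) \<subseteq> carrier int_vec_group" by (simp add: int_vec_group_simps)
    show "range ((*v) M) \<noteq> {}" by simp
  next
    fix a assume "a \<in> range ((*v) M)"
    then obtain x where "a = M *v x" by blast
    then have "- a = M *v (- x)"
      by (simp add: vec_eq_iff matrix_vector_mult_def sum_negf)
    then show "inv\<^bsub>int_vec_group\<^esub> a \<in> range ((*v) M)" unfolding inv by blast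
  next
    fix a b assume "a \<in> range ((*v) M)" "b \<in> range ((*v) M)"
    then obtain x y where "a = M *v x" "b = M *v y" by blast
    then have "a + b = M *v (x + y)" by (simp add: matrix_vector_right_distrib)
    then show "a \<otimes>\<^bsub>int_vec_group\<^esub> b \<in> range ((*v) M)" by (simp add: int_vec_group_simps)
  qed
qed

definition coset_of :: "int^'n::finite^'m::finite \<Rightarrow> int^'m \<Rightarrow> (int^'m) set" where
  "coset_of M y = range ((*v) M) #>\<^bsub>int_vec_group\<^esub> y"

lemma coset_of_eq: "coset_of M y = (\<lambda>x. M *v x + y) ` UNIV"
  by (auto simp: coset_of_def r_coset_def int_vec_group_simps)

lemma coset_of_eq_iff: "coset_of M x = coset_of M y \<longleftrightarrow> x - y \<in> range ((*v) M)"
proof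
  assume "coset_of M x = coset_of M y"
  moreover have "x \<in> coset_of M x" unfolding coset_of_eq by (rule image_eqI[of _ _ 0]) simp_all
  ultimately obtain u where "x = M *v u + y" unfolding coset_of_eq by blast
  then show "x - y \<in> range ((*v) M)" by simp
next
  assume "x - y \<in> range ((*v) M)"
  then obtain u where u: "x - y = M *v u" by blast
  have "M *v w + x = M *v (w + u) + y" "M *v w + y = M *v (w - u) + x" for w
    using u by (simp_all add: matrix_vector_right_distrib matrix_vector_mult_diff_distrib algebra_simps)
  then show "coset_of M x = coset_of M y" unfolding coset_of_eq by blast
qed

lemma
  fixes M :: "int^'n::finite^'m::finite"
  shows comm_group_cokernel: "comm_group (cokernel M)"
    and carrier_cokernel: "carrier (cokernel M) = range (coset_of M)"
    and mult_cokernel: "coset_of M x \<otimes>\<^bsub>cokernel M\<^esub> coset_of M y = coset_of M (x + y)"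
    and one_cokernel: "\<one>\<^bsub>cokernel M\<^esub> = coset_of M 0"
proof -
  interpret G: comm_group "int_vec_group :: (int^'m) monoid" by (rule comm_group_int_vec_group)
  have sub: "subgroup (range ((*v) M)) int_vec_group" by (rule subgroup_range_matrix)
  interpret N: normal "range ((*v) M)" "int_vec_group :: (int^'m) monoid"
    using sub by (rule G.subgroup_imp_normal)
  show "comm_group (cokernel M)"
    unfolding cokernel_def using sub by (rule G.abelian_FactGroup)
  show "carrier (cokernel M) = range (coset_of M)"
    unfolding cokernel_def FactGroup_def RCOSETS_def coset_of_def
    by (auto simp: int_vec_group_simps)
  show "coset_of M x \<otimes>\<^bsub>cokernel M\<^esub> coset_of M y = coset_of M (x + y)"
    using N.rcos_sum[of x y] unfolding cokernel_def FactGroup_def coset_of_def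
    by (simp add: int_vec_group_simps)
  show "\<one>\<^bsub>cokernel M\<^esub> = coset_of M 0"
    unfolding cokernel_def FactGroup_def coset_of_eq by simp
qed

lemma pow_cokernel: "coset_of M x [^]\<^bsub>cokernel M\<^esub> n = coset_of M (int n *s x)"
proof (induction n)
  case 0
  then show ?case by (simp add: one_cokernel)
next
  case (Suc n)
  have "int n *s x + x = int (Suc n) *s x" by (simp add: vec_eq_iff algebra_simps)
  then show ?case using Suc by (simp add: mult_cokernel add.commute)
qed

lemma scaled_matrix_vector: "(A :: int^'n::finite^'m::finite) *v (c *s x) = c *s (A *v x)"
  by (simp add: vec_eq_iff matrix_vector_mult_def sum_distrib_left algebra_simps)

lemma product_group_pow:
  assumes "\<And>i. i \<in> I \<Longrightarrow> group (G i)" "x \<in> carrier (product_group I G)"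
  shows "x [^]\<^bsub>product_group I G\<^esub> (n::nat) = (\<lambda>i\<in>I. x i [^]\<^bsub>G i\<^esub> n)"
proof (induction n)
  case 0
  then show ?case by simp
next
  case (Suc n)
  show ?case by (auto simp: Suc.IH intro!: restrict_ext)
qed

section \<open>Uniqueness of the cyclic factors from torsion counts\<close>

lemma iso_preserves_exponent_count:
  assumes "group G" "group H" "G \<cong> H"
  shows "card {x \<in> carrier G. x [^]\<^bsub>G\<^esub> (r::nat) = \<one>\<^bsub>G\<^esub>} = card {x \<in> carrier H. x [^]\<^bsub>H\<^esub> r = \<one>\<^bsub>H\<^esub>}"
proof -
  obtain f where f: "f \<in> iso G H" using assms(3) by (auto simp: is_iso_def)
  interpret group_hom G H f
    using assms f by (simp add: group_hom_def group_hom_axioms_def iso_def)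
  have bij: "bij_betw f (carrier G) (carrier H)" using f by (simp add: iso_def)
  have "f x [^]\<^bsub>H\<^esub> r = \<one>\<^bsub>H\<^esub> \<longleftrightarrow> x [^]\<^bsub>G\<^esub> r = \<one>\<^bsub>G\<^esub>" if x: "x \<in> carrier G" for x
  proof -
    have "f x [^]\<^bsub>H\<^esub> r = f (x [^]\<^bsub>G\<^esub> r)" using x by (simp add: hom_nat_pow)
    moreover have "f (x [^]\<^bsub>G\<^esub> r) = f \<one>\<^bsub>G\<^esub> \<longleftrightarrow> x [^]\<^bsub>G\<^esub> r = \<one>\<^bsub>G\<^esub>"
      using bij x by (intro inj_on_eq_iff[of f "carrier G"]) (auto simp: bij_betw_def)
    ultimately show ?thesis by simp
  qed
  then have "bij_betw f {x \<in> carrier G. x [^]\<^bsub>G\<^esub> r = \<one>\<^bsub>G\<^esub>} {x \<in> carrier H. x [^]\<^bsub>H\<^esub> r = \<one>\<^bsub>H\<^esub>}"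
    by (intro bij_betw_Collect[OF bij])
  then show ?thesis by (rule bij_betw_same_card)
qed

text \<open>With \<open>g = gcd r n\<close> the condition says that \<open>x\<close> is a multiple
  of \<open>n div g\<close>, and there are \<open>g\<close> of these below \<open>n\<close>.\<close>

lemma card_integer_mod_torsion:
  assumes "n > 0"
  shows "card {x \<in> {0..<int n}. int r * x mod int n = 0} = gcd r n"
proof -
  define g where "g = gcd r n"
  obtain n' r' where n': "n = g * n'" "r = g * r'"
    unfolding g_def by (meson dvdE gcd_dvd1 gcd_dvd2)
  have g: "g > 0" using assms by (simp add: g_def)
  have n'pos: "n' > 0" using assms n' by auto
  have "coprime r' n'"
    using g n' unfolding g_def by (metis div_gcd_coprime gr_implies_not0 nonzero_mult_div_cancel_left gcd_eq_0_iff)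
  then have cop: "coprime (int n') (int r')" by (simp add: coprime_commute)
  have "int r * x mod int n = 0 \<longleftrightarrow> int n' dvd x" for x
  proof -
    have "int r * x mod int n = 0 \<longleftrightarrow> int g * int n' dvd int g * (int r' * x)"
      by (simp add: n' mod_eq_0_iff_dvd mult.assoc)
    also have "\<dots> \<longleftrightarrow> int n' dvd int r' * x" using g by simp
    also have "\<dots> \<longleftrightarrow> int n' dvd x" using cop by (rule coprime_dvd_mult_right_iff)
    finally show ?thesis .
  qed
  then have "{x \<in> {0..<int n}. int r * x mod int n = 0} = (\<lambda>j. int n' * j) ` {0..<int g}"
    using n'pos by (auto simp: n' elim!: dvdE simp: zero_le_mult_iff mult.commute)
  also have "card \<dots> = g"
    using n'pos by (subst card_image) (auto simp: inj_on_def)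
  finally show ?thesis by (simp add: g_def)
qed

abbreviation cyclic_product :: "nat list \<Rightarrow> (nat \<Rightarrow> int) monoid" where
  "cyclic_product ns \<equiv> product_group {..<length ns} (\<lambda>i. integer_mod_group (ns ! i))"

lemma card_cyclic_product_torsion:
  assumes "\<And>n. n \<in> set ns \<Longrightarrow> n > 0"
  shows "card {x \<in> carrier (cyclic_product ns). x [^]\<^bsub>cyclic_product ns\<^esub> r = \<one>\<^bsub>cyclic_product ns\<^esub>}
    = (\<Prod>n\<leftarrow>ns. gcd r n)"
proof -
  have pos: "ns ! i > 0" if "i < length ns" for i using assms that by simp
  have "{x \<in> carrier (cyclic_product ns). x [^]\<^bsub>cyclic_product ns\<^esub> r = \<one>\<^bsub>cyclic_product ns\<^esub>}
      = PiE {..<length ns} (\<lambda>i. {x \<in> {0..<int (ns ! i)}. int r * x mod int (ns ! i) = 0})" (is "?A = ?B")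
  proof -
    have "x [^]\<^bsub>cyclic_product ns\<^esub> r = \<one>\<^bsub>cyclic_product ns\<^esub> \<longleftrightarrow>
        (\<forall>i<length ns. int r * x i mod int (ns ! i) = 0)" if "x \<in> carrier (cyclic_product ns)" for x
    proof -
      have "x [^]\<^bsub>cyclic_product ns\<^esub> r = (\<lambda>i\<in>{..<length ns}. int r * x i mod int (ns ! i))"
        using product_group_pow[OF _ that, of r] by simp
      moreover have "\<one>\<^bsub>cyclic_product ns\<^esub> = (\<lambda>i\<in>{..<length ns}. 0)" by simp
      moreover have "restrict f A = restrict g A \<longleftrightarrow> (\<forall>i\<in>A. f i = g i)" for f g :: "nat \<Rightarrow> int" and A
        by (auto simp: restrict_def fun_eq_iff)
      ultimately show ?thesis by (simp add: Ball_def)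
    qed
    then have "?A = {x \<in> carrier (cyclic_product ns). \<forall>i<length ns. int r * x i mod int (ns ! i) = 0}"
      by (intro Collect_cong conj_cong refl)
    also have "\<dots> = ?B"
      using pos by (auto simp: PiE_iff carrier_integer_mod_group extensional_def)
    finally show ?thesis .
  qed
  then have "card ?A = (\<Prod>i<length ns. card {x \<in> {0..<int (ns ! i)}. int r * x mod int (ns ! i) = 0})"
    by (simp add: card_PiE)
  also have "\<dots> = (\<Prod>i<length ns. gcd r (ns ! i))"
    using card_integer_mod_torsion[OF pos] by (intro prod.cong) simp_all
  also have "\<dots> = (\<Prod>n\<leftarrow>ns. gcd r n)"
    by (simp add: prod.list_conv_set_nth atLeast0LessThan)
  finally show ?thesis .
qed

lemma multiplicity_gcd_prime_power:
  fixes P n :: nat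
  assumes "prime P" "n > 0"
  shows "multiplicity P (gcd (P ^ e) n) = min e (multiplicity P n)"
proof (rule multiplicity_eqI)
  show "P ^ min e (multiplicity P n) dvd gcd (P ^ e) n"
    by (simp add: le_imp_power_dvd multiplicity_dvd')
  show "\<not> P ^ Suc (min e (multiplicity P n)) dvd gcd (P ^ e) n"
  proof
    assume "P ^ Suc (min e (multiplicity P n)) dvd gcd (P ^ e) n"
    then have 1: "P ^ Suc (min e (multiplicity P n)) dvd P ^ e" "P ^ Suc (min e (multiplicity P n)) dvd n"
      by simp_all
    then have "Suc (min e (multiplicity P n)) \<le> e"
      using prime_gt_1_nat[OF assms(1)] power_dvd_imp_le by blast
    moreover have "Suc (min e (multiplicity P n)) \<le> multiplicity P n"
      using 1(2) assms by (intro multiplicity_geI) auto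
    ultimately show False by simp
  qed
qed

lemma multiplicity_prod_list:
  assumes "prime (P::nat)" "0 \<notin> set xs"
  shows "multiplicity P (prod_list xs) = (\<Sum>x\<leftarrow>xs. multiplicity P x)"
  using assms(2)
  by (induction xs) (use assms(1) in \<open>auto simp: prime_elem_multiplicity_mult_distrib prod_list_zero_iff\<close>)

text \<open>The number of elements killed by \<open>P ^ e\<close> is an isomorphism invariant; its
  \<open>P\<close>-adic valuation is the sum of \<open>min e (multiplicity P n)\<close> over the
  factors. A first difference in \<open>e\<close> counts the factors of valuation above
  \<open>e\<close>, and a second one those equal to \<open>P ^ Suc e\<close>.\<close>

lemma cyclic_product_iso_imp_mset_eq:
  assumes iso: "cyclic_product ns \<cong> cyclic_product ms"
    and ns: "\<And>n. n \<in> set ns \<Longrightarrow> primepow n" and ms: "\<And>n. n \<in> set ms \<Longrightarrow> primepow n"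
  shows "mset ns = mset ms"
proof -
  have pos: "n > 0" if "primepow n" for n :: nat
    using that by (rule primepow_gt_0_nat)
  have prod_eq: "(\<Prod>n\<leftarrow>ns. gcd r n) = (\<Prod>n\<leftarrow>ms. gcd r n)" for r
  proof (rule box_equals)
    show "card {x \<in> carrier (cyclic_product ns). x [^]\<^bsub>cyclic_product ns\<^esub> r = \<one>\<^bsub>cyclic_product ns\<^esub>}
      = card {x \<in> carrier (cyclic_product ms). x [^]\<^bsub>cyclic_product ms\<^esub> r = \<one>\<^bsub>cyclic_product ms\<^esub>}"
      by (intro iso_preserves_exponent_count iso) simp_all
  qed (use ns ms pos in \<open>blast intro: card_cyclic_product_torsion\<close>)+
  have sum_eq: "(\<Sum>n\<leftarrow>ns. min e (multiplicity P n)) = (\<Sum>n\<leftarrow>ms. min e (multiplicity P n))"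
    if P: "prime P" for P e
  proof -
    have *: "multiplicity P (\<Prod>n\<leftarrow>xs. gcd (P ^ e) n) = (\<Sum>n\<leftarrow>xs. min e (multiplicity P n))"
      if "\<And>n. n \<in> set xs \<Longrightarrow> primepow n" for xs
    proof -
      have "multiplicity P (\<Prod>n\<leftarrow>xs. gcd (P ^ e) n) = (\<Sum>n\<leftarrow>xs. multiplicity P (gcd (P ^ e) n))"
        using P that pos by (subst multiplicity_prod_list) (auto simp: o_def)
      also have "\<dots> = (\<Sum>n\<leftarrow>xs. min e (multiplicity P n))"
        using P that pos by (intro arg_cong[of _ _ sum_list] map_cong) (auto simp: multiplicity_gcd_prime_power)
      finally show ?thesis .
    qed
    show ?thesis using *[of ns] *[of ms] ns ms prod_eq[of "P ^ e"] by simp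
  qed
  have ge: "(\<Sum>n\<leftarrow>xs. min (Suc e) (multiplicity P n)) = (\<Sum>n\<leftarrow>xs. min e (multiplicity P n))
      + length (filter (\<lambda>n. multiplicity P n > e) xs)" for xs P e
    by (induction xs) auto
  have len: "length (filter (\<lambda>n. multiplicity P n > e) ns) = length (filter (\<lambda>n. multiplicity P n > e) ms)"
    if "prime P" for P e
    using sum_eq[OF that, of e] sum_eq[OF that, of "Suc e"] unfolding ge by linarith
  have cnt: "length (filter (\<lambda>n. multiplicity P n > e) xs) = count (mset xs) (P ^ Suc e)
      + length (filter (\<lambda>n. multiplicity P n > Suc e) xs)"
    if P: "prime P" and "\<And>n. n \<in> set xs \<Longrightarrow> primepow n" for xs P e
    using that(2)
  proof (induction xs)
    case Nil
    then show ?case by simp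
  next
    case (Cons n xs)
    have "n = P ^ Suc e \<longleftrightarrow> multiplicity P n = Suc e"
    proof
      assume "n = P ^ Suc e"
      then show "multiplicity P n = Suc e" using P by (simp del: power_Suc)
    next
      assume m: "multiplicity P n = Suc e"
      obtain p' k where pk: "prime p'" "k > 0" "n = p' ^ k"
        using Cons.prems[of n] unfolding primepow_def by auto
      have "P dvd n" using m by (metis dvd_0_right not_dvd_imp_multiplicity_0 nat.distinct(1))
      then have "P = p'" using pk P by (metis prime_dvd_power primes_dvd_imp_eq)
      then have "multiplicity P n = k" using pk P by simp
      then show "n = P ^ Suc e" using m pk \<open>P = p'\<close> by simp
    qed
    then show ?case using Cons by auto
  qed
  have "count (mset ns) a = count (mset ms) a" for a
  proof (cases "primepow a")
    case True
    then obtain P k where "prime P" "k > 0" "a = P ^ k" unfolding primepow_def by auto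
    then obtain e where "prime P" "a = P ^ Suc e" by (metis gr0_implies_Suc)
    then show ?thesis
      using cnt[of P ns e] cnt[of P ms e] len[of P e] len[of P "Suc e"] ns ms by simp
  next
    case False
    then have "a \<notin> set ns" "a \<notin> set ms" using ns ms by auto
    then show ?thesis by (metis count_eq_zero_iff set_mset_mset)
  qed
  then show ?thesis by (rule multiset_eqI)
qed

lemma elementary_divisors_eqI:
  assumes "G \<cong> cyclic_product ns" "group G" "\<And>n. n \<in> set ns \<Longrightarrow> primepow n"
  shows "elementary_divisors G = mset ns"
  unfolding elementary_divisors_def
proof (rule the_equality)
  show "(\<forall>n\<in>#mset ns. primepow n) \<and> (\<exists>ms. mset ms = mset ns \<and> G \<cong> cyclic_product ms)"
    using assms by auto
next
  fix M assume M: "(\<forall>n\<in>#M. primepow n) \<and> (\<exists>ms. mset ms = M \<and> G \<cong> cyclic_product ms)"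
  then obtain ms where ms: "mset ms = M" "G \<cong> cyclic_product ms" by blast
  have "cyclic_product ms \<cong> cyclic_product ns"
    using group.iso_sym[OF assms(2) ms(2)] assms(1) by (rule iso_trans)
  then have "mset ms = mset ns"
    using M ms assms(3) by (intro cyclic_product_iso_imp_mset_eq) auto
  with ms show "M = mset ns" by simp
qed

lemma multiplicity_nat_abs:
  assumes "prime p" "a \<noteq> 0"
  shows "multiplicity p (nat \<bar>a\<bar>) = multiplicity (int p) a"
proof (rule multiplicity_eqI)
  have dvd_iff: "p ^ n dvd nat \<bar>a\<bar> \<longleftrightarrow> int p ^ n dvd a" for n
    by (metis abs_ge_zero dvd_abs_iff int_dvd_int_iff nat_0_le of_nat_power)
  show "p ^ multiplicity (int p) a dvd nat \<bar>a\<bar>" by (simp add: dvd_iff multiplicity_dvd)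
  show "\<not> p ^ Suc (multiplicity (int p) a) dvd nat \<bar>a\<bar>"
  proof
    assume "p ^ Suc (multiplicity (int p) a) dvd nat \<bar>a\<bar>"
    then have "Suc (multiplicity (int p) a) \<le> multiplicity (int p) a"
      using assms prime_gt_1_nat[OF assms(1)] unfolding dvd_iff by (intro multiplicity_geI) auto
    then show False by simp
  qed
qed

section \<open>The torsion group and the Sylow subgroup of a diagonalized matrix\<close>

locale diagonalized =
  fixes L P P' Q Q' :: "int^'n::finite^'n" and d :: "'n \<Rightarrow> int"
  assumes inv: "P ** P' = mat 1" "P' ** P = mat 1" "Q ** Q' = mat 1" "Q' ** Q = mat 1"
    and diag: "(\<chi> i j. if i = j then d i else 0) = P ** L ** Q"
begin

lemma diag_vec: "((P ** L ** Q) *v x) $ i = d i * x $ i"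
  by (simp add: diag[symmetric] matrix_vector_mult_def if_distrib[of "\<lambda>u. u * _"] cong: if_cong)

lemma PP'_vec: "P *v (P' *v x) = x" "P' *v (P *v x) = x" "Q *v (Q' *v x) = x" "Q' *v (Q *v x) = x"
  by (simp_all add: matrix_vector_mul_assoc inv)

lemma in_range_iff: "y \<in> range ((*v) L) \<longleftrightarrow> (\<forall>i. d i dvd (P *v y) $ i)"
proof
  assume "y \<in> range ((*v) L)"
  then obtain x where "y = L *v x" by blast
  then have "P *v y = (P ** L ** Q) *v (Q' *v x)"
    by (simp add: PP'_vec flip: matrix_vector_mul_assoc)
  then show "\<forall>i. d i dvd (P *v y) $ i" by (simp only: diag_vec) simp
next
  assume "\<forall>i. d i dvd (P *v y) $ i"
  then obtain f where f: "\<And>i. (P *v y) $ i = d i * f i" unfolding dvd_def by metis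
  have "P *v y = (P ** L ** Q) *v (\<chi> i. f i)"
    by (simp only: vec_eq_iff diag_vec f) simp
  then have "P' *v (P *v y) = P' *v (P *v (L *v (Q *v (\<chi> i. f i))))"
    by (simp add: matrix_vector_mul_assoc matrix_mul_assoc)
  then have "y = L *v (Q *v (\<chi> i. f i))" by (simp only: PP'_vec)
  then show "y \<in> range ((*v) L)" by blast
qed

lemma coset_eq_iff: "coset_of L x = coset_of L y \<longleftrightarrow> (\<forall>i. d i dvd (P *v x) $ i - (P *v y) $ i)"
  by (simp add: coset_of_eq_iff in_range_iff matrix_vector_mult_diff_distrib)

lemma coset_pow_one_iff:
  "coset_of L y [^]\<^bsub>cokernel L\<^esub> n = \<one>\<^bsub>cokernel L\<^esub> \<longleftrightarrow> (\<forall>i. d i dvd int n * (P *v y) $ i)"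
  by (simp add: pow_cokernel one_cokernel coset_eq_iff scaled_matrix_vector)

definition nonzero :: "'n set" where "nonzero = {i. d i \<noteq> 0}"

lemma carrier_critical:
  "carrier (critical_group L) = coset_of L ` {y. \<forall>i. i \<notin> nonzero \<longrightarrow> (P *v y) $ i = 0}"
proof -
  have "(\<exists>n::nat. n > 0 \<and> coset_of L y [^]\<^bsub>cokernel L\<^esub> n = \<one>\<^bsub>cokernel L\<^esub>) \<longleftrightarrow>
      (\<forall>i. i \<notin> nonzero \<longrightarrow> (P *v y) $ i = 0)" for y
  proof
    assume "\<exists>n::nat. n > 0 \<and> coset_of L y [^]\<^bsub>cokernel L\<^esub> n = \<one>\<^bsub>cokernel L\<^esub>"
    then obtain n :: nat where "n > 0" "\<forall>i. d i dvd int n * (P *v y) $ i"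
      by (auto simp: coset_pow_one_iff)
    then show "\<forall>i. i \<notin> nonzero \<longrightarrow> (P *v y) $ i = 0"
      by (auto simp: nonzero_def) (metis dvd_0_left mult_eq_0_iff of_nat_0_less_iff order_less_irrefl)
  next
    assume *: "\<forall>i. i \<notin> nonzero \<longrightarrow> (P *v y) $ i = 0"
    \<comment> \<open>The product of the nonzero diagonal entries annihilates all of these cosets at
      once.\<close>
    define n where "n = nat (\<Prod>i\<in>nonzero. \<bar>d i\<bar>)"
    have pos: "(\<Prod>i\<in>nonzero. \<bar>d i\<bar>) > 0" by (rule prod_pos) (simp add: nonzero_def)
    then have n: "int n = (\<Prod>i\<in>nonzero. \<bar>d i\<bar>)" "n > 0" by (simp_all add: n_def)
    have "d i dvd int n * (P *v y) $ i" for i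
    proof (cases "i \<in> nonzero")
      case True
      then have "\<bar>d i\<bar> dvd int n" unfolding n(1) by (intro dvd_prodI) simp_all
      then show ?thesis by simp
    next
      case False
      then show ?thesis using * by simp
    qed
    then show "\<exists>n::nat. n > 0 \<and> coset_of L y [^]\<^bsub>cokernel L\<^esub> n = \<one>\<^bsub>cokernel L\<^esub>"
      using n(2) by (auto simp: coset_pow_one_iff)
  qed
  then show ?thesis
    unfolding critical_group_def torsion_part_def by (auto simp: carrier_cokernel)
qed

lemma critical_group_simps:
  "monoid.mult (critical_group L) = monoid.mult (cokernel L)" "\<one>\<^bsub>critical_group L\<^esub> = \<one>\<^bsub>cokernel L\<^esub>"
  by (simp_all add: critical_group_def torsion_part_def)

lemma subgroup_cosetsI:
  assumes "Y 0" "\<And>x y. Y x \<Longrightarrow> Y y \<Longrightarrow> Y (x - y)"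
  shows "subgroup (coset_of L ` {y. Y y}) (cokernel L)"
proof -
  interpret comm_group "cokernel L" by (rule comm_group_cokernel)
  have uminus: "Y (- x)" if "Y x" for x using assms(2)[OF assms(1) that] by simp
  have plus: "Y (x + y)" if "Y x" "Y y" for x y using assms(2)[OF that(1) uminus[OF that(2)]] by simp
  have inv: "inv\<^bsub>cokernel L\<^esub> (coset_of L x) = coset_of L (- x)" for x
    by (rule inv_equality) (simp_all add: mult_cokernel one_cokernel carrier_cokernel)
  show ?thesis
  proof (rule subgroupI)
    show "coset_of L ` {y. Y y} \<subseteq> carrier (cokernel L)" by (auto simp: carrier_cokernel)
    show "coset_of L ` {y. Y y} \<noteq> {}" using assms(1) by auto
  next
    fix a assume "a \<in> coset_of L ` {y. Y y}"
    then show "inv\<^bsub>cokernel L\<^esub> a \<in> coset_of L ` {y. Y y}" using inv uminus by auto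
  next
    fix a b assume "a \<in> coset_of L ` {y. Y y}" "b \<in> coset_of L ` {y. Y y}"
    then show "a \<otimes>\<^bsub>cokernel L\<^esub> b \<in> coset_of L ` {y. Y y}" using plus by (auto simp: mult_cokernel)
  qed
qed

lemma group_critical: "group (critical_group L)"
proof -
  have "critical_group L = (cokernel L)\<lparr>carrier := carrier (critical_group L)\<rparr>"
    by (simp add: critical_group_def torsion_part_def)
  moreover have "subgroup (carrier (critical_group L)) (cokernel L)"
    unfolding carrier_critical
    by (rule subgroup_cosetsI) (simp_all add: matrix_vector_mult_diff_distrib)
  ultimately show ?thesis
    using comm_group_cokernel[of L]
    by (metis comm_group.axioms(2) group.subgroup_imp_group)
qed


text \<open>The coordinates \<open>P *v y\<close> identify the cokernel with the product of the groups
  \<open>\<int> / d i\<close>; factoring \<open>d i\<close> as \<open>m i * u i\<close> picks out the subgroup \<open>u i * \<int> / d i\<close> in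
  each factor.\<close>

context
  fixes m u :: "'n \<Rightarrow> int"
  assumes d_eq: "\<And>i. \<bar>d i\<bar> = m i * u i"
    and m_pos: "\<And>i. m i > 0" and m_eq_1: "\<And>i. d i = 0 \<Longrightarrow> m i = 1"
begin

definition scaled_coset :: "('n \<Rightarrow> int) \<Rightarrow> (int^'n) set" where
  "scaled_coset w = coset_of L (P' *v (\<chi> i. u i * w i))"

lemma d_dvd_iff: "d i dvd x \<longleftrightarrow> m i * u i dvd x"
  using d_eq[of i] by (metis abs_dvd_iff)

lemma bij_betw_scaled_coset:
  "bij_betw scaled_coset (PiE UNIV (\<lambda>i. {0..<m i})) (coset_of L ` {y. \<forall>i. u i dvd (P *v y) $ i})"
  (is "bij_betw ?f ?A ?B")
  unfolding bij_betw_def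
proof
  show "inj_on ?f ?A"
  proof (rule inj_onI)
    fix v w assume v: "v \<in> ?A" and w: "w \<in> ?A" and eq: "?f v = ?f w"
    have "v i = w i" for i
    proof -
      have 1: "m i * u i dvd u i * (v i - w i)"
        using eq by (simp add: scaled_coset_def coset_eq_iff PP'_vec d_dvd_iff algebra_simps)
      have 2: "v i \<in> {0..<m i}" "w i \<in> {0..<m i}" using v w by auto
      show ?thesis
      proof (cases "u i = 0")
        case False
        then have "m i dvd v i - w i" using 1 by (simp add: mult.commute)
        then show ?thesis using 2
          by (metis atLeastLessThan_iff mod_eq_dvd_iff mod_pos_pos_trivial)
      next
        case True
        then have "m i = 1" using d_eq[of i] m_eq_1[of i] by simp
        then show ?thesis using 2 by simp
      qed
    qed
    then show "v = w" by blast
  qed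
  show "?f ` ?A = ?B"
  proof
    show "?f ` ?A \<subseteq> ?B"
      by (auto simp: scaled_coset_def PP'_vec intro!: imageI)
    show "?B \<subseteq> ?f ` ?A"
    proof
      fix b assume "b \<in> ?B"
      then obtain y where y: "b = coset_of L y" "\<forall>i. u i dvd (P *v y) $ i" by blast
      then obtain f where f: "\<And>i. (P *v y) $ i = u i * f i" unfolding dvd_def by metis
      define w where "w = (\<lambda>i. f i mod m i)"
      have "m i * u i dvd u i * f i - u i * w i" for i
      proof -
        have "u i * f i = u i * (m i * (f i div m i)) + u i * (f i mod m i)"
          by (metis distrib_left mult_div_mod_eq)
        moreover have "u i * (m i * (f i div m i)) = (m i * u i) * (f i div m i)" by simp
        ultimately have "u i * f i - u i * w i = (m i * u i) * (f i div m i)"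
          unfolding w_def by linarith
        then show ?thesis by simp
      qed
      then have "b = ?f w"
        by (simp add: y(1) scaled_coset_def coset_eq_iff PP'_vec d_dvd_iff f)
      moreover have "w \<in> ?A" using m_pos by (auto simp: w_def)
      ultimately show "b \<in> ?f ` ?A" by blast
    qed
  qed
qed

lemma card_scaled_cosets:
  "finite (coset_of L ` {y. \<forall>i. u i dvd (P *v y) $ i})"
  "card (coset_of L ` {y. \<forall>i. u i dvd (P *v y) $ i}) = (\<Prod>i\<in>UNIV. nat (m i))"
proof -
  have "finite (PiE UNIV (\<lambda>i. {0..<m i}))" by (intro finite_PiE) auto
  then show "finite (coset_of L ` {y. \<forall>i. u i dvd (P *v y) $ i})"
    using bij_betw_finite[OF bij_betw_scaled_coset] by blast
  show "card (coset_of L ` {y. \<forall>i. u i dvd (P *v y) $ i}) = (\<Prod>i\<in>UNIV. nat (m i))"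
    using bij_betw_same_card[OF bij_betw_scaled_coset] by (simp add: card_PiE)
qed

text \<open>Indices with \<open>m i = 1\<close> give trivial factors and are dropped, since an
  elementary divisor must be a prime power greater than 1; \<open>g\<close> enumerates the others,
  and \<open>e\<close> fills the dropped coordinates with 0.\<close>

lemma scaled_cosets_iso_cyclic_product:
  assumes g: "bij_betw g {..<k} {i. m i > 1}"
  shows "cyclic_product (map (\<lambda>j. nat (m (g j))) [0..<k]) \<cong>
    (cokernel L)\<lparr>carrier := coset_of L ` {y. \<forall>i. u i dvd (P *v y) $ i}\<rparr>" (is "cyclic_product ?ns \<cong> ?T")
proof -
  define g' where "g' = inv_into {..<k} g"
  have g': "g' i < k \<and> g (g' i) = i" if "m i > 1" for i
    using that g unfolding g'_def bij_betw_def
    by (metis (mono_tags, lifting) f_inv_into_f inv_into_into lessThan_iff mem_Collect_eq)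
  have gg: "m (g j) > 1 \<and> g' (g j) = j" if "j < k" for j
    using that g unfolding g'_def bij_betw_def by (metis imageI inv_into_f_f lessThan_iff mem_Collect_eq)
  define e where "e = (\<lambda>(w :: nat \<Rightarrow> int) i. if m i > 1 then w (g' i) else 0)"
  have car: "carrier (cyclic_product ?ns) = PiE {..<k} (\<lambda>j. {0..<m (g j)})"
  proof -
    have "carrier (integer_mod_group (?ns ! j)) = {0..<m (g j)}" if "j < k" for j
      using gg[OF that] that by (simp add: carrier_integer_mod_group)
    moreover have "{..<length ?ns} = {..<k}" by simp
    ultimately show ?thesis
      by (simp only: carrier_product_group) (intro PiE_cong, simp)
  qed
  have "bij_betw e (PiE {..<k} (\<lambda>j. {0..<m (g j)})) (PiE UNIV (\<lambda>i. {0..<m i}))"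
  proof (rule bij_betw_byWitness[where f' = "\<lambda>v. \<lambda>j\<in>{..<k}. v (g j)"])
    show "\<forall>w\<in>PiE {..<k} (\<lambda>j. {0..<m (g j)}). (\<lambda>j\<in>{..<k}. e w (g j)) = w"
      using gg by (auto simp: e_def fun_eq_iff PiE_iff extensional_def restrict_def)
    have "v i = 0" if "v \<in> PiE UNIV (\<lambda>i. {0..<m i})" "\<not> m i > 1" for v i
    proof -
      have "v i \<in> {0..<m i}" using that(1) by auto
      then show ?thesis using that(2) by simp
    qed
    then show "\<forall>v\<in>PiE UNIV (\<lambda>i. {0..<m i}). e (\<lambda>j\<in>{..<k}. v (g j)) = v"
      using g' by (auto simp: e_def fun_eq_iff)
    show "e ` PiE {..<k} (\<lambda>j. {0..<m (g j)}) \<subseteq> PiE UNIV (\<lambda>i. {0..<m i})"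
    proof
      fix v assume "v \<in> e ` PiE {..<k} (\<lambda>j. {0..<m (g j)})"
      then obtain w where w: "v = e w" "\<And>j. j < k \<Longrightarrow> w j \<in> {0..<m (g j)}" by (auto simp: PiE_iff)
      have "v i \<in> {0..<m i}" for i
      proof (cases "m i > 1")
        case True
        then have "w (g' i) \<in> {0..<m (g (g' i))}" using g' w(2) by blast
        then show ?thesis using True g'[OF True] w(1) by (simp add: e_def)
      next
        case False
        then show ?thesis using w(1) m_pos[of i] by (simp add: e_def)
      qed
      then show "v \<in> PiE UNIV (\<lambda>i. {0..<m i})" by (auto simp: PiE_iff)
    qed
    show "(\<lambda>v. \<lambda>j\<in>{..<k}. v (g j)) ` PiE UNIV (\<lambda>i. {0..<m i}) \<subseteq> PiE {..<k} (\<lambda>j. {0..<m (g j)})"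
      by (auto simp: PiE_iff extensional_def split: if_splits)
  qed
  from bij_betw_trans[OF this bij_betw_scaled_coset]
  have bij: "bij_betw (scaled_coset \<circ> e) (carrier (cyclic_product ?ns)) (carrier ?T)"
    unfolding car by simp
  have "scaled_coset (e (v \<otimes>\<^bsub>cyclic_product ?ns\<^esub> w)) = scaled_coset (e v) \<otimes>\<^bsub>cokernel L\<^esub> scaled_coset (e w)"
    for v w
  proof -
    have "m i * u i dvd u i * e (v \<otimes>\<^bsub>cyclic_product ?ns\<^esub> w) i - (u i * e v i + u i * e w i)" for i
    proof (cases "m i > 1")
      case True
      then have eq: "e (v \<otimes>\<^bsub>cyclic_product ?ns\<^esub> w) i = (e v i + e w i) mod m i"
        using g'[OF True] by (simp add: e_def)
      have *: "b * (y mod a) - b * y = - (a * b * (y div a))" for a b y :: int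
        by (simp add: minus_div_mult_eq_mod[symmetric] algebra_simps)
      show ?thesis unfolding eq distrib_left[symmetric] * by simp
    next
      case False
      then show ?thesis by (simp add: e_def)
    qed
    then show ?thesis
      by (simp add: scaled_coset_def mult_cokernel coset_eq_iff PP'_vec d_dvd_iff
          matrix_vector_right_distrib del: mult_product_group)
  qed
  then have "scaled_coset \<circ> e \<in> hom (cyclic_product ?ns) ?T"
    by (intro homI bij_betw_apply[OF bij]) (simp_all del: mult_product_group)
  then have "scaled_coset \<circ> e \<in> iso (cyclic_product ?ns) ?T"
    using bij by (simp only: iso_def mem_Collect_eq)
  then show ?thesis by (auto simp: is_iso_def)
qed

end

text \<open>The description of subgroups by factorizations of \<open>\<bar>d i\<bar>\<close> is used
  twice: with \<open>m\<close>, the \<open>p\<close>-part of each entry, it gives the Sylow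
  subgroup, and with \<open>a\<close> it gives the whole torsion group and thereby its order.
  Setting \<open>v i = 0\<close> where \<open>d i = 0\<close> makes the free coordinates disappear
  from the Sylow subgroup.\<close>

theorem elem_div_mult_critical_group:
  assumes p: "prime p" and j: "j > 0"
  shows "elem_div_mult p j (critical_group L) = card {i. d i \<noteq> 0 \<and> multiplicity (int p) (d i) = j}"
proof -
  let ?C = "critical_group L"
  define v where "v = (\<lambda>i. if d i = 0 then 0 else multiplicity (int p) (d i))"
  define m where "m = (\<lambda>i. int p ^ v i)"
  define u where "u = (\<lambda>i. \<bar>d i\<bar> div m i)"
  have p1: "p > 1" using p by (rule prime_gt_1_nat)
  have pint: "prime (int p)" using p by simp
  have mu: "\<bar>d i\<bar> = m i * u i" for i
    by (simp add: m_def u_def v_def multiplicity_dvd)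
  have m_pos: "m i > 0" for i using p1 by (simp add: m_def)
  have m_eq_1: "m i = 1" if "d i = 0" for i using that by (simp add: m_def v_def)
  have u_coprime: "coprime (int p) (u i)" if "d i \<noteq> 0" for i
  proof -
    have "\<not> int p dvd u i"
    proof
      assume "int p dvd u i"
      then have "int p ^ Suc (v i) dvd d i"
        using mu[of i] by (metis m_def abs_dvd_iff dvd_abs_iff mult_dvd_mono dvd_refl power_Suc2 dvd_trans)
      then have "Suc (v i) \<le> multiplicity (int p) (d i)"
        using that p1 by (intro multiplicity_geI) auto
      then show False using that by (simp add: v_def)
    qed
    then show ?thesis using pint by (simp add: prime_imp_coprime)
  qed
  \<comment> \<open>The condition that \<open>b i\<close> divides the coordinate forces it to vanish
    where \<open>d i = 0\<close> and is void elsewhere, so these cosets are exactly the torsion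
    elements.\<close>
  define a where "a = (\<lambda>i. if d i = 0 then 1 else \<bar>d i\<bar>)"
  define b where "b = (\<lambda>i. if d i = 0 then 0 else 1 :: int)"
  have ab: "\<bar>d i\<bar> = a i * b i" "a i > 0" "d i = 0 \<Longrightarrow> a i = 1" for i by (simp_all add: a_def b_def)
  have carrier_C: "carrier ?C = coset_of L ` {y. \<forall>i. b i dvd (P *v y) $ i}"
    unfolding carrier_critical by (simp add: nonzero_def b_def)
  have order_C: "order ?C = (\<Prod>i\<in>UNIV. nat (a i))" and fin_C: "finite (carrier ?C)"
    unfolding order_def carrier_C using card_scaled_cosets[OF ab] by simp_all
  have mult_order: "multiplicity p (order ?C) = (\<Sum>i\<in>UNIV. v i)"
  proof -
    have "multiplicity p (nat (a i)) = v i" for i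
      using ab(2)[of i] by (simp add: a_def v_def multiplicity_nat_abs[OF p])
    moreover have "nat (a i) \<noteq> 0" for i using ab(2)[of i] by simp
    then have "0 \<notin> range (\<lambda>i. nat (a i))" by (metis imageE)
    ultimately show ?thesis
      unfolding order_C using p
      by (subst prime_elem_multiplicity_prod_distrib) auto
  qed
  define T where "T = coset_of L ` {y. \<forall>i. u i dvd (P *v y) $ i}"
  have T_sub: "T \<subseteq> carrier ?C"
    unfolding T_def carrier_C
  proof (intro image_mono Collect_mono impI allI)
    fix y i assume "\<forall>i. u i dvd (P *v y) $ i"
    then have "u i dvd (P *v y) $ i" by blast
    then show "b i dvd (P *v y) $ i" using mu[of i] m_pos[of i] by (auto simp: b_def)
  qed
  have card_T: "card T = p ^ (\<Sum>i\<in>UNIV. v i)" and fin_T: "finite T"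
    unfolding T_def using card_scaled_cosets[OF mu m_pos m_eq_1]
    by (simp_all add: m_def nat_power_eq power_sum)
  interpret C: group ?C by (rule group_critical)
  have sub_coker: "subgroup T (cokernel L)"
    unfolding T_def by (rule subgroup_cosetsI) (simp_all add: matrix_vector_mult_diff_distrib)
  have sub_T: "subgroup T ?C"
  proof -
    have 1: "subgroup (carrier ?C) (cokernel L)"
      unfolding carrier_critical by (rule subgroup_cosetsI) (simp_all add: matrix_vector_mult_diff_distrib)
    have "subgroup T ((cokernel L)\<lparr>carrier := carrier ?C\<rparr>)"
      using comm_group_cokernel[of L] sub_coker 1 T_sub
      by (metis comm_group.axioms(2) group.subgroup_incl)
    then show ?thesis by (simp add: critical_group_def torsion_part_def)
  qed
  have sylow: "(THE H. subgroup H ?C \<and> card H = p ^ multiplicity p (order ?C)) = T"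
  proof (rule the_equality)
    show "subgroup T ?C \<and> card T = p ^ multiplicity p (order ?C)"
      using sub_T card_T mult_order by simp
  next
    fix H assume H: "subgroup H ?C \<and> card H = p ^ multiplicity p (order ?C)"
    then interpret H: subgroup H ?C by simp
    \<comment> \<open>The elements of a subgroup of this order are killed by a power of
      \<open>p\<close>, while \<open>u i\<close> is prime to \<open>p\<close> wherever
      \<open>d i\<close> is nonzero. So any competitor is contained in \<open>T\<close>, and the
      cardinalities agree.\<close>
    have "H \<subseteq> T"
    proof
      fix x assume x: "x \<in> H"
      let ?n = "card H"
      have "x [^]\<^bsub>?C\<lparr>carrier := H\<rparr>\<^esub> order (?C\<lparr>carrier := H\<rparr>) = \<one>\<^bsub>?C\<lparr>carrier := H\<rparr>\<^esub>"
        using H.subgroup_is_group[OF C.is_group] x by (intro group.pow_order_eq_1) simp_all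
      then have pow: "x [^]\<^bsub>cokernel L\<^esub> ?n = \<one>\<^bsub>cokernel L\<^esub>"
        by (simp add: order_def nat_pow_def critical_group_simps)
      obtain y where y: "x = coset_of L y" using x H.subset unfolding carrier_C by blast
      have "u i dvd (P *v y) $ i" for i
      proof -
        have dvd: "d i dvd int ?n * (P *v y) $ i" using pow by (simp add: y coset_pow_one_iff)
        show ?thesis
        proof (cases "d i = 0")
          case True
          then have "(P *v y) $ i = 0" using dvd H p1 by simp
          then show ?thesis by simp
        next
          case False
          have "u i dvd int ?n * (P *v y) $ i"
            using dvd mu[of i] by (metis abs_dvd_iff dvd_mult_right)
          moreover have "coprime (u i) (int ?n)" using u_coprime[OF False] H by (simp add: coprime_commute)
          ultimately show ?thesis by (simp add: coprime_dvd_mult_right_iff)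
        qed
      qed
      then show "x \<in> T" unfolding T_def y by blast
    qed
    moreover have "card H = card T" using H card_T mult_order by simp
    ultimately show "H = T" using fin_T by (simp add: card_subset_eq)
  qed
  have sylow_eq: "sylow_part p ?C = (cokernel L)\<lparr>carrier := T\<rparr>"
    unfolding sylow_part_def sylow by (simp add: critical_group_def torsion_part_def)
  have grp: "group (sylow_part p ?C)"
    unfolding sylow_eq using sub_coker comm_group_cokernel[of L]
    by (metis comm_group.axioms(2) group.subgroup_imp_group)
  obtain g where "bij_betw g {..<card {i. m i > 1}} {i. m i > 1}"
    using ex_bij_betw_nat_finite[of "{i. m i > 1}"] by (auto simp: atLeast0LessThan)
  then obtain k where g: "bij_betw g {..<k} {i. m i > 1}" by blast
  let ?ns = "map (\<lambda>j. nat (m (g j))) [0..<k]"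
  have "cyclic_product ?ns \<cong> sylow_part p ?C"
    unfolding sylow_eq T_def by (rule scaled_cosets_iso_cyclic_product[OF mu m_pos m_eq_1 g])
  moreover have "group (cyclic_product ?ns)" by (rule product_group) (rule group_integer_mod_group)
  ultimately have iso: "sylow_part p ?C \<cong> cyclic_product ?ns" by (metis group.iso_sym)
  have primepow: "primepow n" if n: "n \<in> set ?ns" for n
  proof -
    obtain j where "j < k" "n = nat (m (g j))" using n by auto
    moreover from this g have "m (g j) > 1" by (auto simp: bij_betw_def)
    then have "v (g j) > 0" by (cases "v (g j)") (simp_all add: m_def)
    ultimately show ?thesis using p by (auto simp: m_def nat_power_eq)
  qed
  have "elementary_divisors (sylow_part p ?C) = mset ?ns"
    by (rule elementary_divisors_eqI[OF iso grp primepow])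
  then have "elem_div_mult p j ?C = count (mset ?ns) (p ^ j)"
    unfolding elem_div_mult_def by simp
  also have "\<dots> = card {j' \<in> {..<k}. v (g j') = j}"
  proof -
    have "count (mset ?ns) (p ^ j) = card {j' \<in> {..<k}. nat (m (g j')) = p ^ j}"
      unfolding count_mset count_list_eq_length_filter length_filter_conv_card by (auto intro!: arg_cong[of _ _ card])
    also have "{j' \<in> {..<k}. nat (m (g j')) = p ^ j} = {j' \<in> {..<k}. v (g j') = j}"
      using p1 by (auto simp: m_def nat_power_eq)
    finally show ?thesis .
  qed
  also have "\<dots> = card {i \<in> {i. m i > 1}. v i = j}"
    by (rule bij_betw_same_card[OF bij_betw_Collect[OF g]]) simp
  also have "{i \<in> {i. m i > 1}. v i = j} = {i. d i \<noteq> 0 \<and> multiplicity (int p) (d i) = j}"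
    using j p1 by (auto simp: m_def v_def split: if_splits)
  finally show ?thesis .
qed

end

section \<open>Rank modulo a prime\<close>

lemma map_matrix_of_int_mult:
  "map_matrix of_int (A ** B) = (map_matrix of_int A ** map_matrix of_int B :: 'f::comm_ring_1^'n::finite^'m::finite)"
  for A :: "int^'k::finite^'m" and B :: "int^'n^'k"
  by (simp add: vec_eq_iff matrix_matrix_mult_def)

lemma rank_mult_le_right:
  fixes A :: "'f::field^'k::finite^'m::finite" and B :: "'f^'n::finite^'k"
  shows "rank (A ** B) \<le> rank B"
proof -
  have "row i (A ** B) = (\<Sum>k\<in>UNIV. A $ i $ k *s row k B)" for i
    by (simp add: vec_eq_iff row_def matrix_matrix_mult_def)
  moreover have "row k B \<in> vec.span (rows B)" for k
    by (rule vec.span_base) (auto simp: rows_def)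
  ultimately have "rows (A ** B) \<subseteq> vec.span (rows B)"
    by (auto simp: rows_def intro!: vec.span_sum vec.span_scale)
  then show ?thesis unfolding row_rank_def_gen by (rule vec.dim_mono)
qed

lemma rank_mult_le_left:
  fixes A :: "'f::field^'k::finite^'m::finite" and B :: "'f^'n::finite^'k"
  shows "rank (A ** B) \<le> rank A"
proof -
  have lin: "Vector_Spaces.linear (*s) (*s) (\<lambda>v. v v* B)"
    by (simp add: Vector_Spaces.linear_def module_hom_def module_hom_axioms_def vec.vector_space_axioms
      vec.module_axioms vector_matrix_left_distrib scalar_vector_matrix_assoc)
  have "row i (A ** B) = row i A v* B" for i
    by (simp add: vec_eq_iff row_def matrix_matrix_mult_def vector_matrix_mult_def mult.commute)
  then have "rows (A ** B) = (\<lambda>v. v v* B) ` rows A" by (auto simp: rows_def)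
  then show ?thesis unfolding row_rank_def_gen using vec.dim_image_le[OF lin] by simp
qed

lemma rank_diagonal:
  fixes c :: "'n::finite \<Rightarrow> 'f::field"
  shows "rank (\<chi> i j. if i = j then c i else 0) = card {i. c i \<noteq> 0}" (is "rank ?D = _")
proof -
  define B where "B = (\<lambda>i. axis i (1::'f)) ` {i. c i \<noteq> 0}"
  have row: "row i ?D = c i *s axis i 1" for i
    by (auto simp: vec_eq_iff row_def axis_def)
  have indep: "vec.independent B"
    by (rule vec.independent_mono[OF independent_cart_basis]) (auto simp: B_def cart_basis_def)
  have "vec.span (rows ?D) = vec.span B"
  proof (rule vec.span_eq[THEN iffD2], intro conjI subsetI)
    fix x assume "x \<in> rows ?D"
    then obtain i where "x = c i *s axis i 1" unfolding rows_def using row by auto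
    then show "x \<in> vec.span B"
      by (cases "c i = 0") (auto simp: B_def vec.span_zero intro!: vec.span_scale[OF vec.span_base])
  next
    fix x assume "x \<in> B"
    then obtain i where i: "c i \<noteq> 0" "x = axis i 1" by (auto simp: B_def)
    then have "x = inverse (c i) *s row i ?D" by (simp add: row)
    then show "x \<in> vec.span (rows ?D)"
      by (auto intro!: vec.span_scale[OF vec.span_base] simp: rows_def)
  qed
  then have "vec.dim (rows ?D) = vec.dim B" by (rule vec.span_eq_dim)
  also have "\<dots> = card B" using indep by (rule vec.dim_eq_card_independent)
  finally have "rank ?D = card B" unfolding row_rank_def_gen .
  also have "\<dots> = card {i. c i \<noteq> 0}"
    unfolding B_def by (rule card_image) (auto simp: inj_on_def axis_eq_axis)
  finally show ?thesis .
qed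

text \<open>The inverses \<open>P'\<close> and \<open>Q'\<close> have integer entries too, so modulo
  \<open>p\<close> each of \<open>L\<close> and its diagonal form arises from the other by
  multiplications, which cannot raise the rank.\<close>

lemma rank_over_prime_field:
  fixes L P P' Q Q' :: "int^'n::finite^'n"
  assumes inv: "P ** P' = mat 1" "P' ** P = mat 1" "Q ** Q' = mat 1" "Q' ** Q = mat 1"
    and diag: "(\<chi> i j. if i = j then d i else 0) = P ** L ** Q"
    and p: "prime p" "CARD('f::{finite,field}) = p"
  shows "rank_over TYPE('f) L = card {i. \<not> int p dvd d i}"
proof -
  let ?m = "map_matrix of_int :: int^'n^'n \<Rightarrow> 'f^'n^'n"
  have "L = P' ** (P ** L ** Q) ** Q'"
    by (metis inv matrix_mul_assoc matrix_mul_lid matrix_mul_rid)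
  then have eq: "?m L = ?m P' ** ?m (P ** L ** Q) ** ?m Q'"
    by (simp only: map_matrix_of_int_mult[symmetric])
  have le: "rank (A ** B ** C) \<le> rank B" for A B C :: "'f^'n^'n"
    by (rule le_trans[OF rank_mult_le_left rank_mult_le_right])
  have "rank (?m L) \<le> rank (?m (P ** L ** Q))" unfolding eq by (rule le)
  moreover have "rank (?m (P ** L ** Q)) \<le> rank (?m L)"
    unfolding map_matrix_of_int_mult by (rule le)
  ultimately have "rank_over TYPE('f) L = rank (?m (\<chi> i j. if i = j then d i else 0))"
    unfolding rank_over_def diag by simp
  also have "?m (\<chi> i j. if i = j then d i else 0) = (\<chi> i j. if i = j then of_int (d i) else 0)"
    by (simp add: vec_eq_iff)
  also have "rank \<dots> = card {i. of_int (d i) \<noteq> (0 :: 'f)}" by (rule rank_diagonal)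
  also have "{i. of_int (d i) \<noteq> (0 :: 'f)} = {i. \<not> int p dvd d i}"
  proof -
    have "CHAR('f) dvd p" using CHAR_dvd_CARD[where 'a = 'f] p by simp
    moreover have "CHAR('f) \<noteq> 1" by simp
    ultimately have "CHAR('f) = p" using p(1) by (metis prime_nat_iff)
    then show ?thesis by (simp add: of_int_eq_0_iff_char_dvd)
  qed
  finally show ?thesis .
qed

section \<open>Changes of coordinates over an unramified local ring\<close>

text \<open>A local ring \<open>\<O>\<close> inside a large field, with reduction
  \<open>\<phi>\<close> onto the residue field \<open>'k\<close>; elements with nonzero residue are
  units, and the last axiom says that \<open>p\<close> generates the maximal ideal. The axioms
  constrain \<open>\<phi>\<close> only on \<open>\<O>\<close>. Nothing here bounds the power of
  \<open>p\<close> that divides a nonzero element.\<close>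

locale unramified =
  fixes \<O> :: "'b::field_char_0 set" and \<phi> :: "'b \<Rightarrow> 'k::{finite,field}" and p :: nat
  assumes prime_p: "prime p"
    and one_closed: "1 \<in> \<O>"
    and diff_closed: "\<And>x y. x \<in> \<O> \<Longrightarrow> y \<in> \<O> \<Longrightarrow> x - y \<in> \<O>"
    and mult_closed: "\<And>x y. x \<in> \<O> \<Longrightarrow> y \<in> \<O> \<Longrightarrow> x * y \<in> \<O>"
    and \<phi>_one: "\<phi> 1 = 1"
    and \<phi>_diff: "\<And>x y. x \<in> \<O> \<Longrightarrow> y \<in> \<O> \<Longrightarrow> \<phi> (x - y) = \<phi> x - \<phi> y"
    and \<phi>_mult: "\<And>x y. x \<in> \<O> \<Longrightarrow> y \<in> \<O> \<Longrightarrow> \<phi> (x * y) = \<phi> x * \<phi> y"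
    and inverse_closed: "\<And>x. x \<in> \<O> \<Longrightarrow> \<phi> x \<noteq> 0 \<Longrightarrow> inverse x \<in> \<O>"
    and \<phi>_surj: "\<And>c. \<exists>x\<in>\<O>. \<phi> x = c"
    and \<phi>_eq_0_iff: "\<And>x. x \<in> \<O> \<Longrightarrow> \<phi> x = 0 \<longleftrightarrow> x / of_nat p \<in> \<O>"
begin

lemma p_nonzero: "of_nat p \<noteq> (0::'b)"
  using prime_p by (auto dest: prime_gt_0_nat)

lemma zero_closed: "0 \<in> \<O>"
  using diff_closed[OF one_closed one_closed] by simp

lemma \<phi>_zero: "\<phi> 0 = 0"
  using \<phi>_diff[OF one_closed one_closed] by simp

lemma uminus_closed: "x \<in> \<O> \<Longrightarrow> - x \<in> \<O>"
  using diff_closed[OF zero_closed, of x] by simp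

lemma add_closed: "x \<in> \<O> \<Longrightarrow> y \<in> \<O> \<Longrightarrow> x + y \<in> \<O>"
  using diff_closed[OF _ uminus_closed, of x y] by simp

lemma \<phi>_uminus: "x \<in> \<O> \<Longrightarrow> \<phi> (- x) = - \<phi> x"
  using \<phi>_diff[OF zero_closed, of x] by (simp add: \<phi>_zero)

lemma \<phi>_add: "x \<in> \<O> \<Longrightarrow> y \<in> \<O> \<Longrightarrow> \<phi> (x + y) = \<phi> x + \<phi> y"
  using \<phi>_diff[OF _ uminus_closed, of x y] by (simp add: \<phi>_uminus)

lemma sum_closed: "(\<And>i. i \<in> A \<Longrightarrow> f i \<in> \<O>) \<Longrightarrow> (\<Sum>i\<in>A. f i) \<in> \<O>"
  by (induction A rule: infinite_finite_induct) (auto simp: zero_closed add_closed)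

lemma \<phi>_sum: "(\<And>i. i \<in> A \<Longrightarrow> f i \<in> \<O>) \<Longrightarrow> \<phi> (\<Sum>i\<in>A. f i) = (\<Sum>i\<in>A. \<phi> (f i))"
  by (induction A rule: infinite_finite_induct) (auto simp: \<phi>_zero \<phi>_add sum_closed)

lemma power_closed: "x \<in> \<O> \<Longrightarrow> x ^ n \<in> \<O>"
  by (induction n) (auto simp: one_closed mult_closed)

lemma \<phi>_power: "x \<in> \<O> \<Longrightarrow> \<phi> (x ^ n) = \<phi> x ^ n"
  by (induction n) (auto simp: \<phi>_one \<phi>_mult power_closed)

lemma of_nat_closed: "of_nat n \<in> \<O>"
  by (induction n) (auto simp: zero_closed one_closed add_closed)

lemma \<phi>_of_nat: "\<phi> (of_nat n) = of_nat n"
  by (induction n) (auto simp: \<phi>_zero \<phi>_one \<phi>_add one_closed of_nat_closed)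

lemma of_int_closed: "of_int n \<in> \<O>"
  by (cases n rule: int_cases2) (auto simp: of_nat_closed uminus_closed)

lemma \<phi>_of_int: "\<phi> (of_int n) = of_int n"
  by (cases n rule: int_cases2) (auto simp: of_nat_closed \<phi>_uminus \<phi>_of_nat)

lemma of_nat_p_eq_0: "of_nat p = (0 :: 'k)"
  using \<phi>_eq_0_iff[OF of_nat_closed, of p] one_closed p_nonzero by (simp add: \<phi>_of_nat)

lemma of_int_eq_0_iff_dvd: "of_int a = (0 :: 'k) \<longleftrightarrow> int p dvd a"
proof
  assume "int p dvd a"
  then show "of_int a = (0 :: 'k)" using of_nat_p_eq_0 by (auto elim!: dvdE)
next
  assume a: "of_int a = (0 :: 'k)"
  show "int p dvd a"
  proof (rule ccontr)
    assume "\<not> int p dvd a"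
    then have "coprime (int p) a" using prime_p by (simp add: prime_imp_coprime)
    then obtain u v where "u * int p + v * a = 1"
      using bezout_int[of "int p" a] by auto
    then have "of_int (u * int p + v * a) = (1 :: 'k)" by simp
    then show False using a of_nat_p_eq_0 by simp
  qed
qed

text \<open>Defined on the whole field, so that \<open>pdiv 0\<close> is membership in
  \<open>\<O>\<close> and, for elements of \<open>\<O>\<close>, \<open>pdiv 1\<close> is the
  vanishing of the residue.\<close>

definition pdiv :: "nat \<Rightarrow> 'b \<Rightarrow> bool" where
  "pdiv n x \<longleftrightarrow> x / of_nat p ^ n \<in> \<O>"

lemma pdiv_0: "pdiv 0 x \<longleftrightarrow> x \<in> \<O>"
  by (simp add: pdiv_def)

lemma pdiv_zero: "pdiv n 0"
  by (simp add: pdiv_def zero_closed)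

lemma pdiv_add: "pdiv n x \<Longrightarrow> pdiv n y \<Longrightarrow> pdiv n (x + y)"
  by (simp add: pdiv_def add_divide_distrib add_closed)

lemma pdiv_uminus: "pdiv n x \<Longrightarrow> pdiv n (- x)"
  using uminus_closed by (fastforce simp: pdiv_def)

lemma pdiv_uminus_iff: "pdiv n (- x) \<longleftrightarrow> pdiv n x"
  using pdiv_uminus[of n x] pdiv_uminus[of n "- x"] by auto

lemma pdiv_diff: "pdiv n x \<Longrightarrow> pdiv n y \<Longrightarrow> pdiv n (x - y)"
  using pdiv_add[of n x "- y"] pdiv_uminus by simp

lemma pdiv_mult: "x \<in> \<O> \<Longrightarrow> pdiv n y \<Longrightarrow> pdiv n (x * y)"
  using mult_closed by (fastforce simp: pdiv_def)

lemma pdiv_sum: "(\<And>i. i \<in> A \<Longrightarrow> pdiv n (f i)) \<Longrightarrow> pdiv n (\<Sum>i\<in>A. f i)"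
  by (simp add: pdiv_def sum_divide_distrib sum_closed)

lemma pdiv_unit_mult:
  assumes "u \<in> \<O>" "\<phi> u \<noteq> 0"
  shows "pdiv n (u * x) \<longleftrightarrow> pdiv n x"
proof -
  have "u \<noteq> 0" using assms \<phi>_zero by auto
  then show ?thesis
    using pdiv_mult[OF assms(1), of n x] pdiv_mult[OF inverse_closed[OF assms], of n "u * x"]
    by (auto simp: mult.assoc[symmetric])
qed

lemma p_power_closed: "of_nat p ^ n \<in> \<O>"
  by (intro power_closed of_nat_closed)

lemma pdiv_mono: "pdiv n x \<Longrightarrow> m \<le> n \<Longrightarrow> pdiv m x"
proof -
  assume *: "pdiv n x" "m \<le> n"
  have "x / of_nat p ^ m = of_nat p ^ (n - m) * (x / of_nat p ^ n)"
    using *(2) p_nonzero by (simp add: power_diff)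
  then show ?thesis using * mult_closed[OF p_power_closed, of "x / of_nat p ^ n" "n - m"]
    by (simp add: pdiv_def)
qed

lemma pdiv_of_int: "pdiv n (of_int a) \<longleftrightarrow> int p ^ n dvd a"
proof (induction n arbitrary: a)
  case 0
  then show ?case by (simp add: pdiv_0 of_int_closed)
next
  case (Suc n)
  have *: "int p dvd a" if "pdiv (Suc n) (of_int a)"
    using pdiv_mono[OF that, of 1] \<phi>_eq_0_iff[OF of_int_closed, of a]
    by (simp add: pdiv_def \<phi>_of_int of_int_eq_0_iff_dvd)
  have **: "pdiv (Suc n) (of_int (int p * b)) \<longleftrightarrow> int p ^ n dvd b" for b
    using p_nonzero Suc.IH[of b] by (simp add: pdiv_def)
  show ?case
  proof (cases "int p dvd a")
    case True
    then obtain b where "a = int p * b" ..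
    then show ?thesis using ** prime_p by (auto simp: prime_gt_0_nat)
  next
    case False
    then show ?thesis using * by (meson dvd_power dvd_trans zero_less_Suc)
  qed
qed

section \<open>Lattices, filtrations and their residue spaces\<close>

definition lattice :: "'i set \<Rightarrow> ('i \<Rightarrow> 'b) \<Rightarrow> bool" where
  "lattice I y \<longleftrightarrow> (\<forall>i\<in>I. y i \<in> \<O>)"

text \<open>A change of coordinates between the free modules with bases \<open>I\<close> and \<open>J\<close>, given as a
  relation, that transports the filtration \<open>V\<close> into the filtration \<open>W\<close>.\<close>

definition correspondence where
  "correspondence R I V J W \<longleftrightarrow>
     (\<forall>y. lattice I y \<longrightarrow> (\<exists>z. lattice J z \<and> R y z)) \<and>
     (\<forall>z. lattice J z \<longrightarrow> (\<exists>y. lattice I y \<and> R y z)) \<and>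
     (\<forall>y z n. lattice I y \<longrightarrow> lattice J z \<longrightarrow> R y z \<longrightarrow> (V n y \<longleftrightarrow> W n z)) \<and>
     (\<forall>y z y' z'. lattice I y \<longrightarrow> lattice J z \<longrightarrow> lattice I y' \<longrightarrow> lattice J z' \<longrightarrow>
        R y z \<longrightarrow> R y' z' \<longrightarrow> ((\<forall>i\<in>I. \<phi> (y i) = \<phi> (y' i)) \<longleftrightarrow> (\<forall>j\<in>J. \<phi> (z j) = \<phi> (z' j))))"

definition corresponds ::
    "'i set \<Rightarrow> (nat \<Rightarrow> ('i \<Rightarrow> 'b) \<Rightarrow> bool) \<Rightarrow> 'j set \<Rightarrow> (nat \<Rightarrow> ('j \<Rightarrow> 'b) \<Rightarrow> bool) \<Rightarrow> bool" where
  "corresponds I V J W \<longleftrightarrow> (\<exists>R. correspondence R I V J W)"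

text \<open>For a relation closed under differences, comparing the residues of two vectors reduces
  to the vanishing of residues of one.\<close>

lemma correspondsI:
  assumes "\<And>y. lattice I y \<Longrightarrow> \<exists>z. lattice J z \<and> R y z"
    and "\<And>z. lattice J z \<Longrightarrow> \<exists>y. lattice I y \<and> R y z"
    and "\<And>y z n. lattice I y \<Longrightarrow> lattice J z \<Longrightarrow> R y z \<Longrightarrow> V n y \<longleftrightarrow> W n z"
    and diff: "\<And>y z y' z'. R y z \<Longrightarrow> R y' z' \<Longrightarrow> R (\<lambda>i. y i - y' i) (\<lambda>j. z j - z' j)"
    and zero: "\<And>y z. lattice I y \<Longrightarrow> lattice J z \<Longrightarrow> R y z \<Longrightarrow>
      (\<forall>i\<in>I. \<phi> (y i) = 0) \<longleftrightarrow> (\<forall>j\<in>J. \<phi> (z j) = 0)"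
  shows "corresponds I V J W"
proof -
  have "(\<forall>i\<in>I. \<phi> (y i) = \<phi> (y' i)) \<longleftrightarrow> (\<forall>j\<in>J. \<phi> (z j) = \<phi> (z' j))"
    if *: "lattice I y" "lattice J z" "lattice I y'" "lattice J z'" "R y z" "R y' z'" for y z y' z'
  proof -
    have "lattice I (\<lambda>i. y i - y' i)" "lattice J (\<lambda>j. z j - z' j)"
      using * by (auto simp: lattice_def diff_closed)
    from zero[OF this diff[OF *(5,6)]] show ?thesis
      using * by (auto simp: lattice_def \<phi>_diff)
  qed
  then show ?thesis using assms(1-3) unfolding corresponds_def correspondence_def by blast
qed

lemma corresponds_sym:
  assumes "corresponds I V J W"
  shows "corresponds J W I V"
proof -
  obtain R where R: "correspondence R I V J W" using assms by (auto simp: corresponds_def)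
  have "correspondence (\<lambda>z y. R y z) J W I V"
    using R unfolding correspondence_def by blast
  then show ?thesis by (auto simp: corresponds_def)
qed

lemma corresponds_trans:
  assumes "corresponds I V J W" "corresponds J W K X"
  shows "corresponds I V K X"
proof -
  obtain R where R: "correspondence R I V J W" using assms by (auto simp: corresponds_def)
  obtain S where S: "correspondence S J W K X" using assms by (auto simp: corresponds_def)
  have "correspondence (\<lambda>y w. \<exists>z. lattice J z \<and> R y z \<and> S z w) I V K X"
    unfolding correspondence_def
  proof (intro conjI allI impI, goal_cases)
    case (1 y)
    then show ?case using R S unfolding correspondence_def by meson
  next
    case (2 z)
    then show ?case using R S unfolding correspondence_def by meson
  next
    case (3 y w n)
    then obtain z where "lattice J z" "R y z" "S z w" by blast
    moreover have "V n y \<longleftrightarrow> W n z" "W n z \<longleftrightarrow> X n w"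
      using R S 3 calculation unfolding correspondence_def by simp_all
    ultimately show ?case by simp
  next
    case (4 y w y' w')
    then obtain z z' where z: "lattice J z" "R y z" "S z w" "lattice J z'" "R y' z'" "S z' w'"
      by blast
    have "(\<forall>i\<in>I. \<phi> (y i) = \<phi> (y' i)) \<longleftrightarrow> (\<forall>j\<in>J. \<phi> (z j) = \<phi> (z' j))"
      using R 4 z unfolding correspondence_def by simp
    moreover have "(\<forall>j\<in>J. \<phi> (z j) = \<phi> (z' j)) \<longleftrightarrow> (\<forall>k\<in>K. \<phi> (w k) = \<phi> (w' k))"
      using S 4 z unfolding correspondence_def by simp
    ultimately show ?case by simp
  qed
  then show ?thesis by (auto simp: corresponds_def)
qed

text \<open>For \<open>V n y\<close> meaning that \<open>p^n\<close> divides \<open>L y\<close>,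
  this is the image modulo \<open>p\<close> of the submodule of the lattice that \<open>L\<close>
  sends into \<open>p^n\<close> times the lattice. The sizes of these images determine the
  elementary divisors.\<close>

definition residues :: "'i set \<Rightarrow> (nat \<Rightarrow> ('i \<Rightarrow> 'b) \<Rightarrow> bool) \<Rightarrow> nat \<Rightarrow> ('i \<Rightarrow> 'k) set" where
  "residues I V n = {restrict (\<lambda>i. \<phi> (y i)) I | y. lattice I y \<and> V n y}"

lemma finite_residues: "finite I \<Longrightarrow> finite (residues I V n)"
  by (rule finite_subset[of _ "PiE I (\<lambda>_. UNIV)"]) (auto simp: residues_def intro: finite_PiE)

text \<open>Each residue vector is lifted to a related pair \<open>Y c\<close>, \<open>Z c\<close>.
  The clause of \<open>correspondence\<close> about residues makes the passage to the residues of
  \<open>Z c\<close> injective, whatever lifts are chosen.\<close>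

lemma card_residues_le:
  assumes "finite J" "corresponds I V J W"
  shows "card (residues I V n) \<le> card (residues J W n)"
proof -
  obtain R where R: "correspondence R I V J W" using assms by (auto simp: corresponds_def)
  have "\<exists>y z. c = restrict (\<lambda>i. \<phi> (y i)) I \<and> lattice I y \<and> lattice J z \<and> R y z \<and> V n y \<and> W n z"
    if c: "c \<in> residues I V n" for c
  proof -
    obtain y where y: "c = restrict (\<lambda>i. \<phi> (y i)) I" "lattice I y" "V n y"
      using c unfolding residues_def by blast
    obtain z where z: "lattice J z" "R y z" using R y unfolding correspondence_def by meson
    then have "W n z" using R y unfolding correspondence_def by simp
    then show ?thesis using y z by blast
  qed
  then obtain Y Z where YZ: "\<And>c. c \<in> residues I V n \<Longrightarrow> c = restrict (\<lambda>i. \<phi> (Y c i)) I \<and>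
      lattice I (Y c) \<and> lattice J (Z c) \<and> R (Y c) (Z c) \<and> V n (Y c) \<and> W n (Z c)"
    by metis
  define f where "f = (\<lambda>c. restrict (\<lambda>j. \<phi> (Z c j)) J)"
  show ?thesis
  proof (rule card_inj_on_le[of f])
    show "inj_on f (residues I V n)"
    proof (rule inj_onI)
      fix c d assume c: "c \<in> residues I V n" and d: "d \<in> residues I V n" and eq: "f c = f d"
      have "\<forall>j\<in>J. \<phi> (Z c j) = \<phi> (Z d j)"
        using eq unfolding f_def by (metis restrict_apply')
      then have "\<forall>i\<in>I. \<phi> (Y c i) = \<phi> (Y d i)"
        using R YZ[OF c] YZ[OF d] unfolding correspondence_def by blast
      then have "restrict (\<lambda>i. \<phi> (Y c i)) I = restrict (\<lambda>i. \<phi> (Y d i)) I"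
        by (auto intro: restrict_ext)
      then show "c = d" using YZ[OF c] YZ[OF d] by metis
    qed
    show "f ` residues I V n \<subseteq> residues J W n"
      using YZ unfolding f_def residues_def[of J] by blast
    show "finite (residues J W n)" using assms(1) by (rule finite_residues)
  qed
qed

definition diagonal :: "'i set \<Rightarrow> ('i \<Rightarrow> 'b) \<Rightarrow> nat \<Rightarrow> ('i \<Rightarrow> 'b) \<Rightarrow> bool" where
  "diagonal I D n y \<longleftrightarrow> (\<forall>i\<in>I. pdiv n (D i * y i))"

text \<open>A coordinate with nonzero residue is a unit, so it can satisfy the condition only if
  \<open>D i\<close> itself is divisible.\<close>

lemma residues_diagonal:
  "residues I (diagonal I D) n = PiE I (\<lambda>i. if pdiv n (D i) then UNIV else {0})" (is "?L = ?R")
proof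
  have "\<phi> (y i) = 0" if "lattice I y" "diagonal I D n y" "i \<in> I" "\<not> pdiv n (D i)" for y i
  proof (rule ccontr)
    assume "\<phi> (y i) \<noteq> 0"
    then show False
      using that pdiv_unit_mult[of "y i" n "D i"] by (auto simp: lattice_def diagonal_def mult.commute)
  qed
  then show "?L \<subseteq> ?R" unfolding residues_def by (auto simp: PiE_iff)
next
  show "?R \<subseteq> ?L"
  proof
    fix c assume c: "c \<in> ?R"
    \<comment> \<open>A zero residue must be lifted to 0 itself: another element of the maximal
      ideal need not satisfy the condition at an index where \<open>D i\<close> is not
      divisible.\<close>
    define y where "y = (\<lambda>i. if c i = 0 then 0 else SOME x. x \<in> \<O> \<and> \<phi> x = c i)"
    have y: "y i \<in> \<O> \<and> \<phi> (y i) = c i" for i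
      using \<phi>_surj[of "c i"] someI_ex[of "\<lambda>x. x \<in> \<O> \<and> \<phi> x = c i"]
      by (auto simp: y_def zero_closed \<phi>_zero)
    have "pdiv n (D i * y i)" if "i \<in> I" for i
    proof (cases "pdiv n (D i)")
      case True
      then show ?thesis using pdiv_mult[of "y i" n "D i"] y by (simp add: mult.commute)
    next
      case False
      then have "y i = 0" using c that by (auto simp: y_def PiE_iff split: if_splits)
      then show ?thesis by (simp add: pdiv_zero)
    qed
    moreover have "c = restrict (\<lambda>i. \<phi> (y i)) I"
    proof
      fix i show "c i = restrict (\<lambda>i. \<phi> (y i)) I i"
        using c y by (cases "i \<in> I") (auto simp: PiE_iff extensional_def)
    qed
    ultimately show "c \<in> ?L"
      using y unfolding residues_def diagonal_def lattice_def by blast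
  qed
qed

lemma card_residues_diagonal:
  assumes "finite I"
  shows "card (residues I (diagonal I D) n) = CARD('k) ^ card {i\<in>I. pdiv n (D i)}"
proof -
  have "card (residues I (diagonal I D) n) = (\<Prod>i\<in>I. if pdiv n (D i) then CARD('k) else 1)"
    using assms by (simp add: residues_diagonal card_PiE if_distrib[of card] cong: if_cong)
  also have "\<dots> = (\<Prod>i\<in>{i\<in>I. pdiv n (D i)}. CARD('k))"
    using assms by (simp only: prod.inter_filter)
  finally show ?thesis by simp
qed

text \<open>Uniqueness of the invariants of a diagonal form: both residue spaces have as many
  elements as a power of \<open>CARD('k) > 1\<close>, and the exponents are compared.\<close>

theorem diagonal_invariant:
  assumes "finite I" "finite J" "corresponds I (diagonal I D) J (diagonal J D')"
  shows "card {i\<in>I. pdiv n (D i)} = card {j\<in>J. pdiv n (D' j)}"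
proof -
  have "card (residues I (diagonal I D) n) = card (residues J (diagonal J D') n)"
    using card_residues_le[OF assms(2,3)] card_residues_le[OF assms(1) corresponds_sym[OF assms(3)]]
    by (simp add: le_antisym)
  moreover have "CARD('k) > 1"
    using card_mono[of "UNIV :: 'k set" "{0, 1}"] by simp
  ultimately show ?thesis using assms by (simp add: card_residues_diagonal)
qed

lemma corresponds_glue:
  fixes I :: "'t \<Rightarrow> 'i set" and J :: "'t \<Rightarrow> 'j set"
  assumes corr: "\<And>t. t \<in> T \<Longrightarrow> corresponds (I t) (V t) (J t) (W t)"
    and disjI: "disjoint_family_on I T" and disjJ: "disjoint_family_on J T"
    and congV: "\<And>t n y y'. t \<in> T \<Longrightarrow> (\<And>i. i \<in> I t \<Longrightarrow> y i = y' i) \<Longrightarrow> V t n y = V t n y'"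
    and congW: "\<And>t n y y'. t \<in> T \<Longrightarrow> (\<And>i. i \<in> J t \<Longrightarrow> y i = y' i) \<Longrightarrow> W t n y = W t n y'"
  shows "corresponds (\<Union>t\<in>T. I t) (\<lambda>n y. \<forall>t\<in>T. V t n y) (\<Union>t\<in>T. J t) (\<lambda>n z. \<forall>t\<in>T. W t n z)"
proof -
  obtain R where R: "\<And>t. t \<in> T \<Longrightarrow> correspondence (R t) (I t) (V t) (J t) (W t)"
    using corr unfolding corresponds_def by metis
  have indexI: "\<exists>f. \<forall>t\<in>T. \<forall>i\<in>I t. f i = t"
  proof (intro exI ballI)
    fix t i assume "t \<in> T" "i \<in> I t"
    then show "(THE t. t \<in> T \<and> i \<in> I t) = t"
      using disjI by (auto simp: disjoint_family_on_def intro!: the_equality)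
  qed
  have indexJ: "\<exists>f. \<forall>t\<in>T. \<forall>i\<in>J t. f i = t"
  proof (intro exI ballI)
    fix t i assume "t \<in> T" "i \<in> J t"
    then show "(THE t. t \<in> T \<and> i \<in> J t) = t"
      using disjJ by (auto simp: disjoint_family_on_def intro!: the_equality)
  qed
  obtain fI where fI: "\<And>t i. t \<in> T \<Longrightarrow> i \<in> I t \<Longrightarrow> fI i = t" using indexI by blast
  obtain fJ where fJ: "\<And>t i. t \<in> T \<Longrightarrow> i \<in> J t \<Longrightarrow> fJ i = t" using indexJ by blast
  \<comment> \<open>The relation \<open>R t\<close> may look at coordinates outside its block. Hence
    \<open>Q\<close> asks for separate functions \<open>Y t\<close> and \<open>Z t\<close> that
    agree with \<open>y\<close> and \<open>z\<close> on the block only.\<close>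
  define Q where "Q = (\<lambda>y z. \<exists>Y Z. \<forall>t\<in>T. lattice (I t) (Y t) \<and> lattice (J t) (Z t) \<and>
    R t (Y t) (Z t) \<and> (\<forall>i\<in>I t. y i = Y t i) \<and> (\<forall>j\<in>J t. z j = Z t j))"
  have "correspondence Q (\<Union>t\<in>T. I t) (\<lambda>n y. \<forall>t\<in>T. V t n y) (\<Union>t\<in>T. J t) (\<lambda>n z. \<forall>t\<in>T. W t n z)"
    unfolding correspondence_def
  proof (intro conjI allI impI, goal_cases)
    case (1 y)
    have "\<forall>t\<in>T. \<exists>z. lattice (J t) z \<and> R t y z"
    proof
      fix t assume t: "t \<in> T"
      then have "lattice (I t) y" using 1 by (auto simp: lattice_def)
      then show "\<exists>z. lattice (J t) z \<and> R t y z" using R[OF t] unfolding correspondence_def by meson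
    qed
    then obtain Z where Z: "\<And>t. t \<in> T \<Longrightarrow> lattice (J t) (Z t) \<and> R t y (Z t)" by metis
    define z where "z = (\<lambda>j. Z (fJ j) j)"
    have "lattice (\<Union>t\<in>T. J t) z" using Z by (auto simp: z_def lattice_def fJ)
    moreover have "Q y z" unfolding Q_def
      using 1 Z by (intro exI[of _ "\<lambda>_. y"] exI[of _ Z]) (auto simp: z_def fJ lattice_def)
    ultimately show ?case by blast
  next
    case (2 z)
    have "\<forall>t\<in>T. \<exists>y. lattice (I t) y \<and> R t y z"
    proof
      fix t assume t: "t \<in> T"
      then have "lattice (J t) z" using 2 by (auto simp: lattice_def)
      then show "\<exists>y. lattice (I t) y \<and> R t y z" using R[OF t] unfolding correspondence_def by meson
    qed
    then obtain Y where Y: "\<And>t. t \<in> T \<Longrightarrow> lattice (I t) (Y t) \<and> R t (Y t) z" by metis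
    define y where "y = (\<lambda>j. Y (fI j) j)"
    have "lattice (\<Union>t\<in>T. I t) y" using Y by (auto simp: y_def lattice_def fI)
    moreover have "Q y z" unfolding Q_def
      using 2 Y by (intro exI[of _ Y] exI[of _ "\<lambda>_. z"]) (auto simp: y_def fI lattice_def)
    ultimately show ?case by blast
  next
    case (3 y z n)
    then obtain Y Z where YZ: "\<And>t. t \<in> T \<Longrightarrow> lattice (I t) (Y t) \<and> lattice (J t) (Z t) \<and>
        R t (Y t) (Z t) \<and> (\<forall>i\<in>I t. y i = Y t i) \<and> (\<forall>j\<in>J t. z j = Z t j)"
      unfolding Q_def by blast
    have "V t n y \<longleftrightarrow> W t n z" if t: "t \<in> T" for t
    proof -
      have "V t n y \<longleftrightarrow> V t n (Y t)" "W t n z \<longleftrightarrow> W t n (Z t)"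
        using congV[OF t, of y "Y t" n] congW[OF t, of z "Z t" n] YZ[OF t] by simp_all
      then show ?thesis using R[OF t] YZ[OF t] unfolding correspondence_def by simp
    qed
    then show ?case by simp
  next
    case (4 y z y' z')
    then obtain Y Z where YZ: "\<And>t. t \<in> T \<Longrightarrow> lattice (I t) (Y t) \<and> lattice (J t) (Z t) \<and>
        R t (Y t) (Z t) \<and> (\<forall>i\<in>I t. y i = Y t i) \<and> (\<forall>j\<in>J t. z j = Z t j)"
      unfolding Q_def by blast
    obtain Y' Z' where YZ': "\<And>t. t \<in> T \<Longrightarrow> lattice (I t) (Y' t) \<and> lattice (J t) (Z' t) \<and>
        R t (Y' t) (Z' t) \<and> (\<forall>i\<in>I t. y' i = Y' t i) \<and> (\<forall>j\<in>J t. z' j = Z' t j)"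
      using 4 unfolding Q_def by blast
    have "(\<forall>i\<in>I t. \<phi> (y i) = \<phi> (y' i)) \<longleftrightarrow> (\<forall>j\<in>J t. \<phi> (z j) = \<phi> (z' j))" if t: "t \<in> T" for t
      using R[OF t] YZ[OF t] YZ'[OF t] unfolding correspondence_def by simp
    then show ?case by blast
  qed
  then show ?thesis by (auto simp: corresponds_def)
qed

end

section \<open>An unramified local ring of cyclotomic numbers\<close>

text \<open>Elements of the ring generated by \<open>\<zeta>\<close> are handled as integer
  polynomials, so that one polynomial can be evaluated both at \<open>\<zeta>\<close> and at
  \<open>g\<close> in the finite field.\<close>

definition ev :: "'a::comm_ring_1 \<Rightarrow> int poly \<Rightarrow> 'a" where
  "ev x u = poly (map_poly of_int u) x"

lemma map_poly_of_int_mult: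
  "map_poly of_int (u * w) = (map_poly of_int u * map_poly of_int w :: 'a::comm_ring_1 poly)"
  by (simp add: poly_eq_iff coeff_map_poly coeff_mult)

lemma ev_mult: "ev x (u * w) = ev x u * ev x w"
  by (simp add: ev_def map_poly_of_int_mult)

lemma ev_add: "ev x (u + w) = ev x u + ev x w"
proof -
  have "map_poly of_int (u + w) = (map_poly of_int u + map_poly of_int w :: 'a poly)"
    by (simp add: poly_eq_iff coeff_map_poly)
  then show ?thesis by (simp add: ev_def)
qed

lemma ev_diff: "ev x (u - w) = ev x u - ev x w"
  using ev_add[of x "u - w" w] by (simp add: algebra_simps)

lemma ev_const: "ev x [:c:] = of_int c"
  by (simp add: ev_def map_poly_pCons)

lemma ev_0: "ev x 0 = 0" and ev_1: "ev x 1 = 1"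
  using ev_const[of x 0] ev_const[of x 1] by (simp_all add: one_pCons)

lemma ev_power: "ev x (u ^ n) = ev x u ^ n"
  by (induction n) (simp_all add: ev_1 ev_mult)

lemma ev_pCons: "ev x (pCons a u) = of_int a + x * ev x u"
  by (simp add: ev_def map_poly_pCons)

lemma ev_monom: "ev x (Polynomial.monom 1 n) = x ^ n"
  by (simp add: ev_def map_poly_monom poly_monom)

lemma ev_sum: "ev x (\<Sum>i\<in>I. f i) = (\<Sum>i\<in>I. ev x (f i))"
  by (induction I rule: infinite_finite_induct) (simp_all add: ev_0 ev_add)

text \<open>Pseudo-division replaces Bezout's identity, which fails in \<open>\<int>[X]\<close>.\<close>

lemma prime_elem_poly_combination:
  fixes m u :: "int poly"
  assumes m: "prime_elem m" "Polynomial.degree m > 0" and u: "\<not> m dvd u"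
  shows "\<exists>a b c. c \<noteq> 0 \<and> a * m + b * u = [:c:]"
proof -
  define J where "J = {w. w \<noteq> 0 \<and> (\<exists>a b. w = a * m + b * u)}"
  have "m \<noteq> 0" using m by auto
  have "m = 1 * m + 0 * u" by simp
  then have "m \<in> J" using \<open>m \<noteq> 0\<close> unfolding J_def by blast
  then obtain w where w: "w \<in> J" and min: "\<And>v. v \<in> J \<Longrightarrow> Polynomial.degree w \<le> Polynomial.degree v"
    using ex_has_least_nat[of "\<lambda>v. v \<in> J" m Polynomial.degree] by blast
  obtain a b where ab: "w = a * m + b * u" and w0: "w \<noteq> 0" using w by (auto simp: J_def)
  have dvd: "\<exists>c. c \<noteq> 0 \<and> w dvd Polynomial.smult c v" if v: "v = a' * m + b' * u" for v a' b'
  proof -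
    obtain s r where sr: "pseudo_divmod v w = (s, r)" by force
    define c where "c = Polynomial.coeff w (Polynomial.degree w) ^ (Suc (Polynomial.degree v) - Polynomial.degree w)"
    have eq: "Polynomial.smult c v = w * s + r" and r: "r = 0 \<or> Polynomial.degree r < Polynomial.degree w"
      using pseudo_divmod[OF w0 sr] by (simp_all add: c_def)
    have "c \<noteq> 0" using w0 by (simp add: c_def)
    have "r = (Polynomial.smult c a' - s * a) * m + (Polynomial.smult c b' - s * b) * u"
      using eq by (simp add: v ab algebra_simps smult_add_right)
    then have "r = 0" using r min[of r] unfolding J_def by fastforce
    with eq have "w dvd Polynomial.smult c v" by simp
    with \<open>c \<noteq> 0\<close> show ?thesis by blast
  qed
  obtain c where c: "c \<noteq> 0" "w dvd Polynomial.smult c m" using dvd[of m 1 0] by auto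
  obtain c' where c': "c' \<noteq> 0" "w dvd Polynomial.smult c' u" using dvd[of u 0 1] by auto
  obtain s where s: "Polynomial.smult c m = w * s" using c by blast
  have "m dvd w * s" by (metis s dvd_refl dvd_smult)
  \<comment> \<open>The combination \<open>w\<close> of least degree divides constant multiples of
    both \<open>m\<close> and \<open>u\<close>. If \<open>m\<close> divided \<open>w\<close>, it
    would divide a nonzero constant; otherwise it divides \<open>s\<close>, and \<open>w\<close>
    divides a constant and is one.\<close>
  then have "m dvd w \<or> m dvd s" using m by (simp add: prime_elem_dvd_mult_iff)
  then show ?thesis
  proof
    assume "m dvd w"
    then have "m dvd [:c':] * u" using c' by (simp add: dvd_trans)
    then have "m dvd [:c':]" using u prime_elem_dvd_multD[OF m(1)] by blast
    then have "Polynomial.degree m \<le> Polynomial.degree [:c':]" using c' by (intro dvd_imp_degree_le) simp_all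
    then show ?thesis using m by simp
  next
    assume "m dvd s"
    then obtain t where "s = m * t" ..
    then have "m * [:c:] = m * (w * t)" using s by simp
    then have wt: "[:c:] = w * t" using \<open>m \<noteq> 0\<close> by (simp only: mult_cancel_left) simp
    then have "Polynomial.degree w + Polynomial.degree t = 0"
      using c w0 by (metis degree_mult_eq degree_pCons_0 mult_zero_right pCons_eq_0_iff)
    then obtain e where e: "w = [:e:]" by (metis add_is_0 degree_eq_zeroE)
    then have "e \<noteq> 0" using w0 by simp
    then show ?thesis using ab e by metis
  qed
qed

lemma fermat_int:
  assumes "prime p"
  shows "[a ^ p = a] (mod int p)"
proof -
  define b where "b = nat (a mod int p)"
  have p: "p > 0" using assms by (rule prime_gt_0_nat)
  have "[b ^ p = b] (mod p)"
  proof (cases "p dvd b")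
    case True
    then have "p dvd b ^ p" using p by (meson dvd_power dvd_trans)
    with True show ?thesis by (simp add: cong_def)
  next
    case False
    then have "[b ^ (p - 1) * b = 1 * b] (mod p)"
      using fermat_theorem[OF assms] by (intro cong_mult) simp_all
    then show ?thesis using p by (simp flip: power_Suc2)
  qed
  then have "[int b ^ p = int b] (mod int p)" by (metis cong_int_iff of_nat_power)
  moreover have "[a = int b] (mod int p)" using p by (simp add: b_def cong_def)
  ultimately show ?thesis by (meson cong_pow cong_sym cong_trans)
qed

text \<open>The assumption \<open>compatible\<close> says that \<open>\<zeta> \<mapsto> g\<close>
  extends to a ring homomorphism from the ring generated by \<open>\<zeta>\<close> to the finite
  field, and \<open>integral\<close> that every nonzero element of that ring divides a nonzero
  integer. That \<open>g\<close> generates the multiplicative group is a consequence, see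
  \<open>generator\<close>.\<close>

locale compatible_roots =
  fixes \<zeta> :: "'b::field_char_0" and g :: "'k::{finite,field}" and n p N :: nat
  assumes p: "prime p" and card_k: "CARD('k) = p ^ N" and n: "n = p ^ N - 1"
    and \<zeta>: "\<And>j. \<zeta> ^ j = 1 \<longleftrightarrow> n dvd j"
    and compatible: "\<And>u. ev \<zeta> u = 0 \<Longrightarrow> ev g u = 0"
    and integral: "\<And>u. ev \<zeta> u \<noteq> 0 \<Longrightarrow> \<exists>b c. c \<noteq> 0 \<and> ev \<zeta> b * ev \<zeta> u = of_int c"

lemma card_field_ge_2: "CARD('k::{finite,field}) \<ge> 2"
  using card_mono[of "UNIV :: 'k set" "{0, 1}"] by simp

lemma finite_field_power_card_minus_1:
  fixes x :: "'k::{finite,field}"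
  assumes "x \<noteq> 0"
  shows "x ^ (CARD('k) - 1) = 1"
proof -
  have "x ^ (CARD('k) - 1) * (\<Prod>y\<in>UNIV-{0}. y) = (\<Prod>y\<in>UNIV-{0}. x * y)"
    by (simp add: prod.distrib card_Diff_singleton)
  also have "\<dots> = (\<Prod>y\<in>UNIV-{0}. y)"
    by (rule prod.reindex_bij_witness[of _ "\<lambda>y. y / x" "\<lambda>y. x * y"]) (use assms in auto)
  finally show ?thesis by simp
qed

lemma prod_mset_root:
  assumes "ev (x :: 'a::idom) (prod_mset M) = 0"
  shows "\<exists>m\<in>#M. ev x m = 0"
  using assms by (induction M) (auto simp: ev_1 ev_mult)

text \<open>Let \<open>m\<close> be the prime factor of \<open>X^n - 1\<close> with root
  \<open>\<zeta>\<close>, and \<open>w\<close> the cofactor. All \<open>n\<close> nonzero elements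
  of the finite field are roots of \<open>X^n - 1\<close>, and \<open>w\<close> has degree below
  \<open>n\<close>, so one of them is a root of \<open>m\<close>; it serves as \<open>g\<close>. A
  polynomial vanishing at \<open>\<zeta>\<close> is a multiple of \<open>m\<close>, whence
  compatibility.\<close>

lemma compatible_roots_exist:
  fixes \<zeta> :: "'b::field_char_0"
  assumes p: "prime p" and card_k: "CARD('k::{finite,field}) = p ^ N" and n: "n = p ^ N - 1"
    and \<zeta>: "\<And>j. \<zeta> ^ j = 1 \<longleftrightarrow> n dvd j"
  shows "\<exists>g :: 'k. compatible_roots \<zeta> g n p N"
proof -
  have n0: "n > 0" using card_field_ge_2[where 'k = 'k] card_k n by simp
  define F :: "int poly" where "F = Polynomial.monom 1 n - 1"
  have F_ev: "ev x F = x ^ n - 1" for x :: "'c::comm_ring_1"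
    by (simp add: F_def ev_diff ev_monom ev_1)
  have F0: "Polynomial.coeff F 0 = -1" using n0 by (simp add: F_def)
  then have "F \<noteq> 0" by auto
  have degF: "Polynomial.degree F \<le> n"
    unfolding F_def by (rule degree_diff_le) (simp_all add: degree_monom_le)
  obtain M where M: "\<And>m. m \<in># M \<Longrightarrow> prime m" "normalize (prod_mset M) = normalize F"
    by (rule prime_factorization_exists'[OF \<open>F \<noteq> 0\<close>]) blast
  have "F dvd prod_mset M" using M(2) by (metis dvd_refl normalize_dvd_iff dvd_normalize_iff)
  moreover have "ev \<zeta> F = 0" by (simp add: F_ev \<zeta>)
  ultimately have "ev \<zeta> (prod_mset M) = 0" by (auto elim!: dvdE simp: ev_mult)
  then obtain m where "m \<in># M" and m_root: "ev \<zeta> m = 0" using prod_mset_root by blast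
  then have m: "prime_elem m" using M by auto
  have "m dvd F" using \<open>m \<in># M\<close> M(2) by (metis dvd_normalize_iff dvd_prod_mset)
  then obtain w where w: "F = m * w" ..
  have "m \<noteq> 0" "w \<noteq> 0" using w \<open>F \<noteq> 0\<close> by auto
  have m_deg: "Polynomial.degree m > 0"
  proof (rule ccontr)
    assume "\<not> Polynomial.degree m > 0"
    then obtain c where "m = [:c:]" using degree_eq_zeroE by blast
    then show False using m_root \<open>m \<noteq> 0\<close> by (simp add: ev_const)
  qed
  have "Polynomial.degree m + Polynomial.degree w \<le> n" using degF \<open>m \<noteq> 0\<close> \<open>w \<noteq> 0\<close> by (simp add: w degree_mult_eq)
  then have w_deg: "Polynomial.degree w < n" using m_deg by linarith
  have "\<exists>g :: 'k. ev g m = 0"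
  proof (rule ccontr)
    assume no_root: "\<nexists>g :: 'k. ev g m = 0"
    let ?W = "map_poly of_int w :: 'k poly"
    \<comment> \<open>The constant coefficient -1 survives the reduction, which keeps the reduced
      cofactor from being 0.\<close>
    have "Polynomial.coeff (map_poly of_int F :: 'k poly) 0 \<noteq> 0" by (simp add: coeff_map_poly F0)
    then have "?W \<noteq> 0" unfolding w map_poly_of_int_mult by auto
    have "UNIV - {0} \<subseteq> {x. poly ?W x = 0}"
    proof
      fix x :: 'k assume "x \<in> UNIV - {0}"
      then have "ev x F = 0" using finite_field_power_card_minus_1[of x] by (simp add: F_ev card_k n)
      then show "x \<in> {x. poly ?W x = 0}" using no_root by (simp add: w ev_mult) (simp add: ev_def)
    qed
    then have "card (UNIV - {0} :: 'k set) \<le> card {x. poly ?W x = 0}" by (intro card_mono) simp_all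
    also have "\<dots> \<le> Polynomial.degree ?W" using \<open>?W \<noteq> 0\<close> by (rule card_poly_roots_bound)
    also have "\<dots> \<le> Polynomial.degree w" by (rule Polynomial.degree_le) (simp add: coeff_map_poly coeff_eq_0)
    finally show False using w_deg by (simp add: card_k n card_Diff_singleton)
  qed
  then obtain g :: 'k where g: "ev g m = 0" ..
  have comb: "\<exists>a b c. c \<noteq> 0 \<and> a * m + b * u = [:c:]" if "\<not> m dvd u" for u
    using prime_elem_poly_combination[OF m m_deg that] .
  have not_dvd: "ev \<zeta> u \<noteq> 0" "\<exists>b c. c \<noteq> 0 \<and> ev \<zeta> b * ev \<zeta> u = of_int c" if u: "\<not> m dvd u" for u
  proof -
    obtain a b c where "c \<noteq> 0" "a * m + b * u = [:c:]" using comb[OF u] by blast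
    then have "ev \<zeta> (a * m + b * u) = of_int c" by (simp add: ev_const)
    then have "ev \<zeta> b * ev \<zeta> u = of_int c" using m_root by (simp add: ev_add ev_mult)
    then show "ev \<zeta> u \<noteq> 0" "\<exists>b c. c \<noteq> 0 \<and> ev \<zeta> b * ev \<zeta> u = of_int c"
      using \<open>c \<noteq> 0\<close> by auto
  qed
  have "compatible_roots \<zeta> g n p N"
  proof
    fix u assume "ev \<zeta> u = 0"
    then have "m dvd u" using not_dvd(1) by blast
    then show "ev g u = 0" using g by (auto simp: ev_mult)
  next
    fix u assume "ev \<zeta> u \<noteq> 0"
    then have "\<not> m dvd u" using m_root by (auto simp: ev_mult)
    then show "\<exists>b c. c \<noteq> 0 \<and> ev \<zeta> b * ev \<zeta> u = of_int c" by (rule not_dvd(2))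
  qed (fact p card_k n \<zeta>)+
  then show ?thesis ..
qed

context compatible_roots
begin

lemma n_pos: "n > 0"
  using card_field_ge_2[where 'k = 'k] card_k n by simp

lemma CHAR_eq_p: "CHAR('k) = p"
proof -
  have "CHAR('k) dvd p ^ N" using CHAR_dvd_CARD[where 'a = 'k] card_k by simp
  moreover have "CHAR('k) \<noteq> 1" by simp
  moreover have "prime CHAR('k)" using finite_imp_CHAR_pos[where 'a = 'k] prime_CHAR_semidom[where 'a = 'k] by simp
  ultimately show ?thesis using p by (metis prime_dvd_power primes_dvd_imp_eq)
qed

lemma of_nat_p: "of_nat p = (0 :: 'k)"
  using of_nat_CHAR[where 'a = 'k] by (simp add: CHAR_eq_p)

lemma of_nat_n: "of_nat n = (-1 :: 'k)"
proof -
  have "of_nat (n + 1) = (of_nat (p ^ N) :: 'k)" using n_pos n by (simp del: of_nat_add)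
  also have "\<dots> = 0" using card_field_ge_2[where 'k = 'k] card_k by (cases N) (simp_all add: of_nat_p)
  finally show ?thesis by (simp add: eq_neg_iff_add_eq_0 add.commute)
qed

lemma g_power_n: "g ^ n = 1"
  using compatible[of "Polynomial.monom 1 n - 1"] \<zeta>[of n] by (simp add: ev_diff ev_monom ev_1)

lemma g_nonzero: "g \<noteq> 0"
  using g_power_n n_pos by (auto simp: power_0_left)

text \<open>If \<open>g ^ e = 1\<close> for a proper divisor \<open>e\<close> of
  \<open>n = e * r\<close>, then \<open>\<zeta>\<close> is a root of the sum of the
  \<open>X^(e * i)\<close> with \<open>i < r\<close>. Evaluated at \<open>g\<close>, this sum is
  \<open>r\<close>, so \<open>r\<close> and its multiple \<open>n\<close> would be 0 in the finite
  field, where \<open>n\<close> is -1.\<close>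

lemma g_power_eq_1_iff: "g ^ j = 1 \<longleftrightarrow> n dvd j"
proof
  assume "n dvd j"
  then show "g ^ j = 1" using g_power_n by (auto simp: power_mult)
next
  assume gj: "g ^ j = 1"
  show "n dvd j"
  proof (rule ccontr)
    assume nj: "\<not> n dvd j"
    then have "j \<noteq> 0" by (metis dvd_0_right)
    define e where "e = gcd j n"
    obtain x y where "j * x = n * y + e" using bezout_nat[OF \<open>j \<noteq> 0\<close>, of n] by (auto simp: e_def)
    then have "(g ^ j) ^ x = (g ^ n) ^ y * g ^ e" by (simp add: power_mult[symmetric] power_add[symmetric])
    then have ge: "g ^ e = 1" by (simp add: gj g_power_n)
    obtain r where r: "n = e * r" unfolding e_def by (meson dvdE gcd_dvd2)
    have "\<not> n dvd e" using nj by (metis e_def dvd_trans gcd_dvd1)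
    then have "\<zeta> ^ e \<noteq> 1" by (simp add: \<zeta>)
    define c :: "int poly" where "c = (\<Sum>i<r. Polynomial.monom 1 (e * i))"
    have ev_c: "ev x c = (\<Sum>i<r. (x ^ e) ^ i)" for x :: "'c::comm_ring_1"
      by (simp add: c_def ev_sum ev_monom power_mult)
    have "(\<zeta> ^ e - 1) * ev \<zeta> c = \<zeta> ^ n - 1"
      by (simp add: ev_c r power_mult power_diff_1_eq)
    then have "ev \<zeta> c = 0" using \<open>\<zeta> ^ e \<noteq> 1\<close> \<zeta>[of n] by simp
    then have "ev g c = 0" by (rule compatible)
    then have "of_nat r = (0 :: 'k)" by (simp add: ev_c ge)
    then have "of_nat n = (0 :: 'k)" by (simp add: r)
    then show False by (simp add: of_nat_n)
  qed
qed

lemma generator: "x \<noteq> 0 \<Longrightarrow> \<exists>j<n. x = g ^ j"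
proof -
  assume x: "x \<noteq> 0"
  have "inj_on (\<lambda>j. g ^ j) {..<n}"
  proof (rule linorder_inj_onI)
    fix i j assume ij: "i < j" "i \<in> {..<n}" "j \<in> {..<n}"
    show "g ^ i \<noteq> g ^ j"
    proof
      assume "g ^ i = g ^ j"
      moreover have "g ^ i * g ^ (j - i) = g ^ j" using ij by (simp flip: power_add)
      ultimately have "g ^ (j - i) = 1" using g_nonzero by simp
      then have "n dvd j - i" by (simp add: g_power_eq_1_iff)
      then show False using ij by (auto dest: dvd_imp_le)
    qed
  qed auto
  then have "card ((\<lambda>j. g ^ j) ` {..<n}) = n" by (simp add: card_image)
  moreover have "card (UNIV - {0 :: 'k}) = n" by (simp add: card_k n card_Diff_singleton)
  moreover have "(\<lambda>j. g ^ j) ` {..<n} \<subseteq> UNIV - {0}" using g_nonzero by auto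
  ultimately have "(\<lambda>j. g ^ j) ` {..<n} = UNIV - {0}" by (intro card_subset_eq) simp_all
  then have "x \<in> (\<lambda>j. g ^ j) ` {..<n}" using x by simp
  then show ?thesis by auto
qed

section \<open>Congruences modulo \<open>p\<close> and the \<open>q\<close>-power map\<close>

definition cong_p :: "'b \<Rightarrow> 'b \<Rightarrow> bool" where
  "cong_p x y \<longleftrightarrow> (\<exists>u. x - y = of_nat p * ev \<zeta> u)"

lemma cong_p_refl: "cong_p x x"
  unfolding cong_p_def by (rule exI[of _ 0]) (simp add: ev_0)

lemma cong_p_trans: "cong_p x y \<Longrightarrow> cong_p y z \<Longrightarrow> cong_p x z"
proof -
  assume "cong_p x y" "cong_p y z"
  then obtain u w where "x - y = of_nat p * ev \<zeta> u" "y - z = of_nat p * ev \<zeta> w"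
    unfolding cong_p_def by blast
  then have "x - z = of_nat p * ev \<zeta> (u + w)" by (simp add: ev_add algebra_simps)
  then show ?thesis unfolding cong_p_def by blast
qed

lemma cong_p_add: "cong_p x y \<Longrightarrow> cong_p x' y' \<Longrightarrow> cong_p (x + x') (y + y')"
proof -
  assume "cong_p x y" "cong_p x' y'"
  then obtain u w where "x - y = of_nat p * ev \<zeta> u" "x' - y' = of_nat p * ev \<zeta> w"
    unfolding cong_p_def by blast
  then have "(x + x') - (y + y') = of_nat p * ev \<zeta> (u + w)" by (simp add: ev_add algebra_simps)
  then show ?thesis unfolding cong_p_def by blast
qed

lemma cong_p_mult: "cong_p (ev \<zeta> a) (ev \<zeta> b) \<Longrightarrow> cong_p (ev \<zeta> c) (ev \<zeta> d) \<Longrightarrow>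
  cong_p (ev \<zeta> a * ev \<zeta> c) (ev \<zeta> b * ev \<zeta> d)"
proof -
  assume "cong_p (ev \<zeta> a) (ev \<zeta> b)" "cong_p (ev \<zeta> c) (ev \<zeta> d)"
  then obtain u w where *: "ev \<zeta> a - ev \<zeta> b = of_nat p * ev \<zeta> u" "ev \<zeta> c - ev \<zeta> d = of_nat p * ev \<zeta> w"
    unfolding cong_p_def by blast
  have "ev \<zeta> a * ev \<zeta> c - ev \<zeta> b * ev \<zeta> d = (ev \<zeta> a - ev \<zeta> b) * ev \<zeta> c + ev \<zeta> b * (ev \<zeta> c - ev \<zeta> d)"
    by (simp add: algebra_simps)
  also have "\<dots> = of_nat p * ev \<zeta> (u * c + b * w)"
    unfolding * by (simp add: ev_add ev_mult algebra_simps)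
  finally show ?thesis unfolding cong_p_def by blast
qed

lemma cong_p_power: "cong_p (ev \<zeta> a) (ev \<zeta> b) \<Longrightarrow> cong_p (ev \<zeta> a ^ k) (ev \<zeta> b ^ k)"
proof (induction k)
  case 0
  then show ?case by (simp add: cong_p_refl)
next
  case (Suc k)
  then show ?case using cong_p_mult[of a b "a ^ k" "b ^ k"] by (simp add: ev_power)
qed

lemma frobenius_add: "cong_p ((ev \<zeta> a + ev \<zeta> b) ^ p) (ev \<zeta> a ^ p + ev \<zeta> b ^ p)"
proof -
  define c :: "nat \<Rightarrow> int poly" where
    "c = (\<lambda>k. of_nat ((p choose k) div p) * a ^ k * b ^ (p - k))"
  have ev_nat: "ev \<zeta> (of_nat k) = of_nat k" for k
    by (induction k) (simp_all add: ev_0 ev_1 ev_add)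
  have p1: "p > 1" using p by (rule prime_gt_1_nat)
  have "(ev \<zeta> a + ev \<zeta> b) ^ p = (\<Sum>k\<le>p. of_nat (p choose k) * ev \<zeta> a ^ k * ev \<zeta> b ^ (p - k))"
    by (rule binomial_ring)
  also have "{..p} = insert 0 (insert p {0<..<p})" using p1 by auto
  also have "(\<Sum>k\<in>insert 0 (insert p {0<..<p}). of_nat (p choose k) * ev \<zeta> a ^ k * ev \<zeta> b ^ (p - k))
     = ev \<zeta> a ^ p + ev \<zeta> b ^ p + (\<Sum>k\<in>{0<..<p}. of_nat (p choose k) * ev \<zeta> a ^ k * ev \<zeta> b ^ (p - k))"
    using p1 by simp
  also have "(\<Sum>k\<in>{0<..<p}. of_nat (p choose k) * ev \<zeta> a ^ k * ev \<zeta> b ^ (p - k))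
     = (\<Sum>k\<in>{0<..<p}. of_nat p * ev \<zeta> (c k))"
  proof (rule sum.cong)
    fix k assume k: "k \<in> {0<..<p}"
    then have "p dvd (p choose k)" using p by (intro dvd_choose_prime) auto
    then have "p choose k = p * ((p choose k) div p)" by simp
    then have "of_nat (p choose k) = (of_nat p * of_nat ((p choose k) div p) :: 'b)" by (metis of_nat_mult)
    then show "of_nat (p choose k) * ev \<zeta> a ^ k * ev \<zeta> b ^ (p - k) = of_nat p * ev \<zeta> (c k)"
      by (simp add: c_def ev_mult ev_power ev_nat)
  qed simp
  also have "\<dots> = of_nat p * ev \<zeta> (\<Sum>k\<in>{0<..<p}. c k)" by (simp add: ev_sum sum_distrib_left)
  finally show ?thesis unfolding cong_p_def by auto
qed

lemma frobenius_add_power: "cong_p ((ev \<zeta> a + ev \<zeta> b) ^ p ^ k) (ev \<zeta> a ^ p ^ k + ev \<zeta> b ^ p ^ k)"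
proof (induction k)
  case 0
  then show ?case by (simp add: cong_p_refl)
next
  case (Suc k)
  have "cong_p (ev \<zeta> ((a + b) ^ p ^ k) ^ p) (ev \<zeta> (a ^ p ^ k + b ^ p ^ k) ^ p)"
    by (rule cong_p_power) (use Suc in \<open>simp add: ev_add ev_power\<close>)
  moreover have "cong_p ((ev \<zeta> (a ^ p ^ k) + ev \<zeta> (b ^ p ^ k)) ^ p) (ev \<zeta> (a ^ p ^ k) ^ p + ev \<zeta> (b ^ p ^ k) ^ p)"
    by (rule frobenius_add)
  ultimately have "cong_p (ev \<zeta> ((a + b) ^ p ^ k) ^ p) (ev \<zeta> (a ^ p ^ k) ^ p + ev \<zeta> (b ^ p ^ k) ^ p)"
    unfolding ev_add by (rule cong_p_trans)
  then show ?case by (simp add: ev_power ev_add power_mult[symmetric] mult.commute)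
qed

text \<open>The \<open>q\<close>-power map is additive modulo \<open>p\<close>, fixes integers by
  Fermat's theorem, and fixes \<open>\<zeta>\<close> because \<open>q = n + 1\<close>. This
  congruence is the source of unramifiedness.\<close>

lemma cong_p_power_q: "cong_p (ev \<zeta> u ^ p ^ N) (ev \<zeta> u)"
proof (induction u)
  case 0
  then show ?case using p by (simp add: ev_0 cong_p_refl power_0_left prime_gt_0_nat)
next
  case (pCons a u)
  let ?q = "p ^ N"
  have "int p dvd a ^ ?q - a"
  proof -
    have "[a ^ (p ^ k) = a] (mod int p)" for k
    proof (induction k)
      case (Suc k)
      have "[(a ^ (p ^ k)) ^ p = a ^ p] (mod int p)" using Suc by (rule cong_pow)
      also have "[a ^ p = a] (mod int p)" using p by (rule fermat_int)
      finally show ?case by (simp add: power_mult[symmetric] mult.commute)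
    qed simp
    then show ?thesis by (simp add: cong_iff_dvd_diff)
  qed
  then obtain c where c: "a ^ ?q - a = int p * c" ..
  have "of_int a ^ ?q - of_int a = (of_int (a ^ ?q - a) :: 'b)" by simp
  also have "\<dots> = of_nat p * ev \<zeta> [:c:]" unfolding c by (simp add: ev_const)
  finally have 1: "cong_p (ev \<zeta> [:a:] ^ ?q) (ev \<zeta> [:a:])" 
    unfolding cong_p_def by (intro exI[of _ "[:c:]"]) (simp add: ev_const)
  have "\<zeta> ^ ?q = \<zeta>"
  proof -
    have "?q = Suc n" using n_pos n by simp
    then show ?thesis using \<zeta>[of n] by simp
  qed
  then have 2: "cong_p (ev \<zeta> ([:0, 1:] * u) ^ ?q) (ev \<zeta> ([:0, 1:] * u))"
    using cong_p_mult[of "[:0,1:]" "[:0,1:]" "u ^ ?q" u] pCons.IH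
    by (simp add: ev_mult ev_pCons ev_0 power_mult_distrib ev_power cong_p_refl del: mult_pCons_left)
  have "cong_p ((ev \<zeta> [:a:] + ev \<zeta> ([:0, 1:] * u)) ^ ?q) (ev \<zeta> [:a:] + ev \<zeta> ([:0, 1:] * u))"
    by (rule cong_p_trans[OF frobenius_add_power cong_p_add[OF 1 2]])
  moreover have "ev \<zeta> (pCons a u) = ev \<zeta> [:a:] + ev \<zeta> ([:0, 1:] * u)"
    by (simp add: ev_pCons ev_0)
  ultimately show ?case by simp
qed

text \<open>The localization at the kernel of \<open>\<zeta> \<mapsto> g\<close>, a prime ideal
  above \<open>p\<close>.\<close>

definition ring :: "'b set" where
  "ring = {ev \<zeta> u / ev \<zeta> w | u w. ev g w \<noteq> 0}"

definition residue :: "'b \<Rightarrow> 'k" where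
  "residue x = (THE c. \<exists>u w. ev g w \<noteq> 0 \<and> x = ev \<zeta> u / ev \<zeta> w \<and> c = ev g u / ev g w)"

lemma ev_\<zeta>_nonzero: "ev g w \<noteq> 0 \<Longrightarrow> ev \<zeta> w \<noteq> 0"
  using compatible by blast

lemma residue_eq:
  assumes "ev g w \<noteq> 0"
  shows "residue (ev \<zeta> u / ev \<zeta> w) = ev g u / ev g w"
  unfolding residue_def
proof (rule the_equality)
  show "\<exists>u' w'. ev g w' \<noteq> 0 \<and> ev \<zeta> u / ev \<zeta> w = ev \<zeta> u' / ev \<zeta> w' \<and> ev g u / ev g w = ev g u' / ev g w'"
    using assms by blast
next
  fix c assume "\<exists>u' w'. ev g w' \<noteq> 0 \<and> ev \<zeta> u / ev \<zeta> w = ev \<zeta> u' / ev \<zeta> w' \<and> c = ev g u' / ev g w'"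
  then obtain u' w' where *: "ev g w' \<noteq> 0" "ev \<zeta> u / ev \<zeta> w = ev \<zeta> u' / ev \<zeta> w'" "c = ev g u' / ev g w'"
    by blast
  then have "ev \<zeta> (u * w' - u' * w) = 0"
    using ev_\<zeta>_nonzero[OF assms] ev_\<zeta>_nonzero[OF *(1)] by (simp add: ev_diff ev_mult frac_eq_eq)
  then have "ev g (u * w' - u' * w) = 0" by (rule compatible)
  then show "c = ev g u / ev g w"
    using assms * by (simp add: ev_diff ev_mult frac_eq_eq)
qed

lemma ringI: "ev g w \<noteq> 0 \<Longrightarrow> ev \<zeta> u / ev \<zeta> w \<in> ring"
  unfolding ring_def by blast

lemma ringE:
  assumes "x \<in> ring"
  obtains u w where "ev g w \<noteq> 0" "ev \<zeta> w \<noteq> 0" "x = ev \<zeta> u / ev \<zeta> w" "residue x = ev g u / ev g w"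
  using assms residue_eq ev_\<zeta>_nonzero unfolding ring_def by blast

lemma ev_in_ring: "ev \<zeta> u \<in> ring" and residue_ev: "residue (ev \<zeta> u) = ev g u"
  using ringI[of 1 u] residue_eq[of 1 u] by (simp_all add: ev_1)

lemma unramified_ring: "unramified ring residue p"
proof
  show "prime p" by (rule p)
  show "1 \<in> ring" "residue 1 = 1" using ev_in_ring[of 1] residue_ev[of 1] by (simp_all add: ev_1)
next
  fix x y assume "x \<in> ring" "y \<in> ring"
  obtain u w where 1: "ev g w \<noteq> 0" "ev \<zeta> w \<noteq> 0" "x = ev \<zeta> u / ev \<zeta> w" "residue x = ev g u / ev g w"
    using \<open>x \<in> ring\<close> by (rule ringE)
  obtain u' w' where 2: "ev g w' \<noteq> 0" "ev \<zeta> w' \<noteq> 0" "y = ev \<zeta> u' / ev \<zeta> w'" "residue y = ev g u' / ev g w'"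
    using \<open>y \<in> ring\<close> by (rule ringE)
  have w: "ev g (w * w') \<noteq> 0" using 1 2 by (simp add: ev_mult)
  have d: "x - y = ev \<zeta> (u * w' - u' * w) / ev \<zeta> (w * w')"
    using 1 2 by (simp add: ev_diff ev_mult diff_frac_eq)
  have m: "x * y = ev \<zeta> (u * u') / ev \<zeta> (w * w')"
    using 1 2 by (simp add: ev_mult)
  show "x - y \<in> ring" "x * y \<in> ring" unfolding d m using w by (simp_all add: ringI)
  show "residue (x - y) = residue x - residue y"
    unfolding d residue_eq[OF w] using 1 2 by (simp add: ev_diff ev_mult diff_frac_eq)
  show "residue (x * y) = residue x * residue y"
    unfolding m residue_eq[OF w] using 1 2 by (simp add: ev_mult)
next
  fix x assume "x \<in> ring" "residue x \<noteq> 0"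
  obtain u w where 1: "ev g w \<noteq> 0" "ev \<zeta> w \<noteq> 0" "x = ev \<zeta> u / ev \<zeta> w" "residue x = ev g u / ev g w"
    using \<open>x \<in> ring\<close> by (rule ringE)
  then have "inverse x = ev \<zeta> w / ev \<zeta> u" "ev g u \<noteq> 0" using \<open>residue x \<noteq> 0\<close> by auto
  then show "inverse x \<in> ring" by (simp add: ringI)
next
  fix c :: 'k
  show "\<exists>x\<in>ring. residue x = c"
  proof (cases "c = 0")
    case True
    then show ?thesis using ev_in_ring[of 0] residue_ev[of 0] by (auto simp: ev_0)
  next
    case False
    then obtain j where "c = g ^ j" using generator by blast
    then show ?thesis using ev_in_ring[of "Polynomial.monom 1 j"] residue_ev[of "Polynomial.monom 1 j"] by (auto simp: ev_monom)
  qed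
next
  fix x assume "x \<in> ring"
  have p0: "of_nat p \<noteq> (0 :: 'b)" using p by (auto dest: prime_gt_0_nat)
  have ev_p: "ev y [:int p:] = of_nat p" for y :: "'c::comm_ring_1" by (simp add: ev_const)
  show "residue x = 0 \<longleftrightarrow> x / of_nat p \<in> ring"
  proof
    assume "x / of_nat p \<in> ring"
    then obtain u w where 1: "ev g w \<noteq> 0" "ev \<zeta> w \<noteq> 0" "x / of_nat p = ev \<zeta> u / ev \<zeta> w"
      by (rule ringE)
    then have "x = ev \<zeta> ([:int p:] * u) / ev \<zeta> w"
      using p0 by (simp only: ev_mult ev_p) (simp add: field_simps)
    then have "residue x = ev g ([:int p:] * u) / ev g w" by (simp only: residue_eq[OF 1(1)])
    also have "\<dots> = 0" by (simp only: ev_mult ev_p of_nat_p) simp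
    finally show "residue x = 0" .
  next
    assume res: "residue x = 0"
    obtain u w where 1: "ev g w \<noteq> 0" "ev \<zeta> w \<noteq> 0" "x = ev \<zeta> u / ev \<zeta> w" "residue x = ev g u / ev g w"
      using \<open>x \<in> ring\<close> by (rule ringE)
    have gu: "ev g u = 0" using res 1 by simp
    obtain r where r: "ev \<zeta> u ^ p ^ N - ev \<zeta> u = of_nat p * ev \<zeta> r"
      using cong_p_power_q[of u] unfolding cong_p_def by blast
    have qn: "p ^ N = Suc n" using n_pos n by simp
    \<comment> \<open>The numerator \<open>u\<close> has residue 0, so \<open>w'\<close> has residue
      -1 and may serve as a denominator, while \<open>u * w' = u^q - u\<close> is divisible by
      \<open>p\<close>.\<close>
    define w' where "w' = u ^ n - 1"
    have gw': "ev g w' \<noteq> 0" using gu n_pos by (simp add: w'_def ev_diff ev_power ev_1 power_0_left)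
    then have \<zeta>w': "ev \<zeta> w' \<noteq> 0" by (rule ev_\<zeta>_nonzero)
    have "ev \<zeta> u * ev \<zeta> w' = of_nat p * ev \<zeta> r"
      using r by (simp add: qn w'_def ev_diff ev_power ev_1 algebra_simps)
    then have "x / of_nat p = ev \<zeta> r / ev \<zeta> (w * w')"
      using 1 p0 \<zeta>w' by (simp add: ev_mult field_simps)
    moreover have "ev g (w * w') \<noteq> 0" using 1 gw' by (simp add: ev_mult)
    ultimately show "x / of_nat p \<in> ring" by (simp add: ringI)
  qed
qed

lemma ring_integral:
  assumes "x \<in> ring" "x \<noteq> 0"
  shows "\<exists>y\<in>ring. \<exists>c. c \<noteq> 0 \<and> x * y = of_int c"
proof -
  obtain u w where 1: "ev g w \<noteq> 0" "ev \<zeta> w \<noteq> 0" "x = ev \<zeta> u / ev \<zeta> w"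
    using \<open>x \<in> ring\<close> by (rule ringE)
  then have "ev \<zeta> u \<noteq> 0" using assms by auto
  then obtain b c where "c \<noteq> 0" "ev \<zeta> b * ev \<zeta> u = of_int c" using integral by blast
  moreover have "x * ev \<zeta> (b * w) = ev \<zeta> b * ev \<zeta> u" using 1 by (simp add: ev_mult)
  ultimately have "x * ev \<zeta> (b * w) = of_int c" by simp
  then show ?thesis using \<open>c \<noteq> 0\<close> ev_in_ring by blast
qed

end

section \<open>Valuations\<close>

sublocale compatible_roots \<subseteq> unramified ring residue p
  by (rule unramified_ring)

context compatible_roots
begin

section \<open>Units, powers of \<open>p\<close> and valuations\<close>

definition unit :: "'b \<Rightarrow> bool" where
  "unit u \<longleftrightarrow> u \<in> ring \<and> residue u \<noteq> 0"

lemma unit_nonzero: "unit u \<Longrightarrow> u \<noteq> 0"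
  using \<phi>_zero by (auto simp: unit_def)

lemma unit_mult: "unit u \<Longrightarrow> unit w \<Longrightarrow> unit (u * w)"
  by (simp add: unit_def mult_closed \<phi>_mult)

lemma unit_one: "unit 1"
  by (simp add: unit_def one_closed \<phi>_one)

lemma unit_inverse: "unit u \<Longrightarrow> unit (inverse u)"
proof -
  assume u: "unit u"
  then have "inverse u \<in> ring" by (simp add: unit_def inverse_closed)
  moreover have "residue u * residue (inverse u) = 1"
    using u calculation \<phi>_mult[of u "inverse u"] unit_nonzero[OF u] by (simp add: unit_def \<phi>_one)
  ultimately show ?thesis by (auto simp: unit_def)
qed

lemma unit_if_mult_eq_one: "x \<in> ring \<Longrightarrow> y \<in> ring \<Longrightarrow> x * y = 1 \<Longrightarrow> unit x"
  using \<phi>_mult[of x y] by (auto simp: unit_def \<phi>_one)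

lemma not_unit_p_power:
  assumes "x \<in> ring" "k > 0"
  shows "\<not> unit (of_nat p ^ k * x)"
  using assms by (simp add: unit_def \<phi>_mult \<phi>_power p_power_closed of_nat_closed \<phi>_of_nat of_nat_p)

text \<open>A power of \<open>p\<close> dividing \<open>x\<close> also divides the nonzero integer
  \<open>c\<close>, so there is a largest one; the quotient by it has nonzero residue.\<close>

lemma ring_decomposition:
  assumes x: "x \<in> ring" "x \<noteq> 0"
  shows "\<exists>k u. unit u \<and> x = of_nat p ^ k * u"
proof -
  obtain y c where y: "y \<in> ring" "c \<noteq> 0" "x * y = of_int c" using ring_integral[OF x] by blast
  have bound: "k < nat \<bar>c\<bar>" if "pdiv k x" for k
  proof -
    have "pdiv k (of_int c)" using pdiv_mult[OF y(1) that] y(3) by (simp add: mult.commute)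
    then have "int p ^ k dvd c" by (simp add: pdiv_of_int)
    then have "int p ^ k \<le> \<bar>c\<bar>" using y(2) dvd_imp_le_int[of c "int p ^ k"] by simp
    moreover have "int k < int p ^ k"
      using power_gt_expt[of p k] prime_gt_1_nat[OF p] by (simp flip: of_nat_power)
    ultimately show ?thesis by linarith
  qed
  have "pdiv 0 x" using x by (simp add: pdiv_0)
  define k where "k = (GREATEST k. pdiv k x)"
  have k: "pdiv k x"
    unfolding k_def by (rule GreatestI_nat[of _ 0 "nat \<bar>c\<bar>"]) (use \<open>pdiv 0 x\<close> bound in \<open>auto intro: less_imp_le\<close>)
  have "\<not> pdiv (Suc k) x"
  proof
    assume "pdiv (Suc k) x"
    then have "Suc k \<le> k"
      unfolding k_def by (rule Greatest_le_nat[of _ _ "nat \<bar>c\<bar>"]) (use bound in \<open>auto intro: less_imp_le\<close>)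
    then show False by simp
  qed
  then have "residue (x / of_nat p ^ k) \<noteq> 0"
    using k \<phi>_eq_0_iff[of "x / of_nat p ^ k"] by (simp add: pdiv_def mult.commute)
  then have "unit (x / of_nat p ^ k)" using k by (simp add: unit_def pdiv_def)
  then show ?thesis using p_nonzero by (intro exI[of _ k] exI[of _ "x / of_nat p ^ k"]) simp
qed

text \<open>The nonzero elements of the fraction field of \<open>ring\<close>. Excluding 0 keeps
  \<open>val\<close> integer-valued.\<close>

definition fraction :: "'b \<Rightarrow> bool" where
  "fraction z \<longleftrightarrow> (\<exists>(k::int) u. unit u \<and> z = of_nat p powi k * u)"

definition val :: "'b \<Rightarrow> int" where
  "val z = (THE k. \<exists>u. unit u \<and> z = of_nat p powi k * u)"

lemma p_powi_closed: "k \<ge> 0 \<Longrightarrow> of_nat p powi k \<in> ring"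
  by (simp add: power_int_def p_power_closed)

lemma val_eqI:
  assumes "unit u" "z = of_nat p powi k * u"
  shows "val z = k"
  unfolding val_def
proof (rule the_equality)
  show "\<exists>u. unit u \<and> z = of_nat p powi k * u" using assms by blast
next
  fix j assume "\<exists>u. unit u \<and> z = of_nat p powi j * u"
  then obtain w where w: "unit w" "z = of_nat p powi j * w" by blast
  have eq: "of_nat p powi k * u = of_nat p powi j * w" using assms(2) w(2) by simp
  have False if "unit a" "unit b" "of_nat p powi i * a = of_nat p powi j * b" "i < j" for i j :: int and a b
  proof -
    have "of_nat p powi j = (of_nat p powi (i + int (nat (j - i))) :: 'b)" using that(4) by simp
    also have "\<dots> = of_nat p powi i * of_nat p powi int (nat (j - i))"
      by (rule power_int_add[OF disjI1[OF p_nonzero]])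
    finally have "of_nat p powi j = (of_nat p powi i * of_nat p ^ nat (j - i) :: 'b)"
      by (simp only: power_int_of_nat)
    then have "a = of_nat p ^ nat (j - i) * b" using that(3) p_nonzero by simp
    then show False using that not_unit_p_power[of b "nat (j - i)"] by (simp add: unit_def)
  qed
  from this[OF assms(1) w(1) eq] this[OF w(1) assms(1) eq[symmetric]]
  show "j = k" by (cases j k rule: linorder_cases) auto
qed

lemma fractionE:
  assumes "fraction z"
  obtains u where "unit u" "z = of_nat p powi val z * u"
  using assms val_eqI unfolding fraction_def by metis

lemma fraction_nonzero: "fraction z \<Longrightarrow> z \<noteq> 0"
  using p_nonzero unit_nonzero by (auto simp: fraction_def)

lemma fraction_mult: "fraction x \<Longrightarrow> fraction y \<Longrightarrow> fraction (x * y)"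
  and val_mult: "fraction x \<Longrightarrow> fraction y \<Longrightarrow> val (x * y) = val x + val y"
proof -
  assume "fraction x" "fraction y"
  obtain u where u: "unit u" "x = of_nat p powi val x * u" using \<open>fraction x\<close> by (rule fractionE)
  obtain w where w: "unit w" "y = of_nat p powi val y * w" using \<open>fraction y\<close> by (rule fractionE)
  have *: "x * y = of_nat p powi (val x + val y) * (u * w)"
    using p_nonzero by (subst u(2), subst w(2)) (simp add: power_int_add)
  then show "fraction (x * y)" unfolding fraction_def using unit_mult[OF u(1) w(1)] by blast
  show "val (x * y) = val x + val y" using val_eqI[OF unit_mult[OF u(1) w(1)] *] .
qed

lemma fraction_inverse: "fraction x \<Longrightarrow> fraction (inverse x)"
  and val_inverse: "fraction x \<Longrightarrow> val (inverse x) = - val x"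
proof -
  assume "fraction x"
  then obtain u where u: "unit u" "x = of_nat p powi val x * u" by (rule fractionE)
  have *: "inverse x = of_nat p powi (- val x) * inverse u"
    by (subst u(2)) (simp add: power_int_minus)
  then show "fraction (inverse x)" unfolding fraction_def using unit_inverse[OF u(1)] by blast
  show "val (inverse x) = - val x" using val_eqI[OF unit_inverse[OF u(1)] *] .
qed

lemma fraction_divide: "fraction x \<Longrightarrow> fraction y \<Longrightarrow> fraction (x / y)"
  by (simp add: divide_inverse fraction_mult fraction_inverse)

lemma fraction_unit: "unit u \<Longrightarrow> fraction u" and val_unit: "unit u \<Longrightarrow> val u = 0"
proof -
  assume u: "unit u"
  have *: "u = of_nat p powi 0 * u" by simp
  show "fraction u" unfolding fraction_def using u * by blast
  show "val u = 0" by (rule val_eqI[OF u *])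
qed

lemma fraction_power: "fraction x \<Longrightarrow> fraction (x ^ k)"
  and val_power: "fraction x \<Longrightarrow> val (x ^ k) = int k * val x"
proof -
  assume x: "fraction x"
  have "fraction (x ^ k) \<and> val (x ^ k) = int k * val x"
    by (induction k) (auto simp: fraction_unit unit_one val_unit fraction_mult val_mult x algebra_simps)
  then show "fraction (x ^ k)" "val (x ^ k) = int k * val x" by simp_all
qed

lemma fraction_p: "fraction (of_nat p)" and val_p: "val (of_nat p) = 1"
  unfolding fraction_def using val_eqI[OF unit_one, of "of_nat p" 1] unit_one
  by (auto intro!: exI[of _ 1])

lemma fraction_ring: "x \<in> ring \<Longrightarrow> x \<noteq> 0 \<Longrightarrow> fraction x"
  using ring_decomposition[of x] unfolding fraction_def by (metis power_int_of_nat)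

lemma pdiv_iff_val: "fraction z \<Longrightarrow> pdiv k z \<longleftrightarrow> int k \<le> val z"
proof -
  assume "fraction z"
  then obtain u where u: "unit u" "z = of_nat p powi val z * u" by (rule fractionE)
  have z: "z / of_nat p ^ k = of_nat p powi (val z - int k) * u"
    using p_nonzero by (subst u(2)) (simp add: power_int_diff)
  show ?thesis
  proof
    assume "int k \<le> val z"
    then show "pdiv k z" unfolding pdiv_def z using u(1) by (simp add: unit_def mult_closed p_powi_closed)
  next
    assume "pdiv k z"
    then have ring: "of_nat p powi (val z - int k) * u \<in> ring" by (simp add: pdiv_def z)
    show "int k \<le> val z"
    proof (rule ccontr)
      assume "\<not> int k \<le> val z"
      define m where "m = nat (int k - val z)"
      have "m > 0" "val z - int k = - int m" using \<open>\<not> int k \<le> val z\<close> by (simp_all add: m_def)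
      then have "u = of_nat p ^ m * (of_nat p powi (val z - int k) * u)"
        using p_nonzero by (simp add: power_int_minus)
      then show False using not_unit_p_power[OF ring \<open>m > 0\<close>] u(1) by metis
    qed
  qed
qed

lemma in_ring_iff_val: "fraction z \<Longrightarrow> z \<in> ring \<longleftrightarrow> 0 \<le> val z"
  using pdiv_iff_val[of z 0] by (simp add: pdiv_0)

text \<open>The valuation extended to the elements whose \<open>n\<close>-th power is a fraction: this
  covers Gauss sums, which lie in a ramified extension.\<close>

definition radical :: "'b \<Rightarrow> bool" where
  "radical z \<longleftrightarrow> fraction (z ^ n)"

definition rval :: "'b \<Rightarrow> real" where
  "rval z = of_int (val (z ^ n)) / real n"

lemma radical_mult: "radical x \<Longrightarrow> radical y \<Longrightarrow> radical (x * y)"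
  and rval_mult: "radical x \<Longrightarrow> radical y \<Longrightarrow> rval (x * y) = rval x + rval y"
  by (simp_all add: radical_def rval_def power_mult_distrib fraction_mult val_mult add_divide_distrib)

lemma rval_divide:
  assumes "radical x" "radical y"
  shows "rval (x / y) = rval x - rval y"
proof -
  have *: "fraction (x ^ n)" "fraction (inverse (y ^ n))" "fraction (y ^ n)"
    using assms by (simp_all add: radical_def fraction_inverse)
  have "(x / y) ^ n = x ^ n * inverse (y ^ n)" by (simp add: power_mult_distrib power_inverse divide_inverse)
  then show ?thesis
    unfolding rval_def using * by (simp add: val_mult val_inverse diff_divide_distrib)
qed

lemma rval_fraction: "fraction x \<Longrightarrow> rval x = of_int (val x)"
  using n_pos by (simp add: rval_def val_power)

end

section \<open>Gauss and Jacobi sums\<close>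

locale gauss_sums = compatible_roots \<zeta> g n p N
  for \<zeta> :: "'b::field_char_0" and g :: "'k::{finite,field}" and n p N +
  fixes \<omega> :: 'b
  assumes \<omega>: "\<And>j. \<omega> ^ j = 1 \<longleftrightarrow> p dvd j"
begin

section \<open>Multiplicative characters\<close>

lemma power_eq_iff_cong:
  fixes z :: "'c::field"
  assumes "\<And>j. z ^ j = 1 \<longleftrightarrow> d dvd j" "d > 0"
  shows "z ^ i = z ^ j \<longleftrightarrow> [i = j] (mod d)"
proof -
  have "z \<noteq> 0" using assms by (metis dvd_refl power_0_left zero_neq_one less_not_refl)
  have *: "z ^ i = z ^ j \<longleftrightarrow> [i = j] (mod d)" if "i \<le> j" for i j
  proof -
    have "z ^ j = z ^ i * z ^ (j - i)" using that by (simp flip: power_add)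
    then have "z ^ i = z ^ j \<longleftrightarrow> z ^ (j - i) = 1" using \<open>z \<noteq> 0\<close> by auto
    also have "\<dots> \<longleftrightarrow> [j = i] (mod d)" using assms(1) that by (simp add: cong_altdef_nat)
    finally show ?thesis by (simp add: cong_sym_eq)
  qed
  show ?thesis using *[of i j] *[of j i] by (cases "i \<le> j") (auto simp: cong_sym_eq)
qed

lemma g_power_eq_iff: "g ^ i = g ^ j \<longleftrightarrow> [i = j] (mod n)"
  by (rule power_eq_iff_cong[OF g_power_eq_1_iff n_pos])

lemma \<zeta>_power_eq_iff: "\<zeta> ^ i = \<zeta> ^ j \<longleftrightarrow> [i = j] (mod n)"
  by (rule power_eq_iff_cong[OF \<zeta> n_pos])

lemma card_k': "CARD('k) = Suc n"
  using n n_pos card_k by simp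

lemma x_power_n: "x \<noteq> 0 \<Longrightarrow> x ^ n = (1 :: 'k)"
  using finite_field_power_card_minus_1[of x] by (simp add: card_k')

text \<open>The logarithm has the base \<open>inverse g\<close>, so that \<open>\<theta> a\<close> reduces to \<open>x \<mapsto> x ^ (- a)\<close>;
  this is the sign for which Stickelberger's formula holds without complementing digits.\<close>

definition dlog :: "'k \<Rightarrow> nat" where
  "dlog x = (SOME j. x * g ^ j = 1)"

lemma dlog: "x \<noteq> 0 \<Longrightarrow> x * g ^ dlog x = 1"
  unfolding dlog_def
proof (rule someI_ex)
  assume "x \<noteq> 0"
  then obtain j where "inverse x = g ^ j" using generator[of "inverse x"] by auto
  then show "\<exists>j. x * g ^ j = 1" using \<open>x \<noteq> 0\<close> by (metis right_inverse)
qed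

text \<open>The character is extended by 0 at 0 even when it is trivial. So
  \<open>\<theta> 0\<close> is the indicator of the nonzero elements, and the constant function 1 is
  none of the \<open>\<theta> a\<close>.\<close>

definition \<theta> :: "nat \<Rightarrow> 'k \<Rightarrow> 'b" where
  "\<theta> a x = (if x = 0 then 0 else \<zeta> ^ (a * dlog x))"

lemma \<theta>_eqI: "x * g ^ j = 1 \<Longrightarrow> \<theta> a x = \<zeta> ^ (a * j)"
proof -
  assume *: "x * g ^ j = 1"
  then have x: "x \<noteq> 0" by auto
  have "g ^ dlog x = g ^ j" using dlog[OF x] * x by (metis mult_left_cancel)
  then have "[a * dlog x = a * j] (mod n)" by (intro cong_scalar_left) (simp add: g_power_eq_iff)
  then show ?thesis using x by (simp add: \<theta>_def \<zeta>_power_eq_iff)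
qed

lemma \<theta>_zero [simp]: "\<theta> a 0 = 0"
  by (simp add: \<theta>_def)

lemma \<theta>_one [simp]: "\<theta> a 1 = 1"
  using \<theta>_eqI[of 1 0 a] by simp

lemma \<theta>_mult: "\<theta> a (x * y) = \<theta> a x * \<theta> a y"
proof (cases "x = 0 \<or> y = 0")
  case False
  have "(x * y) * g ^ (dlog x + dlog y) = (x * g ^ dlog x) * (y * g ^ dlog y)"
    by (simp add: power_add mult_ac)
  also have "\<dots> = 1" using False by (simp add: dlog)
  finally have "(x * y) * g ^ (dlog x + dlog y) = 1" .
  from \<theta>_eqI[OF this, of a] False show ?thesis by (simp add: \<theta>_def power_add algebra_simps)
qed auto

lemma \<theta>_power: "k > 0 \<Longrightarrow> \<theta> a (x ^ k) = \<theta> a x ^ k"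
  by (induction k rule: nat_induct_non_zero) (simp_all add: \<theta>_mult)

lemma \<theta>_add: "\<theta> (a + b) x = \<theta> a x * \<theta> b x"
  by (simp add: \<theta>_def power_add algebra_simps)

lemma \<theta>_times: "k > 0 \<Longrightarrow> \<theta> (k * a) x = \<theta> a (x ^ k)"
  by (simp add: \<theta>_power) (simp add: \<theta>_def mult_ac power_0_left flip: power_mult)

lemma \<theta>_cong: "[a = b] (mod n) \<Longrightarrow> \<theta> a x = \<theta> b x"
  by (simp add: \<theta>_def \<zeta>_power_eq_iff cong_scalar_right)

lemma \<theta>_trivial: "n dvd a \<Longrightarrow> x \<noteq> 0 \<Longrightarrow> \<theta> a x = 1"
  using \<theta>_cong[of a 0 x] by (simp add: cong_0_iff) (simp add: \<theta>_def)

lemma \<theta>_eq_0_iff [simp]: "\<theta> a x = 0 \<longleftrightarrow> x = 0"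
  using \<zeta>[of n] n_pos by (auto simp: \<theta>_def power_0_left)

lemma \<theta>_inverse: "x \<noteq> 0 \<Longrightarrow> \<theta> a (inverse x) = inverse (\<theta> a x)"
  using \<theta>_mult[of a x "inverse x"] by (simp add: inverse_unique)

lemma \<theta>_divide: "y \<noteq> 0 \<Longrightarrow> \<theta> a (x / y) = \<theta> a x / \<theta> a y"
  by (simp add: divide_inverse \<theta>_mult \<theta>_inverse)

lemma \<theta>_in_ring: "\<theta> a x \<in> ring"
  using ev_in_ring[of "Polynomial.monom 1 (a * dlog x)"]
  by (simp add: \<theta>_def ev_monom zero_closed)

lemma residue_\<theta>: "x \<noteq> 0 \<Longrightarrow> residue (\<theta> a x) = inverse x ^ a"
proof -
  assume x: "x \<noteq> 0"
  have "residue (\<theta> a x) = g ^ (a * dlog x)"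
    using residue_ev[of "Polynomial.monom 1 (a * dlog x)"] x by (simp add: \<theta>_def ev_monom)
  moreover have "g ^ dlog x = inverse x" using dlog[OF x] by (simp add: inverse_unique)
  ultimately show ?thesis by (simp add: mult.commute[of a] power_mult)
qed

lemma sum_UNIV_scale: "c \<noteq> 0 \<Longrightarrow> (\<Sum>x\<in>UNIV. f (c * x)) = (\<Sum>x\<in>UNIV. f (x :: 'k))"
  by (rule sum.reindex_bij_witness[of _ "\<lambda>x. x / c" "\<lambda>x. c * x"]) auto

lemma sum_\<theta>: "(\<Sum>x\<in>UNIV. \<theta> a x) = (if n dvd a then of_nat n else 0)"
proof (cases "n dvd a")
  case True
  have "(\<Sum>x\<in>UNIV. \<theta> a x) = (\<Sum>x\<in>UNIV - {0 :: 'k}. 1)"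
    by (rule sum.mono_neutral_cong_right) (auto simp: \<theta>_trivial True)
  then show ?thesis using True by (simp add: card_Diff_singleton card_k')
next
  case False
  have "\<theta> a (inverse g) = \<zeta> ^ a" using \<theta>_eqI[of "inverse g" 1 a] g_nonzero by simp
  then have ne: "\<theta> a (inverse g) \<noteq> 1" using False by (simp add: \<zeta>)
  have "\<theta> a (inverse g) * (\<Sum>x\<in>UNIV. \<theta> a x) = (\<Sum>x\<in>UNIV. \<theta> a (inverse g * x))"
    by (simp add: sum_distrib_left \<theta>_mult)
  also have "\<dots> = (\<Sum>x\<in>UNIV. \<theta> a x)" by (rule sum_UNIV_scale) (simp add: g_nonzero)
  finally show ?thesis using ne False by simp
qed

section \<open>The trace and the additive character\<close>

definition trace :: "'k \<Rightarrow> 'k" where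
  "trace x = (\<Sum>i<N. x ^ p ^ i)"

lemma prime_CHAR: "prime CHAR('k)"
  by (simp add: CHAR_eq_p p)

lemma N_pos: "N > 0"
  using card_field_ge_2[where 'k = 'k] card_k by (cases N) simp_all

lemma x_power_q: "x ^ p ^ N = (x :: 'k)"
proof -
  have "p ^ N = Suc n" using card_k card_k' by simp
  then show ?thesis by (cases "x = 0") (simp_all add: x_power_n)
qed

lemma trace_add: "trace (x + y) = trace x + trace y"
  by (simp add: trace_def sum.distrib freshmans_dream'[OF prime_CHAR] CHAR_eq_p)

lemma trace_frobenius: "trace (x ^ p) = trace x"
proof -
  have "trace (x ^ p) = (\<Sum>i<N. x ^ p ^ Suc i)" by (simp add: trace_def power_mult)
  also have "\<dots> = (\<Sum>i<Suc N. x ^ p ^ i) - x ^ p ^ 0" by (subst sum.lessThan_Suc_shift) simp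
  also have "\<dots> = trace x" by (simp add: trace_def x_power_q)
  finally show ?thesis .
qed

lemma trace_power_p: "trace x ^ p = trace x"
proof -
  have "trace x ^ p = (\<Sum>i<N. (x ^ p ^ i) ^ p)"
    unfolding trace_def by (rule freshmans_dream_sum[OF prime_CHAR]) (simp add: CHAR_eq_p)
  also have "\<dots> = trace (x ^ p)" by (simp add: trace_def mult.commute flip: power_mult)
  finally show ?thesis by (simp add: trace_frobenius)
qed

lemma of_nat_eq_iff_cong: "of_nat i = (of_nat j :: 'k) \<longleftrightarrow> [i = j] (mod p)"
  using of_nat_eq_iff_cong_CHAR[where 'a = 'k] by (simp add: CHAR_eq_p)

text \<open>The polynomial \<open>X^p - X\<close> has at most \<open>p\<close> roots, and the
  multiples of 1 already supply \<open>p\<close> of them.\<close>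

lemma fixed_by_frobenius: "y ^ p = (y :: 'k) \<Longrightarrow> \<exists>j. y = of_nat j"
proof -
  assume y: "y ^ p = y"
  let ?f = "Polynomial.monom 1 p - Polynomial.monom 1 1 :: 'k poly"
  have p1: "p > 1" using p by (rule prime_gt_1_nat)
  have "Polynomial.coeff ?f 1 \<noteq> 0" using p1 by simp
  then have f0: "?f \<noteq> 0" by (metis coeff_0)
  have roots: "{y. poly ?f y = 0} = {y. y ^ p = y}" by (simp add: poly_monom)
  have "card {y :: 'k. y ^ p = y} \<le> Polynomial.degree ?f"
    using card_poly_roots_bound[OF f0] unfolding roots .
  also have "\<dots> \<le> p" using p1 by (intro degree_diff_le) (simp_all add: degree_monom_eq)
  finally have "card {y :: 'k. y ^ p = y} \<le> p" .
  moreover have "inj_on (of_nat :: nat \<Rightarrow> 'k) {..<p}"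
  proof (rule inj_onI)
    fix i j assume "i \<in> {..<p}" "j \<in> {..<p}" "of_nat i = (of_nat j :: 'k)"
    then show "i = j" unfolding of_nat_eq_iff_cong by (intro cong_less_modulus_unique_nat) simp_all
  qed
  then have "card ((of_nat :: nat \<Rightarrow> 'k) ` {..<p}) = p" by (simp add: card_image)
  moreover have "(of_nat :: nat \<Rightarrow> 'k) ` {..<p} \<subseteq> {y. y ^ p = y}"
  proof
    fix z assume "z \<in> (of_nat :: nat \<Rightarrow> 'k) ` {..<p}"
    then obtain j where z: "z = of_nat j" by auto
    have "[int j ^ p = int j] (mod int p)" using p by (rule fermat_int)
    then have "[j ^ p = j] (mod p)" by (metis cong_int_iff of_nat_power)
    then have "of_nat (j ^ p) = (of_nat j :: 'k)" by (simp only: of_nat_eq_iff_cong)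
    then show "z \<in> {y. y ^ p = y}" by (simp add: z)
  qed
  ultimately have "(of_nat :: nat \<Rightarrow> 'k) ` {..<p} = {y. y ^ p = y}"
    by (intro card_seteq) simp_all
  then show ?thesis using y by blast
qed

definition \<psi> :: "'k \<Rightarrow> 'b" where
  "\<psi> x = \<omega> ^ (SOME j. trace x = of_nat j)"

lemma \<psi>_eqI: "trace x = of_nat j \<Longrightarrow> \<psi> x = \<omega> ^ j"
proof -
  assume j: "trace x = of_nat j"
  then have "trace x = of_nat (SOME j. trace x = of_nat j)" by (rule someI)
  then have "[(SOME j. trace x = of_nat j) = j] (mod p)" using j by (metis of_nat_eq_iff_cong)
  then show ?thesis
    unfolding \<psi>_def by (simp add: power_eq_iff_cong[OF \<omega>] prime_gt_0_nat p)
qed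

lemma \<psi>_add: "\<psi> (x + y) = \<psi> x * \<psi> y"
proof -
  obtain i j where ij: "trace x = of_nat i" "trace y = of_nat j"
    using fixed_by_frobenius[OF trace_power_p] by metis
  then have "trace (x + y) = of_nat (i + j)" by (simp add: trace_add)
  from \<psi>_eqI[OF this] \<psi>_eqI[OF ij(1)] \<psi>_eqI[OF ij(2)] show ?thesis
    by (simp add: power_add)
qed

lemma \<psi>_zero [simp]: "\<psi> 0 = 1"
  using \<psi>_eqI[of 0 0] p by (simp add: trace_def power_0_left prime_gt_0_nat)

lemma \<psi>_frobenius: "\<psi> (x ^ p) = \<psi> x"
  by (simp add: \<psi>_def trace_frobenius)

text \<open>As a polynomial the trace has coefficient 1 at \<open>X\<close> and degree at most
  \<open>p^(N - 1) < q\<close>, so it cannot vanish on the whole field.\<close>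

lemma \<psi>_nontrivial: "\<exists>x. \<psi> x \<noteq> 1"
proof -
  let ?f = "\<Sum>i<N. Polynomial.monom 1 (p ^ i) :: 'k poly"
  have p1: "p > 1" using p by (rule prime_gt_1_nat)
  have "Polynomial.coeff ?f 1 = (\<Sum>i<N. if i = 0 then 1 else 0)"
    using p1 by (auto simp: coeff_sum intro!: sum.cong)
  then have "Polynomial.coeff ?f 1 \<noteq> 0" using N_pos by simp
  then have f0: "?f \<noteq> 0" by (metis coeff_0)
  have "{x. poly ?f x = 0} = {x. trace x = 0}"
    by (simp add: poly_sum poly_monom trace_def)
  then have "card {x :: 'k. trace x = 0} \<le> Polynomial.degree ?f"
    using card_poly_roots_bound[OF f0] by simp
  also have "\<dots> \<le> p ^ (N - 1)"
    using p1 by (intro degree_sum_le) (auto simp: degree_monom_eq intro!: power_increasing)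
  also have "\<dots> < CARD('k)" using p1 N_pos by (simp add: card_k)
  finally have "{x :: 'k. trace x = 0} \<noteq> UNIV" by auto
  then obtain x :: 'k where x: "trace x \<noteq> 0" by blast
  obtain j where j: "trace x = of_nat j" using fixed_by_frobenius[OF trace_power_p] by blast
  then have "\<not> p dvd j" using x of_nat_eq_iff_cong[of j 0] by (simp add: cong_0_iff)
  then show ?thesis using \<psi>_eqI[OF j] \<omega>[of j] by metis
qed

lemma sum_\<psi>: "(\<Sum>x\<in>UNIV. \<psi> x) = 0"
proof -
  obtain c where c: "\<psi> c \<noteq> 1" using \<psi>_nontrivial by blast
  have "\<psi> c * (\<Sum>x\<in>UNIV. \<psi> x) = (\<Sum>x\<in>UNIV. \<psi> (c + x))"
    by (simp add: sum_distrib_left \<psi>_add)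
  also have "\<dots> = (\<Sum>x\<in>UNIV. \<psi> x)"
    by (rule sum.reindex_bij_witness[of _ "\<lambda>x. x - c" "\<lambda>x. c + x"]) auto
  finally show ?thesis using c by simp
qed

section \<open>Products of Gauss sums\<close>

definition gauss :: "nat \<Rightarrow> 'b" where
  "gauss a = (\<Sum>x\<in>UNIV. \<theta> a x * \<psi> x)"

definition jacobi :: "nat \<Rightarrow> nat \<Rightarrow> 'b" where
  "jacobi a b = (\<Sum>x\<in>UNIV. \<theta> a x * \<theta> b (1 - x))"

lemma gauss_trivial: "n dvd a \<Longrightarrow> gauss a = -1"
proof -
  assume "n dvd a"
  then have "gauss a = (\<Sum>x\<in>UNIV - {0}. \<psi> x)"
    unfolding gauss_def by (intro sum.mono_neutral_cong_right) (auto simp: \<theta>_trivial)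
  also have "\<dots> = -1" using sum_\<psi> by (simp add: sum_diff1)
  finally show ?thesis .
qed

lemma gauss_cong: "[a = b] (mod n) \<Longrightarrow> gauss a = gauss b"
  unfolding gauss_def using \<theta>_cong by simp

lemma bij_frobenius: "bij (\<lambda>x :: 'k. x ^ p)"
proof -
  have "inj (\<lambda>x :: 'k. x ^ p)"
  proof (rule injI)
    fix x y :: 'k assume "x ^ p = y ^ p"
    then have "(x ^ p) ^ p ^ (N - 1) = (y ^ p) ^ p ^ (N - 1)" by simp
    then have "x ^ p ^ N = y ^ p ^ N" using N_pos by (simp flip: power_mult power_Suc)
    then show "x = y" by (simp add: x_power_q)
  qed
  then show ?thesis by (simp add: finite_UNIV_inj_surj bij_def)
qed

lemma gauss_frobenius: "gauss (p * a) = gauss a"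
proof -
  have "gauss (p * a) = (\<Sum>x\<in>UNIV. \<theta> a (x ^ p) * \<psi> (x ^ p))"
    unfolding gauss_def by (simp add: \<theta>_times \<psi>_frobenius prime_gt_0_nat p)
  also have "\<dots> = gauss a"
    unfolding gauss_def using sum.reindex_bij_betw[OF bij_frobenius, of "\<lambda>x. \<theta> a x * \<psi> x"] by simp
  finally show ?thesis .
qed

text \<open>The substitution of \<open>s * x\<close> for \<open>x\<close> reduces a nonzero
  \<open>s\<close> to 1; at \<open>s = 0\<close> the two characters merge into one up to a sign. The
  formula serves both the products of Gauss sums and the action of the adjacency matrix on
  characters.\<close>

lemma sum_\<theta>_convolution:
  "(\<Sum>x\<in>UNIV. \<theta> a x * \<theta> b (s - x)) =
     (if s = 0 then \<theta> b (-1) * (\<Sum>x\<in>UNIV. \<theta> (a + b) x) else \<theta> (a + b) s * jacobi a b)"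
proof (cases "s = 0")
  case True
  have "\<theta> a x * \<theta> b (- x) = \<theta> b (-1) * \<theta> (a + b) x" for x
    using \<theta>_mult[of b "-1" x] by (simp add: \<theta>_add mult_ac)
  then show ?thesis using True by (simp add: sum_distrib_left)
next
  case False
  have "(\<Sum>x\<in>UNIV. \<theta> a x * \<theta> b (s - x)) = (\<Sum>x\<in>UNIV. \<theta> a (s * x) * \<theta> b (s - s * x))"
    using sum_UNIV_scale[OF False, of "\<lambda>x. \<theta> a x * \<theta> b (s - x)"] by simp
  also have "\<dots> = (\<Sum>x\<in>UNIV. \<theta> (a + b) s * (\<theta> a x * \<theta> b (1 - x)))"
  proof (rule sum.cong)
    fix x
    have "s - s * x = s * (1 - x)" by (simp add: algebra_simps)
    then show "\<theta> a (s * x) * \<theta> b (s - s * x) = \<theta> (a + b) s * (\<theta> a x * \<theta> b (1 - x))"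
      by (simp add: \<theta>_mult \<theta>_add mult_ac)
  qed simp
  finally show ?thesis using False by (simp add: jacobi_def sum_distrib_left)
qed

lemma sum_shift: "(\<Sum>s\<in>UNIV. f (s - x)) = (\<Sum>s\<in>UNIV. f (s :: 'k))"
  by (rule sum.reindex_bij_witness[of _ "\<lambda>s. s + x" "\<lambda>s. s - x"]) auto

lemma gauss_mult_convolution:
  "gauss a * gauss b = (\<Sum>s\<in>UNIV. \<psi> s * (\<Sum>x\<in>UNIV. \<theta> a x * \<theta> b (s - x)))"
proof -
  have "gauss a * gauss b = (\<Sum>x\<in>UNIV. \<Sum>y\<in>UNIV. \<theta> a x * \<theta> b y * \<psi> (x + y))"
    unfolding gauss_def by (simp add: sum_product \<psi>_add mult_ac)
  also have "\<dots> = (\<Sum>x\<in>UNIV. \<Sum>s\<in>UNIV. \<theta> a x * \<theta> b (s - x) * \<psi> (x + (s - x)))"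
    by (intro sum.cong refl sum_shift[symmetric])
  also have "\<dots> = (\<Sum>s\<in>UNIV. \<Sum>x\<in>UNIV. \<theta> a x * \<theta> b (s - x) * \<psi> s)"
    by (subst sum.swap) simp
  finally show ?thesis by (simp add: sum_distrib_left mult_ac)
qed

lemma gauss_mult:
  assumes "\<not> n dvd a + b"
  shows "gauss a * gauss b = jacobi a b * gauss (a + b)"
proof -
  have "(\<Sum>x\<in>UNIV. \<theta> a x * \<theta> b (s - x)) = \<theta> (a + b) s * jacobi a b" for s
    using assms by (simp add: sum_\<theta>_convolution sum_\<theta>)
  then have "gauss a * gauss b = (\<Sum>s\<in>UNIV. \<psi> s * (\<theta> (a + b) s * jacobi a b))"
    by (simp only: gauss_mult_convolution)
  also have "\<dots> = jacobi a b * gauss (a + b)"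
    unfolding gauss_def by (simp add: sum_distrib_left mult_ac)
  finally show ?thesis .
qed

lemma sum_\<theta>_convolution_opposite:
  assumes "n dvd a + b"
  shows "(\<Sum>x\<in>UNIV. \<theta> a x * \<theta> b (s - x)) = (if s = 0 then \<theta> b (-1) * of_nat n else jacobi a b)"
  using assms by (simp add: sum_\<theta>_convolution sum_\<theta> \<theta>_trivial)

text \<open>Summed over all \<open>s\<close>, the convolution is a product of two full character
  sums and vanishes. The term \<open>s = 0\<close> and the \<open>n\<close> equal remaining terms
  then determine the Jacobi sum.\<close>

lemma jacobi_opposite:
  assumes "n dvd a + b" "\<not> n dvd a"
  shows "jacobi a b = - \<theta> b (-1)"
proof -
  have "(\<Sum>s\<in>UNIV. \<Sum>x\<in>UNIV. \<theta> a x * \<theta> b (s - x)) = (\<Sum>x\<in>UNIV. \<Sum>s\<in>UNIV. \<theta> a x * \<theta> b (s - x))"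
    by (rule sum.swap)
  also have "\<dots> = 0"
    using assms by (simp add: sum_shift sum_\<theta> flip: sum_distrib_left sum_distrib_right)
  finally have "0 = (\<Sum>s\<in>UNIV. \<Sum>x\<in>UNIV. \<theta> a x * \<theta> b (s - x))" ..
  also have "\<dots> = \<theta> b (-1) * of_nat n + (\<Sum>s\<in>UNIV - {0 :: 'k}. jacobi a b)"
    unfolding sum_\<theta>_convolution_opposite[OF assms(1)] by (subst sum.remove[of _ 0]) simp_all
  also have "\<dots> = of_nat n * (\<theta> b (-1) + jacobi a b)"
    by (simp add: card_Diff_singleton card_k' algebra_simps)
  finally show ?thesis using n_pos by (simp add: eq_neg_iff_add_eq_0 add.commute)
qed

lemma gauss_mult_opposite:
  assumes "n dvd a + b" "\<not> n dvd a"
  shows "gauss a * gauss b = \<theta> b (-1) * of_nat (Suc n)"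
proof -
  have "gauss a * gauss b = \<theta> b (-1) * of_nat n + (\<Sum>s\<in>UNIV - {0}. \<psi> s * jacobi a b)"
    unfolding gauss_mult_convolution sum_\<theta>_convolution_opposite[OF assms(1)]
    by (subst sum.remove[of _ 0]) simp_all
  also have "(\<Sum>s\<in>UNIV - {0}. \<psi> s * jacobi a b) = - jacobi a b"
    using sum_\<psi> by (simp add: sum_diff1 flip: sum_distrib_right)
  finally show ?thesis by (simp add: jacobi_opposite[OF assms] algebra_simps)
qed

lemma gauss_nonzero: "gauss a \<noteq> 0"
proof (cases "n dvd a")
  case True
  then show ?thesis by (simp add: gauss_trivial)
next
  case False
  have "a + (n - 1) * a = n * a" using n_pos by (cases n) simp_all
  then have "n dvd a + (n - 1) * a" by simp
  from gauss_mult_opposite[OF this False] show ?thesis by (auto simp del: of_nat_Suc)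
qed

end

section \<open>Valuations of Gauss sums and carries\<close>

text \<open>Unlike \<open>digit_sum\<close>, this does not reduce \<open>a\<close> modulo
  \<open>p ^ N - 1\<close>, so it admits recursion on \<open>N\<close> by splitting off the lowest
  digit.\<close>

definition digits_sum :: "nat \<Rightarrow> nat \<Rightarrow> nat \<Rightarrow> nat" where
  "digits_sum p N a = (\<Sum>i<N. a div p ^ i mod p)"

lemma digits_sum_Suc: "digits_sum p (Suc N) a = a mod p + digits_sum p N (a div p)"
  unfolding digits_sum_def by (subst sum.lessThan_Suc_shift) (simp add: div_mult2_eq)

lemma digits_sum_Suc_top: "a < p ^ N \<Longrightarrow> digits_sum p (Suc N) a = digits_sum p N a"
  by (simp add: digits_sum_def)

lemma digits_sum_mult:
  assumes "p > 0" "p * a < p ^ N"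
  shows "digits_sum p N (p * a) = digits_sum p N a"
proof (cases N)
  case 0
  then show ?thesis by (simp add: digits_sum_def)
next
  case (Suc M)
  have "a < p ^ M" using assms by (simp add: Suc)
  then show ?thesis using assms(1) unfolding Suc
    by (subst digits_sum_Suc) (simp add: digits_sum_Suc_top)
qed

lemma digits_sum_succ:
  assumes "N > 0" "\<not> p dvd Suc a"
  shows "digits_sum p N (Suc a) = Suc (digits_sum p N a)"
proof -
  obtain M where N: "N = Suc M" using assms(1) by (cases N) auto
  have "Suc a div p = a div p" "Suc a mod p = Suc (a mod p)"
    using assms(2) by (simp_all add: div_Suc mod_Suc dvd_eq_mod_eq_0 split: if_splits)
  then show ?thesis by (simp add: N digits_sum_Suc)
qed

lemma digits_sum_max: "p > 0 \<Longrightarrow> digits_sum p N (p ^ N - 1) = N * (p - 1)"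
proof (induction N)
  case 0
  then show ?case by (simp add: digits_sum_def)
next
  case (Suc N)
  have "p ^ N > 0" using Suc.prems by simp
  then have "p ^ Suc N - 1 = p * (p ^ N - 1) + (p - 1)"
    using Suc.prems by (simp add: algebra_simps)
  moreover have "(p * x + r) div p = x" "(p * x + r) mod p = r" if "r < p" for x r
    using that by simp_all
  from this[of "p - 1" "p ^ N - 1"]
  have "(p * (p ^ N - 1) + (p - 1)) div p = p ^ N - 1" "(p * (p ^ N - 1) + (p - 1)) mod p = p - 1"
    using Suc.prems by simp_all
  ultimately show ?case using Suc by (simp add: digits_sum_Suc)
qed

lemma digit_sum_eq: "digit_sum p N a = digits_sum p N (a mod (p ^ N - 1))"
  by (simp add: digit_sum_def digit_def digits_sum_def)

context gauss_sums
begin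

lemma jacobi_in_ring: "jacobi a b \<in> ring"
  unfolding jacobi_def by (intro sum_closed mult_closed \<theta>_in_ring)

lemma minus_one_sign_in_ring: "\<theta> a (-1) * of_nat m \<in> ring"
  by (intro mult_closed \<theta>_in_ring of_nat_closed)

text \<open>The quotient is a Jacobi sum, or up to sign 1 or \<open>q\<close> when
  \<open>a + b\<close> gives the trivial character. The root \<open>\<omega>\<close> has cancelled,
  although a single Gauss sum need not be a fraction.\<close>

lemma gauss_cocycle_in_ring: "gauss a * gauss b / gauss (a + b) \<in> ring"
proof (cases "n dvd a + b")
  case False
  then show ?thesis using gauss_nonzero[of "a + b"] by (simp add: gauss_mult jacobi_in_ring)
next
  case True
  show ?thesis
  proof (cases "n dvd a")
    case True
    then have "n dvd b" using \<open>n dvd a + b\<close> by (simp add: dvd_add_right_iff)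
    then show ?thesis using True \<open>n dvd a + b\<close> by (simp add: gauss_trivial uminus_closed one_closed)
  next
    case False
    then show ?thesis
      using True uminus_closed[OF minus_one_sign_in_ring[of b "Suc n"]]
      by (simp add: gauss_mult_opposite gauss_trivial del: of_nat_Suc)
  qed
qed

lemma gauss_cocycle_fraction: "fraction (gauss a * gauss b / gauss (a + b))"
  by (intro fraction_ring gauss_cocycle_in_ring) (simp add: gauss_nonzero)

text \<open>A telescoping product of cocycles. For \<open>m = n\<close> the denominator is -1, which
  makes \<open>gauss a ^ n\<close> a fraction and the extended valuation applicable.\<close>

lemma gauss_power_fraction: "m > 0 \<Longrightarrow> fraction (gauss a ^ m / gauss (m * a))"
proof (induction m rule: nat_induct_non_zero)
  case 1
  then show ?case by (simp add: gauss_nonzero fraction_unit unit_one)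
next
  case (Suc m)
  have "gauss a ^ Suc m / gauss (Suc m * a) =
      (gauss a ^ m / gauss (m * a)) * (gauss (m * a) * gauss a / gauss (m * a + a))"
    using gauss_nonzero[of "m * a"] by (simp add: add.commute field_simps)
  then show ?case using Suc.IH gauss_cocycle_fraction by (metis fraction_mult)
qed

lemma fraction_uminus: "fraction x \<Longrightarrow> fraction (- x)"
proof -
  assume "fraction x"
  moreover have "unit (-1)"
    by (rule unit_if_mult_eq_one[of _ "-1"]) (simp_all add: uminus_closed one_closed)
  ultimately show ?thesis using fraction_mult[OF fraction_unit, of "-1" x] by simp
qed

lemma radical_gauss: "radical (gauss a)"
proof -
  have "fraction (- (gauss a ^ n / gauss (n * a)))"
    by (intro fraction_uminus gauss_power_fraction n_pos)
  then show ?thesis by (simp add: radical_def gauss_trivial)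
qed

definition gval :: "nat \<Rightarrow> real" where
  "gval a = rval (gauss a)"

lemma gval_cocycle: "gval a + gval b - gval (a + b) = of_int (val (gauss a * gauss b / gauss (a + b)))"
proof -
  have "rval (gauss a * gauss b / gauss (a + b)) = gval a + gval b - gval (a + b)"
    by (simp add: gval_def rval_divide rval_mult radical_gauss radical_mult)
  then show ?thesis by (simp add: rval_fraction gauss_cocycle_fraction)
qed

lemma gval_cocycle_nonneg: "val (gauss a * gauss b / gauss (a + b)) \<ge> 0"
  using gauss_cocycle_in_ring gauss_cocycle_fraction by (simp flip: in_ring_iff_val)

lemma gval_frobenius: "gval (p * a) = gval a"
  by (simp add: gval_def gauss_frobenius)

lemma gval_cong: "[a = b] (mod n) \<Longrightarrow> gval a = gval b"
  using gauss_cong by (simp add: gval_def)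

lemma unit_sign: "unit (\<theta> a (-1))"
  using \<theta>_mult[of a "-1" "-1"] by (intro unit_if_mult_eq_one[of _ "\<theta> a (-1)"]) (simp_all add: \<theta>_in_ring)

lemma of_nat_q: "of_nat (Suc n) = (of_nat p ^ N :: 'b)"
proof -
  have "Suc n = p ^ N" using card_k card_k' by simp
  then show ?thesis by (simp only: of_nat_power)
qed

lemma gval_opposite:
  assumes "n dvd a + b" "\<not> n dvd a"
  shows "gval a + gval b = N"
proof -
  have "gval a + gval b = rval (gauss a * gauss b)"
    by (simp add: gval_def rval_mult radical_gauss)
  also have "\<dots> = rval (\<theta> b (-1) * of_nat p ^ N)"
    unfolding gauss_mult_opposite[OF assms] of_nat_q ..
  also have "\<dots> = real N"
    using fraction_unit[OF unit_sign] fraction_power[OF fraction_p]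
    by (subst rval_fraction) (simp_all add: fraction_mult val_mult val_power val_unit unit_sign fraction_p val_p)
  finally show ?thesis .
qed

section \<open>Jacobi sums modulo \<open>p\<close> and Stickelberger's theorem\<close>

lemma sum_inverse_power:
  assumes "\<not> n dvd a"
  shows "(\<Sum>x\<in>UNIV - {0}. inverse x ^ a) = (0 :: 'k)"
proof -
  have "0 = residue (\<Sum>x\<in>UNIV. \<theta> a x)" using assms by (simp add: sum_\<theta> \<phi>_zero)
  also have "\<dots> = (\<Sum>x\<in>UNIV. residue (\<theta> a x))" by (intro \<phi>_sum \<theta>_in_ring)
  also have "\<dots> = (\<Sum>x\<in>UNIV - {0}. inverse x ^ a)"
    by (rule sum.mono_neutral_cong_right) (auto simp: residue_\<theta> \<phi>_zero)
  finally show ?thesis ..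
qed

lemma residue_jacobi:
  "residue (jacobi a b) = (\<Sum>x\<in>UNIV - {0, 1}. inverse x ^ a * inverse (1 - x) ^ b)"
proof -
  have "residue (jacobi a b) = (\<Sum>x\<in>UNIV. residue (\<theta> a x * \<theta> b (1 - x)))"
    unfolding jacobi_def by (intro \<phi>_sum mult_closed \<theta>_in_ring)
  also have "\<dots> = (\<Sum>x\<in>UNIV - {0, 1}. inverse x ^ a * inverse (1 - x) ^ b)"
    by (rule sum.mono_neutral_cong_right) (auto simp: \<phi>_mult \<theta>_in_ring residue_\<theta> \<phi>_zero)
  finally show ?thesis .
qed

text \<open>The summands for \<open>Suc a\<close> and \<open>a\<close> differ by
  \<open>inverse x ^ Suc a\<close>. Over all nonzero \<open>x\<close> these powers sum to 0, because
  \<open>n\<close> does not divide \<open>Suc a\<close>; leaving out \<open>x = 1\<close> gives -1.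
  So each step lowers the residue by 1.\<close>

lemma residue_jacobi_one:
  assumes "n > 1" "a < n"
  shows "residue (jacobi a 1) = - of_nat (Suc a)"
  using assms(2)
proof (induction a)
  case 0
  have "(\<Sum>x\<in>UNIV - {0, 1}. inverse (1 - x)) = (\<Sum>x\<in>UNIV - {0, 1 :: 'k}. inverse x)"
    by (rule sum.reindex_bij_witness[of _ "\<lambda>x. 1 - x" "\<lambda>x. 1 - x"]) auto
  also have "\<dots> = (\<Sum>x\<in>UNIV - {0 :: 'k}. inverse x) - 1"
    using sum_diff1[of "UNIV - {0 :: 'k}" inverse 1] by (simp add: Diff_insert2[symmetric] insert_commute)
  also have "(\<Sum>x\<in>UNIV - {0 :: 'k}. inverse x) = 0"
    using sum_inverse_power[of 1] assms(1) by simp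
  finally show ?case by (simp add: residue_jacobi)
next
  case (Suc a)
  have "(\<Sum>x\<in>UNIV - {0, 1 :: 'k}. inverse x ^ Suc a) = (\<Sum>x\<in>UNIV - {0 :: 'k}. inverse x ^ Suc a) - 1"
    using sum_diff1[of "UNIV - {0 :: 'k}" "\<lambda>x. inverse x ^ Suc a" 1]
    by (simp add: Diff_insert2[symmetric] insert_commute del: power_Suc)
  also have "(\<Sum>x\<in>UNIV - {0 :: 'k}. inverse x ^ Suc a) = 0"
    using Suc.prems by (intro sum_inverse_power) (auto dest: dvd_imp_le)
  finally have 1: "(\<Sum>x\<in>UNIV - {0, 1 :: 'k}. inverse x ^ Suc a) = -1" by simp
  have "residue (jacobi (Suc a) 1) - residue (jacobi a 1)
      = (\<Sum>x\<in>UNIV - {0, 1 :: 'k}. inverse x ^ Suc a * inverse (1 - x) - inverse x ^ a * inverse (1 - x))"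
    by (simp only: residue_jacobi power_one_right sum_subtractf)
  also have "\<dots> = (\<Sum>x\<in>UNIV - {0, 1 :: 'k}. inverse x ^ Suc a)"
  proof (rule sum.cong)
    fix x :: 'k assume x: "x \<in> UNIV - {0, 1}"
    then have "x \<noteq> 0" "1 - x \<noteq> 0" by auto
    have "inverse x * inverse (1 - x) - inverse (1 - x) = (inverse x - 1) * inverse (1 - x)"
      by (simp add: left_diff_distrib)
    also have "inverse x - 1 = inverse x * (1 - x)" using \<open>x \<noteq> 0\<close> by (simp add: right_diff_distrib)
    finally have "inverse x * inverse (1 - x) - inverse (1 - x) = inverse x"
      using \<open>1 - x \<noteq> 0\<close> by (simp add: mult.assoc)
    then have "inverse x ^ a * (inverse x * inverse (1 - x) - inverse (1 - x)) = inverse x ^ a * inverse x"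
      by simp
    then show "inverse x ^ Suc a * inverse (1 - x) - inverse x ^ a * inverse (1 - x) = inverse x ^ Suc a"
      by (simp add: algebra_simps)
  qed simp
  finally have "residue (jacobi (Suc a) 1) = residue (jacobi a 1) - 1"
    unfolding 1 by (simp add: diff_eq_eq)
  then show ?case using Suc by simp
qed

text \<open>A trailing zero digit is removed by Frobenius invariance. Otherwise the last digit is
  lowered by 1: the Jacobi sum of \<open>a - 1\<close> and 1 has residue \<open>- a\<close>, nonzero
  as \<open>p\<close> does not divide \<open>a\<close>, so no valuation is lost.\<close>

lemma gval_digits:
  assumes n1: "n > 1"
  shows "0 < a \<Longrightarrow> a < n \<Longrightarrow> gval a = digits_sum p N a * gval 1"
proof (induction a rule: less_induct)
  case (less a)
  have p1: "p > 1" using p by (rule prime_gt_1_nat)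
  have nq: "Suc n = p ^ N" using card_k card_k' by simp
  show ?case
  proof (cases "p dvd a")
    case True
    then obtain b where b: "a = p * b" ..
    have "b < a" "0 < b" using less.prems p1 by (auto simp: b)
    then have "gval b = digits_sum p N b * gval 1" using less by (intro less.IH) simp_all
    moreover have "digits_sum p N (p * b) = digits_sum p N b"
      using less.prems p1 nq by (intro digits_sum_mult) (simp_all add: b)
    ultimately show ?thesis by (simp add: b gval_frobenius)
  next
    case False
    obtain b where b: "a = Suc b" using less.prems by (cases a) auto
    have ds: "digits_sum p N a = Suc (digits_sum p N b)"
      using False N_pos unfolding b by (intro digits_sum_succ) simp_all
    show ?thesis
    proof (cases "b = 0")
      case True
      then show ?thesis using ds b by (simp add: digits_sum_def)
    next
      case False
      then have IH: "gval b = digits_sum p N b * gval 1" using less.prems by (intro less.IH) (simp_all add: b)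
      have "of_nat (Suc b) \<noteq> (0 :: 'k)"
        using \<open>\<not> p dvd a\<close> of_nat_eq_iff_cong[of "Suc b" 0] by (simp add: b cong_0_iff del: of_nat_Suc)
      then have "unit (jacobi b 1)"
        using residue_jacobi_one[OF n1, of b] less.prems
        by (simp add: unit_def jacobi_in_ring b del: of_nat_Suc)
      moreover have "\<not> n dvd b + 1" using less.prems by (auto simp: b dest: dvd_imp_le)
      then have "gauss b * gauss 1 / gauss (b + 1) = jacobi b 1"
        using gauss_nonzero[of "b + 1"] by (simp add: gauss_mult)
      ultimately have "gval b + gval 1 - gval (b + 1) = 0"
        using gval_cocycle[of b 1] by (simp add: val_unit)
      then show ?thesis using IH ds unfolding b by (simp add: algebra_simps)
    qed
  qed
qed

text \<open>All digits of \<open>n = p ^ N - 1\<close> are \<open>p - 1\<close>, so the digit sums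
  of 1 and \<open>n - 1\<close> add up to \<open>N * (p - 1)\<close>, while the valuations of these
  opposite arguments add up to \<open>N\<close>.\<close>

lemma gval_one:
  assumes n1: "n > 1"
  shows "gval 1 = 1 / (real p - 1)"
proof -
  have p1: "p > 1" using p by (rule prime_gt_1_nat)
  have nq: "Suc n = p ^ N" using card_k card_k' by simp
  have "\<not> p dvd n"
  proof
    assume "p dvd n"
    moreover have "p dvd Suc n" unfolding nq using N_pos by simp
    ultimately have "p dvd 1" by (metis Suc_eq_plus1 dvd_add_right_iff)
    then show False using p1 by simp
  qed
  then have "digits_sum p N n = Suc (digits_sum p N (n - 1))"
    using digits_sum_succ[OF N_pos, of p "n - 1"] n_pos by simp
  moreover have "digits_sum p N n = N * (p - 1)"
    using digits_sum_max[of p N] p1 nq by (metis diff_Suc_1 less_imp_le_nat order_less_trans zero_less_one)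
  ultimately have ds: "real (digits_sum p N (n - 1)) + 1 = real N * (real p - 1)"
    using p1 by (metis Suc_eq_plus1 of_nat_add of_nat_mult of_nat_1 of_nat_diff less_imp_le_nat)
  have "gval 1 + gval (n - 1) = N"
    using n1 by (intro gval_opposite) simp_all
  moreover have "gval (n - 1) = digits_sum p N (n - 1) * gval 1"
    using n1 by (intro gval_digits) simp_all
  ultimately have "(real (digits_sum p N (n - 1)) + 1) * gval 1 = N" by (simp add: algebra_simps)
  then have "real N * ((real p - 1) * gval 1) = real N * 1" unfolding ds by simp
  then have "(real p - 1) * gval 1 = 1" using N_pos by simp
  then show ?thesis using p1 by (simp add: field_simps)
qed

theorem gval_eq_digit_sum:
  assumes "\<not> n dvd a"
  shows "gval a = digit_sum p N a / (real p - 1)"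
proof -
  have n1: "n > 1" using assms n_pos by (cases "n = 1") auto
  have "gval a = gval (a mod n)" by (rule gval_cong) (simp add: cong_def)
  also have "\<dots> = digits_sum p N (a mod n) * gval 1"
    using assms n_pos by (intro gval_digits n1) (auto simp: dvd_eq_mod_eq_0)
  finally show ?thesis unfolding gval_one[OF n1] digit_sum_eq by (simp add: n)
qed

text \<open>The valuation of the cocycle is a natural number \<open>c\<close>, because the cocycle
  lies in \<open>ring\<close>. This is what shows that the truncated subtraction and the division in
  \<open>carries\<close> are exact.\<close>

theorem carries_eq:
  assumes "\<not> n dvd a" "\<not> n dvd b" "\<not> n dvd a + b"
  shows "real (carries p N a b) = gval a + gval b - gval (a + b)"
proof -
  have p1: "p > 1" using p by (rule prime_gt_1_nat)
  define c where "c = nat (val (gauss a * gauss b / gauss (a + b)))"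
  have c: "real c = gval a + gval b - gval (a + b)"
    using gval_cocycle[of a b] gval_cocycle_nonneg[of a b] by (simp add: c_def)
  then have "real c = (digit_sum p N a + digit_sum p N b - real (digit_sum p N (a + b))) / (real p - 1)"
    using assms by (simp add: gval_eq_digit_sum add_divide_distrib diff_divide_distrib)
  then have "real c * (real p - 1) = digit_sum p N a + digit_sum p N b - real (digit_sum p N (a + b))"
    using p1 by simp
  then have "real (c * (p - 1) + digit_sum p N (a + b)) = real (digit_sum p N a + digit_sum p N b)"
    using p1 by (simp add: of_nat_diff)
  then have "c * (p - 1) + digit_sum p N (a + b) = digit_sum p N a + digit_sum p N b"
    by (simp only: of_nat_eq_iff)
  then have "digit_sum p N a + digit_sum p N b - digit_sum p N (a + b) = c * (p - 1)" by simp
  then have "carries p N a b = c" using p1 by (simp add: carries_def)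
  then show ?thesis using c by simp
qed

end

section \<open>Characters of order \<open>l\<close>\<close>

locale semiprimitive = gauss_sums \<zeta> g n p N \<omega>
  for \<zeta> :: "'b::field_char_0" and g :: "'k::{finite,field}" and n p N \<omega> +
  fixes l k :: nat
  assumes prime_l: "prime l" and l2: "l > 2" and primroot: "residue_primroot l p" and kl: "n = l * k"
begin

lemma k_pos: "k > 0"
  using n_pos by (simp add: kl)

lemma odd_l: "odd l"
  using prime_l l2 prime_odd_nat by blast

lemma n_dvd_mult_k_iff: "n dvd m * k \<longleftrightarrow> l dvd m"
  using k_pos by (simp add: kl)

text \<open>As \<open>l\<close> is odd, -1 is an \<open>l\<close>-th power, and characters of order
  dividing \<open>l\<close> are trivial there. Hence no signs appear in the later formulas.\<close>

lemma sign_k: "\<theta> (m * k) (-1) = 1"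
proof -
  have "\<theta> k (-1) = \<theta> k ((-1) ^ l)" using odd_l by simp
  also have "\<dots> = \<theta> n (-1)" using l2 by (simp add: kl \<theta>_times)
  also have "\<dots> = 1" by (simp add: \<theta>_trivial)
  finally have k: "\<theta> k (-1) = 1" .
  show ?thesis
  proof (cases "m = 0")
    case True
    then show ?thesis by (simp add: \<theta>_trivial)
  next
    case False
    then have "\<theta> (m * k) (-1) = \<theta> k (-1) ^ m" by (simp add: \<theta>_times \<theta>_power)
    then show ?thesis by (simp add: k)
  qed
qed

lemma gauss_frobenius_power: "gauss (p ^ j * a) = gauss a"
  by (induction j) (simp_all add: mult.assoc gauss_frobenius)

definition \<gamma> :: 'b where "\<gamma> = gauss k"

text \<open>The Gauss sums of the characters of order \<open>l\<close> are Frobenius conjugates of each other,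
  hence equal.\<close>

lemma gauss_mult_k:
  assumes "\<not> l dvd m"
  shows "gauss (m * k) = \<gamma>"
proof -
  have "l > 1" using l2 by simp
  have "coprime m l" using assms prime_l by (metis coprime_commute prime_imp_coprime)
  then have "m mod l \<in> totatives l"
    using \<open>l > 1\<close> assms by (auto simp: totatives_def dvd_eq_mod_eq_0 coprime_commute)
  also have "totatives l = (\<lambda>i. p ^ i mod l) ` {..<totient l}"
    using residue_primroot_is_generator[OF \<open>l > 1\<close> primroot] by (simp add: bij_betw_def)
  finally obtain j where "p ^ j mod l = m mod l" by auto
  then have "[p ^ j * k = m * k] (mod n)"
    unfolding kl by (simp add: cong_def mod_mult_mult2)
  then have "gauss (p ^ j * k) = gauss (m * k)" by (rule gauss_cong)
  then show ?thesis by (simp add: gauss_frobenius_power \<gamma>_def)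
qed

text \<open>The characters of \<open>k\<close> and \<open>(l - 1) * k\<close> are inverse to each
  other and have the same Gauss sum.\<close>

lemma \<gamma>_square: "\<gamma> ^ 2 = of_nat (Suc n)"
proof -
  have "\<not> l dvd 1" "\<not> l dvd l - 1" using l2 by (auto dest: dvd_imp_le)
  then have "gauss (1 * k) = \<gamma>" "gauss ((l - 1) * k) = \<gamma>" by (simp_all only: gauss_mult_k not_False_eq_True)
  then have "\<gamma> ^ 2 = gauss (1 * k) * gauss ((l - 1) * k)"
    by (simp only: power2_eq_square)
  also have "\<dots> = \<theta> ((l - 1) * k) (-1) * of_nat (Suc n)"
  proof (rule gauss_mult_opposite)
    have "1 * k + (l - 1) * k = n" using l2 by (cases l) (simp_all add: kl)
    then show "n dvd 1 * k + (l - 1) * k" by simp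
    show "\<not> n dvd 1 * k" using \<open>\<not> l dvd 1\<close> by (simp only: n_dvd_mult_k_iff) simp
  qed
  finally show ?thesis by (simp only: sign_k mult_1)
qed

lemma gval_mult_k:
  assumes "\<not> l dvd m"
  shows "gval (m * k) = real N / 2"
proof -
  have "\<not> l dvd 1" using l2 by auto
  have "rval (\<gamma> * \<gamma>) = rval (of_nat p ^ N)" using \<gamma>_square of_nat_q by (simp add: power2_eq_square)
  also have "\<dots> = N"
    by (subst rval_fraction) (simp_all add: fraction_power fraction_p val_power val_p)
  finally have "2 * rval \<gamma> = N" by (simp add: rval_mult radical_gauss \<gamma>_def)
  then show ?thesis unfolding gval_def gauss_mult_k[OF assms] by simp
qed

end

section \<open>Diagonal forms of the blocks of the Laplacian\<close>

context unramified
begin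

lemma \<phi>_eq_0_iff_pdiv: "x \<in> \<O> \<Longrightarrow> \<phi> x = 0 \<longleftrightarrow> pdiv 1 x"
  by (simp add: pdiv_def \<phi>_eq_0_iff)

text \<open>One equivalence covers two requirements: at \<open>n = 0\<close> it transports the
  lattices, at \<open>n = 1\<close> the vanishing of residues.\<close>

lemma correspondsI_pdiv:
  assumes total: "\<And>y. \<exists>z. R y z" "\<And>z. \<exists>y. R y z"
    and pdiv: "\<And>y z n. R y z \<Longrightarrow> (\<forall>i\<in>I. pdiv n (y i)) \<longleftrightarrow> (\<forall>j\<in>J. pdiv n (z j))"
    and cond: "\<And>y z n. R y z \<Longrightarrow> V n y \<longleftrightarrow> W n z"
    and diff: "\<And>y z y' z'. R y z \<Longrightarrow> R y' z' \<Longrightarrow> R (\<lambda>i. y i - y' i) (\<lambda>j. z j - z' j)"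
  shows "corresponds I V J W"
proof (rule correspondsI[where R = R])
  have lat: "lattice I y \<longleftrightarrow> lattice J z" if "R y z" for y z
    using pdiv[OF that, of 0] by (simp add: lattice_def pdiv_0)
  show "\<exists>z. lattice J z \<and> R y z" if "lattice I y" for y using total(1)[of y] lat that by blast
  show "\<exists>y. lattice I y \<and> R y z" if "lattice J z" for z using total(2)[of z] lat that by blast
  show "(\<forall>i\<in>I. \<phi> (y i) = 0) \<longleftrightarrow> (\<forall>j\<in>J. \<phi> (z j) = 0)"
    if "lattice I y" "lattice J z" "R y z" for y z
    using pdiv[OF that(3), of 1] that(1,2) by (simp add: lattice_def \<phi>_eq_0_iff_pdiv)
qed (use cond diff in blast)+

lemma pdiv_add_cancel: "pdiv n x \<Longrightarrow> pdiv n (x + y) \<longleftrightarrow> pdiv n y"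
  using pdiv_diff[of n "x + y" x] pdiv_add[of n x y] by auto

text \<open>The matrix \<open>s - c w u\<^sup>T\<close>, where \<open>u\<close> has a coordinate 1 at \<open>a\<close> and \<open>w\<close> one at \<open>b\<close>. Row
  \<open>b\<close> clears the others, and the combination of all rows with coefficients \<open>u\<close> is then a multiple
  of the coordinate \<open>b\<close>.\<close>

lemma rank_one_perturbation:
  fixes u w :: "'i \<Rightarrow> 'b"
  assumes fin: "finite I" and ab: "a \<in> I" "b \<in> I" "a \<noteq> b"
    and u: "\<And>i. i \<in> I \<Longrightarrow> u i \<in> \<O>" "u a = 1" and w: "\<And>i. i \<in> I \<Longrightarrow> w i \<in> \<O>" "w b = 1"
    and c: "c \<noteq> 0" "s / c \<in> \<O>"
  shows "corresponds I (\<lambda>n y. \<forall>i\<in>I. pdiv n (s * y i - c * w i * (\<Sum>j\<in>I. u j * y j)))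
    I (diagonal I (\<lambda>i. if i = a then c else if i = b then s * (s - c * (\<Sum>j\<in>I. u j * w j)) / c else s))"
proof -
  define T where "T = (\<Sum>j\<in>I. u j * w j)"
  define U where "U = (\<lambda>y. \<Sum>j\<in>I. u j * y j)"
  \<comment> \<open>Since \<open>w b = 1\<close>, row \<open>b\<close> of the matrix is
    \<open>- c\<close> times the new coordinate at \<open>a\<close>, and row \<open>i\<close> minus
    \<open>w i\<close> times row \<open>b\<close> is \<open>s\<close> times the new coordinate at
    \<open>i\<close>. Integrality of \<open>s / c\<close> keeps the new coordinates in the lattice,
    and \<open>u a = 1\<close> lets \<open>y a\<close> be recovered.\<close>
  define R where "R = (\<lambda>y z. z a = U y - s / c * y b \<and> z b = y b \<and>
     (\<forall>i. i \<noteq> a \<longrightarrow> i \<noteq> b \<longrightarrow> z i = y i - w i * y b))"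
  have T: "T \<in> \<O>" unfolding T_def by (intro sum_closed mult_closed u w)
  have U_split: "U y = y a + (\<Sum>j\<in>I - {a}. u j * y j)" for y
    using fin ab u(2) by (simp add: U_def sum.remove[of I a])
  have U_diff: "U (\<lambda>i. y i - y' i) = U y - U y'" for y y'
    by (simp add: U_def right_diff_distrib sum_subtractf)
  show ?thesis
  proof (rule correspondsI_pdiv[where R = R])
    fix y :: "'i \<Rightarrow> 'b"
    show "\<exists>z. R y z" unfolding R_def
      using ab by (intro exI[of _ "\<lambda>i. if i = a then U y - s / c * y b else if i = b then y b else y i - w i * y b"]) auto
  next
    fix z :: "'i \<Rightarrow> 'b"
    define y' where "y' = (\<lambda>i. if i = b then z b else z i + w i * z b)"
    define y where "y = y'(a := z a + s / c * z b - (\<Sum>j\<in>I - {a}. u j * y' j))"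
    have "U y = z a + s / c * z b"
    proof -
      have "(\<Sum>j\<in>I - {a}. u j * y j) = (\<Sum>j\<in>I - {a}. u j * y' j)"
        by (intro sum.cong) (auto simp: y_def)
      then show ?thesis by (simp add: U_split) (simp add: y_def)
    qed
    then have "R y z" unfolding R_def using ab by (auto simp: y_def y'_def)
    then show "\<exists>y. R y z" by (rule exI[where x = y])
  next
    fix y z n assume R: "R y z"
    have z: "z a = U y - s / c * y b" "z b = y b" "\<And>i. i \<noteq> a \<Longrightarrow> i \<noteq> b \<Longrightarrow> z i = y i - w i * y b"
      using R by (auto simp: R_def)
    show "(\<forall>i\<in>I. pdiv n (y i)) \<longleftrightarrow> (\<forall>j\<in>I. pdiv n (z j))"
    proof
      assume y: "\<forall>i\<in>I. pdiv n (y i)"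
      then have "pdiv n (U y)" unfolding U_def by (intro pdiv_sum pdiv_mult u) auto
      then have "pdiv n (z a)" unfolding z(1) using y ab by (intro pdiv_diff pdiv_mult c) auto
      moreover have "pdiv n (z b)" using y ab by (simp add: z(2))
      moreover have "pdiv n (z i)" if "i \<in> I" "i \<noteq> a" "i \<noteq> b" for i
        unfolding z(3)[OF that(2,3)] using y ab that by (intro pdiv_diff pdiv_mult w) auto
      ultimately show "\<forall>j\<in>I. pdiv n (z j)" by metis
    next
      assume zz: "\<forall>j\<in>I. pdiv n (z j)"
      then have yb: "pdiv n (y b)" using ab z(2) by metis
      have yi: "pdiv n (y i)" if i: "i \<in> I" "i \<noteq> a" for i
      proof (cases "i = b")
        case False
        have "y i = z i + w i * y b" using z(3)[OF i(2) False] by simp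
        then show ?thesis using zz i yb by (simp add: pdiv_add pdiv_mult w)
      qed (use yb in simp)
      have "pdiv n (\<Sum>j\<in>I - {a}. u j * y j)" using yi u by (intro pdiv_sum pdiv_mult) auto
      moreover have "pdiv n (U y)"
      proof -
        have "U y = z a + s / c * y b" using z(1) by simp
        then show ?thesis using zz ab yb by (simp only:) (intro pdiv_add pdiv_mult c, auto)
      qed
      moreover have "y a = U y - (\<Sum>j\<in>I - {a}. u j * y j)" by (simp add: U_split)
      ultimately have "pdiv n (y a)" by (simp only: pdiv_diff)
      with yi show "\<forall>i\<in>I. pdiv n (y i)" by metis
    qed
    define E where "E = (\<lambda>i. s * y i - c * w i * U y)"
    have Eb: "E b = - (c * z a)" using c w(2) by (simp add: E_def z(1) algebra_simps)
    have Ei: "E i = s * z i + w i * E b" if "i \<noteq> a" "i \<noteq> b" for i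
      using w(2) by (simp add: E_def z(3)[OF that] algebra_simps)
    have "(\<Sum>i\<in>I. u i * E i) = (\<Sum>i\<in>I. s * (u i * y i) - c * U y * (u i * w i))"
      by (intro sum.cong) (simp_all add: E_def algebra_simps)
    also have "\<dots> = s * U y - c * U y * T"
      by (simp add: sum_subtractf T_def U_def flip: sum_distrib_left)
    finally have sumE: "(\<Sum>i\<in>I. u i * E i) = (s - c * T) * U y" by (simp add: algebra_simps)
    have Uz: "U y = z a + s / c * z b" using z by simp
    \<comment> \<open>The combination of all rows is \<open>(s - c * T) * U y\<close>. Eliminating
      \<open>U y\<close> in favour of \<open>z b\<close> and row \<open>b\<close> leaves the last
      diagonal entry.\<close>
    have "s * (s - c * T) / c * z b = (s - c * T) * (U y - z a)" using c(1) by (simp add: Uz)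
    also have "\<dots> = (\<Sum>i\<in>I. u i * E i) + (s / c - T) * E b"
      unfolding sumE Eb using c(1) by (simp add: algebra_simps)
    also have "(\<Sum>i\<in>I. u i * E i) = E a + (\<Sum>i\<in>I - {a}. u i * E i)"
      using fin ab u(2) by (simp add: sum.remove[of I a])
    finally have Ea: "s * (s - c * T) / c * z b = E a + (\<Sum>i\<in>I - {a}. u i * E i) + (s / c - T) * E b" .
    let ?D = "\<lambda>i. if i = a then c else if i = b then s * (s - c * T) / c else s"
    have rest: "pdiv n ((\<Sum>i\<in>I - {a}. u i * E i) + (s / c - T) * E b)" if "\<forall>i\<in>I - {a}. pdiv n (E i)"
      using that ab by (intro pdiv_add pdiv_sum pdiv_mult u diff_closed c T) auto
    have "(\<forall>i\<in>I. pdiv n (E i)) \<longleftrightarrow> diagonal I ?D n z"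
    proof
      assume E: "\<forall>i\<in>I. pdiv n (E i)"
      have pa: "pdiv n (?D a * z a)" using E ab Eb pdiv_uminus_iff[of n "c * z a"] by auto
      have pb: "pdiv n (?D b * z b)"
      proof -
        have "?D b * z b = E a + ((\<Sum>i\<in>I - {a}. u i * E i) + (s / c - T) * E b)" using Ea ab by simp
        then show ?thesis using E ab rest by (simp only:) (rule pdiv_add, auto)
      qed
      have pi: "pdiv n (?D i * z i)" if "i \<in> I" "i \<noteq> a" "i \<noteq> b" for i
      proof -
        have "?D i * z i = E i - w i * E b" using Ei[OF that(2,3)] that(2,3) by simp
        moreover have "pdiv n (E i - w i * E b)" using E ab that w(1) by (intro pdiv_diff pdiv_mult) auto
        ultimately show ?thesis by (rule ssubst)
      qed
      show "diagonal I ?D n z" unfolding diagonal_def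
      proof
        fix i assume i: "i \<in> I"
        consider "i = a" | "i = b" | "i \<noteq> a" "i \<noteq> b" by blast
        then show "pdiv n (?D i * z i)"
        proof cases
          case 1
          then show ?thesis using pa by (simp only:)
        next
          case 2
          then show ?thesis using pb by (simp only:)
        next
          case 3
          then show ?thesis by (rule pi[OF i])
        qed
      qed
    next
      assume D: "diagonal I ?D n z"
      then have D: "pdiv n (?D i * z i)" if "i \<in> I" for i using that by (simp add: diagonal_def)
      have pEb: "pdiv n (E b)" using D[OF ab(1)] by (simp add: Eb pdiv_uminus)
      have pEi: "pdiv n (E i)" if i: "i \<in> I - {a}" for i
      proof (cases "i = b")
        case False
        then have "pdiv n (s * z i)" using D[of i] i by simp
        then show ?thesis using i False by (simp add: Ei pdiv_add pdiv_mult w pEb)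
      qed (use pEb in simp)
      have "E a = s * (s - c * T) / c * z b - ((\<Sum>i\<in>I - {a}. u i * E i) + (s / c - T) * E b)"
        using Ea by simp
      moreover have "pdiv n (s * (s - c * T) / c * z b)" using D[OF ab(2)] ab by simp
      ultimately have "pdiv n (E a)" using rest pEi by (simp only:) (rule pdiv_diff, auto)
      with pEi show "\<forall>i\<in>I. pdiv n (E i)" by blast
    qed
    then show "(\<forall>i\<in>I. pdiv n (s * y i - c * w i * (\<Sum>j\<in>I. u j * y j))) \<longleftrightarrow>
       diagonal I (\<lambda>i. if i = a then c else if i = b then s * (s - c * (\<Sum>j\<in>I. u j * w j)) / c else s) n z"
      unfolding E_def U_def T_def .
  next
    fix y z y' z' assume "R y z" "R y' z'"
    then show "R (\<lambda>i. y i - y' i) (\<lambda>j. z j - z' j)"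
      by (simp add: R_def U_diff algebra_simps diff_divide_distrib)
  qed
qed

text \<open>The block of the functions that are constant on the cosets of the connection set, in the
  basis of the constant function (index 0), the \<open>l - 1\<close> nontrivial characters and the indicator
  of 0 (index \<open>l\<close>).\<close>

lemma trivial_block:
  fixes \<gamma> :: 'b and ix :: "nat \<Rightarrow> 'i"
  assumes l: "l > 2" and \<gamma>: "\<gamma> \<in> \<O>" and inj: "inj_on ix {..l}"
  defines "Y \<equiv> \<lambda>y. \<Sum>m\<in>{1..<l}. y (ix m)"
  shows "corresponds (ix ` {..l})
    (\<lambda>n y. pdiv n (Y y - y (ix l)) \<and>
       (\<forall>m\<in>{1..<l}. pdiv n ((\<gamma>\<^sup>2 + \<gamma>) * y (ix m) - \<gamma> * Y y - y (ix l))))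
    (ix ` {..l}) (diagonal (ix ` {..l}) (\<lambda>i. if i = ix 0 then 0 else if i = ix l then 1
       else if i = ix 1 then \<gamma> + 1 else if i = ix 2 then \<gamma> * (\<gamma> + 1) * (\<gamma> + 1 - of_nat l) else \<gamma>\<^sup>2 + \<gamma>))"
    (is "corresponds ?I ?V ?I (diagonal ?I ?D)")
proof -
  have ix: "ix i = ix j \<longleftrightarrow> i = j" if "i \<le> l" "j \<le> l" for i j
    using inj that by (auto dest: inj_onD)
  have mem: "ix m \<in> ?I" if "m \<le> l" for m using that by auto
  have split1: "{1..<l} = insert 1 {2..<l}" using l by auto
  \<comment> \<open>Row 0 is the new coordinate at \<open>ix l\<close>. Modulo it, row
    \<open>m\<close> becomes \<open>(\<gamma> + 1) * (\<gamma> * y (ix m) - Y y)\<close>; this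
    suggests \<open>Y y - \<gamma> * y (ix 2)\<close> and the differences from
    \<open>y (ix 2)\<close> as the other coordinates.\<close>
  define R where "R = (\<lambda>y z. z (ix 0) = y (ix 0) \<and> z (ix l) = Y y - y (ix l) \<and>
     z (ix 1) = Y y - \<gamma> * y (ix 2) \<and> z (ix 2) = y (ix 2) \<and>
     (\<forall>m\<in>{3..<l}. z (ix m) = y (ix m) - y (ix 2)))"
  have all_iff: "(\<forall>i\<in>?I. P i) \<longleftrightarrow> P (ix 0) \<and> P (ix l) \<and> P (ix 1) \<and> P (ix 2) \<and> (\<forall>m\<in>{3..<l}. P (ix m))" for P
  proof -
    have "{..l} = insert 0 (insert l (insert 1 (insert 2 {3..<l})))" using l by auto
    then show ?thesis by simp
  qed
  have Y_split: "Y y = y (ix 1) + (\<Sum>m\<in>{2..<l}. y (ix m))" for y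
    unfolding Y_def split1 by simp
  have Y_diff: "Y (\<lambda>i. y i - y' i) = Y y - Y y'" for y y'
    by (simp add: Y_def sum_subtractf)
  have l_in: "\<gamma> + 1 - of_nat l \<in> \<O>"
    by (intro diff_closed add_closed \<gamma> one_closed of_nat_closed)
  show ?thesis
  proof (rule correspondsI_pdiv[where R = R])
    fix y :: "'i \<Rightarrow> 'b"
    define z where "z = (\<lambda>i. if i = ix 0 then y (ix 0) else if i = ix l then Y y - y (ix l)
       else if i = ix 1 then Y y - \<gamma> * y (ix 2) else if i = ix 2 then y (ix 2) else y i - y (ix 2))"
    have "R y z" unfolding R_def using l by (auto simp: z_def ix)
    then show "\<exists>z. R y z" by (rule exI[where x = z])
  next
    fix z :: "'i \<Rightarrow> 'b"
    define y' where "y' = (\<lambda>i. if i = ix 0 then z (ix 0) else if i = ix 2 then z (ix 2)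
       else if i = ix l then z (ix 1) + \<gamma> * z (ix 2) - z (ix l) else z i + z (ix 2))"
    define y where "y = y'(ix 1 := z (ix 1) + \<gamma> * z (ix 2) - (\<Sum>m\<in>{2..<l}. y' (ix m)))"
    have "(\<Sum>m\<in>{2..<l}. y (ix m)) = (\<Sum>m\<in>{2..<l}. y' (ix m))"
      using l by (intro sum.cong) (auto simp: y_def ix)
    then have "Y y = z (ix 1) + \<gamma> * z (ix 2)" by (simp add: Y_split) (simp add: y_def)
    then have "R y z" unfolding R_def using l by (auto simp: y_def y'_def ix)
    then show "\<exists>y. R y z" by (rule exI[where x = y])
  next
    fix y z n assume "R y z"
    then have z: "z (ix 0) = y (ix 0)" "z (ix l) = Y y - y (ix l)" "z (ix 1) = Y y - \<gamma> * y (ix 2)"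
      "z (ix 2) = y (ix 2)" "\<And>m. m \<in> {3..<l} \<Longrightarrow> z (ix m) = y (ix m) - y (ix 2)"
      by (auto simp: R_def)
    show "(\<forall>i\<in>?I. pdiv n (y i)) \<longleftrightarrow> (\<forall>j\<in>?I. pdiv n (z j))"
    proof
      assume y: "\<forall>i\<in>?I. pdiv n (y i)"
      then have "pdiv n (Y y)" unfolding Y_def by (intro pdiv_sum) auto
      then show "\<forall>j\<in>?I. pdiv n (z j)"
        using y \<gamma> unfolding all_iff by (auto simp: z z(3)[unfolded One_nat_def] intro!: pdiv_diff pdiv_mult)
    next
      assume zz: "\<forall>j\<in>?I. pdiv n (z j)"
      have y2: "pdiv n (y (ix 2))" using zz z(4) mem[of 2] l by (metis less_imp_le)
      have Y: "pdiv n (Y y)"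
      proof -
        have "Y y = z (ix 1) + \<gamma> * y (ix 2)" using z(3) by simp
        then show ?thesis using zz mem[of 1] l y2 \<gamma> by (simp add: pdiv_add pdiv_mult)
      qed
      have ym: "pdiv n (y (ix m))" if m: "m \<in> {2..<l}" for m
      proof (cases "m = 2")
        case False
        then have "y (ix m) = z (ix m) + y (ix 2)" using z(5)[of m] m by simp
        then show ?thesis using zz mem[of m] m y2 by (simp add: pdiv_add)
      qed (use y2 in simp)
      have "y (ix 1) = Y y - (\<Sum>m\<in>{2..<l}. y (ix m))" by (simp add: Y_split)
      then have y1: "pdiv n (y (ix 1))" using Y ym by (simp only:) (intro pdiv_diff pdiv_sum, auto)
      have "y (ix l) = Y y - z (ix l)" using z(2) by simp
      then have yl: "pdiv n (y (ix l))" using Y zz mem[of l] by (simp add: pdiv_diff)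
      have "pdiv n (y (ix 0))" using zz[unfolded all_iff] z(1) by simp
      then show "\<forall>i\<in>?I. pdiv n (y i)" unfolding all_iff using y1 y2 yl ym by auto
    qed
    define F where "F = (\<lambda>m. (\<gamma>\<^sup>2 + \<gamma>) * y (ix m) - (\<gamma> + 1) * Y y)"
    have V_iff: "?V n y \<longleftrightarrow> pdiv n (z (ix l)) \<and> (\<forall>m\<in>{1..<l}. pdiv n (F m))"
    proof -
      have eq: "(\<gamma>\<^sup>2 + \<gamma>) * y (ix m) - \<gamma> * Y y - y (ix l) = z (ix l) + F m" for m
        by (simp add: z F_def algebra_simps)
      show ?thesis unfolding eq z(2)[symmetric] using pdiv_add_cancel by blast
    qed
    have F2: "F 2 = - ((\<gamma> + 1) * z (ix 1))" unfolding F_def z(3) by (simp add: power2_eq_square algebra_simps)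
    have Fm: "F m = (\<gamma>\<^sup>2 + \<gamma>) * z (ix m) + F 2" if "m \<in> {3..<l}" for m
      using that by (simp add: F_def z algebra_simps)
    \<comment> \<open>The sum of all rows takes the place of row 1. It is a multiple of
      \<open>Y y\<close>, and rewriting \<open>Y y\<close> in the new coordinates leaves the
      diagonal entry at \<open>ix 2\<close> modulo row 2.\<close>
    have "(\<Sum>m\<in>{1..<l}. F m) = (\<gamma>\<^sup>2 + \<gamma>) * Y y - of_nat (l - 1) * ((\<gamma> + 1) * Y y)"
      by (simp add: F_def sum_subtractf Y_def flip: sum_distrib_left)
    also have "of_nat (l - 1) = (of_nat l - 1 :: 'b)" using l by (simp add: of_nat_diff)
    also have "(\<gamma>\<^sup>2 + \<gamma>) * Y y - (of_nat l - 1) * ((\<gamma> + 1) * Y y) = (\<gamma> + 1) * (\<gamma> + 1 - of_nat l) * Y y"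
      by (simp add: power2_eq_square algebra_simps)
    also have "Y y = z (ix 1) + \<gamma> * z (ix 2)" using z(3,4) by simp
    also have "(\<gamma> + 1) * (\<gamma> + 1 - of_nat l) * (z (ix 1) + \<gamma> * z (ix 2)) =
        \<gamma> * (\<gamma> + 1) * (\<gamma> + 1 - of_nat l) * z (ix 2) - (\<gamma> + 1 - of_nat l) * F 2"
      by (simp add: F2 algebra_simps)
    finally have F1: "F 1 + (\<Sum>m\<in>{2..<l}. F m) =
        \<gamma> * (\<gamma> + 1) * (\<gamma> + 1 - of_nat l) * z (ix 2) - (\<gamma> + 1 - of_nat l) * F 2"
      unfolding split1 by simp
    have W_iff: "diagonal ?I ?D n z \<longleftrightarrow> pdiv n (z (ix l)) \<and> pdiv n ((\<gamma> + 1) * z (ix 1)) \<and>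
        pdiv n (\<gamma> * (\<gamma> + 1) * (\<gamma> + 1 - of_nat l) * z (ix 2)) \<and>
        (\<forall>m\<in>{3..<l}. pdiv n ((\<gamma>\<^sup>2 + \<gamma>) * z (ix m)))"
      unfolding diagonal_def all_iff using l by (auto simp: ix pdiv_zero)
    have "(\<forall>m\<in>{1..<l}. pdiv n (F m)) \<longleftrightarrow> pdiv n ((\<gamma> + 1) * z (ix 1)) \<and>
        pdiv n (\<gamma> * (\<gamma> + 1) * (\<gamma> + 1 - of_nat l) * z (ix 2)) \<and>
        (\<forall>m\<in>{3..<l}. pdiv n ((\<gamma>\<^sup>2 + \<gamma>) * z (ix m)))" (is "?F \<longleftrightarrow> ?Z")
    proof
      assume F: ?F
      have pF2: "pdiv n (F 2)" using F l by simp
      have "pdiv n ((\<gamma>\<^sup>2 + \<gamma>) * z (ix m))" if "m \<in> {3..<l}" for m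
      proof -
        have "(\<gamma>\<^sup>2 + \<gamma>) * z (ix m) = F m - F 2" using Fm[OF that] by simp
        then show ?thesis using F that pF2 by (simp add: pdiv_diff)
      qed
      moreover have "pdiv n ((\<gamma> + 1) * z (ix 1))" using pF2 F2 pdiv_uminus_iff[of n "(\<gamma> + 1) * z (ix 1)"] by simp
      moreover have "pdiv n (\<gamma> * (\<gamma> + 1) * (\<gamma> + 1 - of_nat l) * z (ix 2))"
      proof -
        have "\<gamma> * (\<gamma> + 1) * (\<gamma> + 1 - of_nat l) * z (ix 2) =
           F 1 + (\<Sum>m\<in>{2..<l}. F m) + (\<gamma> + 1 - of_nat l) * F 2" using F1 by simp
        then show ?thesis using F pF2 l l_in by (simp only:) (intro pdiv_add pdiv_sum pdiv_mult, auto)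
      qed
      ultimately show ?Z by blast
    next
      assume Z: ?Z
      then have pF2: "pdiv n (F 2)" by (simp add: F2 pdiv_uminus)
      have pFm: "pdiv n (F m)" if m: "m \<in> {2..<l}" for m
      proof (cases "m = 2")
        case False
        then have m3: "m \<in> {3..<l}" using m by auto
        then show ?thesis unfolding Fm[OF m3] using Z pF2 by (intro pdiv_add) auto
      qed (use pF2 in simp)
      have "F 1 = \<gamma> * (\<gamma> + 1) * (\<gamma> + 1 - of_nat l) * z (ix 2) - (\<gamma> + 1 - of_nat l) * F 2 - (\<Sum>m\<in>{2..<l}. F m)"
        using F1 by (simp add: algebra_simps)
      moreover have "pdiv n ((\<gamma> + 1 - of_nat l) * F 2)" by (intro pdiv_mult l_in pF2)
      moreover have "pdiv n (\<Sum>m\<in>{2..<l}. F m)" by (intro pdiv_sum pFm)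
      ultimately have "pdiv n (F 1)" using Z by (simp only: pdiv_diff)
      then show ?F using pFm unfolding split1 by blast
    qed
    then show "?V n y \<longleftrightarrow> diagonal ?I ?D n z" unfolding V_iff W_iff by blast
  next
    fix y z y' z' assume "R y z" "R y' z'"
    then show "R (\<lambda>i. y i - y' i) (\<lambda>j. z j - z' j)"
      by (simp add: R_def Y_diff algebra_simps)
  qed
qed

end

section \<open>The Laplacian in a basis of characters\<close>

lemma sum_root_of_unity:
  fixes z :: "'b::field"
  assumes "z ^ r = 1"
  shows "(\<Sum>i<r. z ^ i) = (if z = 1 then of_nat r else 0)"
  using power_diff_1_eq[of z r] assms by auto

lemma sum_periodic_shift:
  fixes f :: "nat \<Rightarrow> 'b::ab_group_add"
  assumes "\<And>m. f (m + r) = f m"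
  shows "(\<Sum>m<r. f (c + m)) = (\<Sum>m<r. f m)"
proof (induction c)
  case (Suc c)
  have "(\<Sum>m<r. f (Suc c + m)) + f (c + 0) = (\<Sum>m<Suc r. f (c + m))"
    by (subst sum.lessThan_Suc_shift) (simp add: add.commute)
  also have "\<dots> = (\<Sum>m<r. f (c + m)) + f c" using assms[of c] by simp
  finally show ?case using Suc by simp
qed simp

lemma sum_linear_split:
  fixes c t G :: "'i \<Rightarrow> 'b::comm_ring"
  shows "(\<Sum>m\<in>I. c m * (A * t m + B * G m * H)) = A * (\<Sum>m\<in>I. c m * t m) + B * H * (\<Sum>m\<in>I. G m * c m)"
proof -
  have "(\<Sum>m\<in>I. c m * (A * t m + B * G m * H)) = (\<Sum>m\<in>I. A * (c m * t m) + B * H * (G m * c m))"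
    by (intro sum.cong refl) (simp add: algebra_simps)
  then show ?thesis by (simp add: sum.distrib sum_distrib_left)
qed

context semiprimitive
begin

abbreviation G :: "nat \<Rightarrow> nat \<Rightarrow> 'b" where
  "G i m \<equiv> gauss (i + m * k)"

section \<open>The connection set and the basis of characters\<close>

definition in_S :: "'k \<Rightarrow> bool" where
  "in_S x \<longleftrightarrow> x \<noteq> 0 \<and> x ^ k = 1"

lemma power_eq_1_iff_\<theta>: "x \<noteq> 0 \<Longrightarrow> x ^ r = 1 \<longleftrightarrow> \<theta> r x = 1"
proof -
  assume x: "x \<noteq> 0"
  have "x ^ r * g ^ (r * dlog x) = (x * g ^ dlog x) ^ r"
    by (simp add: power_mult_distrib mult.commute[of r] flip: power_mult)
  also have "\<dots> = 1" using dlog[OF x] by simp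
  finally have "x ^ r = 1 \<longleftrightarrow> g ^ (r * dlog x) = 1"
    by (metis mult_1 mult_1_right)
  then show ?thesis using x by (simp add: \<theta>_def \<zeta> g_power_eq_1_iff)
qed

lemma \<theta>_0: "\<theta> 0 x = (if x = 0 then 0 else 1)"
  by (simp add: \<theta>_def)

lemma \<theta>_multiple: "x \<noteq> 0 \<Longrightarrow> \<theta> (m * a) x = \<theta> a x ^ m"
  by (simp add: \<theta>_def mult_ac flip: power_mult)

text \<open>The \<open>\<theta> (m * k)\<close> with \<open>m < l\<close> are the characters trivial
  on the connection set. Their sum is \<open>l\<close> times its indicator, which turns the
  adjacency matrix into a sum of convolutions.\<close>

lemma sum_\<theta>_k: "(\<Sum>m<l. \<theta> (m * k) x) = (if in_S x then of_nat l else 0)"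
proof (cases "x = 0")
  case False
  have "\<theta> k x ^ l = 1" using \<theta>_multiple[OF False, of l k] False by (simp add: \<theta>_trivial flip: kl)
  then have "(\<Sum>m<l. \<theta> k x ^ m) = (if \<theta> k x = 1 then of_nat l else 0)"
    by (rule sum_root_of_unity)
  then show ?thesis using False by (simp add: \<theta>_multiple in_S_def power_eq_1_iff_\<theta>)
qed (simp add: in_S_def)

lemma sum_all_\<theta>: "v \<noteq> 0 \<Longrightarrow> (\<Sum>a<n. \<theta> a v) = (if v = 1 then of_nat n else 0)"
proof -
  assume v: "v \<noteq> 0"
  have "\<theta> 1 v ^ n = 1" using \<theta>_multiple[OF v, of n 1] v by (simp add: \<theta>_trivial)
  then have "(\<Sum>a<n. \<theta> 1 v ^ a) = (if \<theta> 1 v = 1 then of_nat n else 0)"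
    by (rule sum_root_of_unity)
  moreover have "(\<Sum>a<n. \<theta> a v) = (\<Sum>a<n. \<theta> 1 v ^ a)"
  proof (rule sum.cong)
    fix a show "\<theta> a v = \<theta> 1 v ^ a" using \<theta>_multiple[OF v, of a 1] by (simp only: mult_1_right)
  qed (rule refl)
  ultimately show ?thesis using power_eq_1_iff_\<theta>[OF v, of 1] by simp
qed

lemma sum_pairs: "(\<Sum>i<k. \<Sum>m<l. F (i + m * k)) = (\<Sum>a<n. F a)" for F :: "nat \<Rightarrow> 'b"
proof -
  have "(\<Sum>i<k. \<Sum>m<l. F (i + m * k)) = (\<Sum>m<l. \<Sum>i<k. F (i + m * k))" by (rule sum.swap)
  also have "\<dots> = (\<Sum>m<l. sum F {m * k..<m * k + k})"
  proof (rule sum.cong)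
    fix m
    show "(\<Sum>i<k. F (i + m * k)) = sum F {m * k..<m * k + k}"
      using sum.shift_bounds_nat_ivl[of F 0 "m * k" k] by (simp add: atLeast0LessThan add.commute[of k])
  qed simp
  also have "\<dots> = (\<Sum>a<n. F a)" unfolding kl by (rule sum.nat_group)
  finally show ?thesis .
qed

text \<open>The pair \<open>(i, m)\<close> stands for the character \<open>\<theta> (i + m * k)\<close>, except that \<open>(0, 0)\<close> stands for
  the constant function 1 and \<open>(0, l)\<close> for the indicator of 0.\<close>

definition index :: "(nat \<times> nat) set" where
  "index = {..<k} \<times> {..<l} \<union> {(0, l)}"

definition basis :: "nat \<Rightarrow> nat \<Rightarrow> 'k \<Rightarrow> 'b" where
  "basis i m x = (if i = 0 \<and> m = 0 then 1 else \<theta> (i + m * k) x)"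

definition expand :: "(nat \<times> nat \<Rightarrow> 'b) \<Rightarrow> 'k \<Rightarrow> 'b" where
  "expand c x = (\<Sum>i<k. \<Sum>m<l. c (i, m) * basis i m x) + c (0, l) * of_bool (x = 0)"

lemma basis_nonzero: "x \<noteq> 0 \<Longrightarrow> basis i m x = \<theta> (i + m * k) x"
  by (simp add: basis_def \<theta>_0)

lemma basis_zero: "basis i m 0 = of_bool (i = 0 \<and> m = 0)"
  by (simp add: basis_def)

lemma basis_in_ring: "basis i m x \<in> ring"
  by (simp add: basis_def one_closed \<theta>_in_ring)

lemma expand_zero: "expand c 0 = c (0, 0) + c (0, l)"
proof -
  have "(\<Sum>i<k. \<Sum>m<l. c (i, m) * basis i m 0) = (\<Sum>i<k. if i = 0 then c (0, 0) else 0)"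
  proof (rule sum.cong)
    fix i
    have "(\<Sum>m<l. c (i, m) * basis i m 0) = (\<Sum>m<l. if m = 0 then (if i = 0 then c (0, 0) else 0) else 0)"
      by (intro sum.cong) (auto simp: basis_zero)
    then show "(\<Sum>m<l. c (i, m) * basis i m 0) = (if i = 0 then c (0, 0) else 0)"
      using l2 by simp
  qed simp
  then show ?thesis using k_pos by (simp add: expand_def)
qed

lemma expand_nonzero: "x \<noteq> 0 \<Longrightarrow> expand c x = (\<Sum>i<k. \<Sum>m<l. c (i, m) * \<theta> (i + m * k) x)"
  by (simp add: expand_def basis_nonzero)

lemma expand_diff: "expand (\<lambda>a. c a - c' a) x = expand c x - expand c' x"
  by (simp add: expand_def left_diff_distrib sum_subtractf)

lemma pair_less_n: "i < k \<Longrightarrow> m < l \<Longrightarrow> i + m * k < n"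
  using mult_le_mono1[of "Suc m" l k] by (simp add: kl)

text \<open>Orthogonality on the multiplicative group, where the constant function agrees with
  \<open>\<theta> 0\<close> and the indicator of 0 vanishes. The exponent
  \<open>n - (i + m * k)\<close> stands for the inverse character.\<close>

lemma fourier_coefficient:
  assumes i: "i < k" and m: "m < l"
  shows "of_nat n * c (i, m) = (\<Sum>x\<in>UNIV - {0}. expand c x * \<theta> (n - (i + m * k)) x)"
proof -
  let ?a = "i + m * k"
  have orth: "(\<Sum>x\<in>UNIV. \<theta> (i' + m' * k) x * \<theta> (n - ?a) x) = (if i' = i \<and> m' = m then of_nat n else 0)"
    if "i' < k" "m' < l" for i' m'
  proof -
    have a: "?a < n" "i' + m' * k < n" using pair_less_n i m that by auto
    have "n dvd (i' + m' * k) + (n - ?a) \<longleftrightarrow> [(i' + m' * k) + (n - ?a) + ?a = 0 + ?a] (mod n)"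
      unfolding cong_add_rcancel_nat by (simp add: cong_0_iff)
    also have "\<dots> \<longleftrightarrow> [i' + m' * k = ?a] (mod n)" using a by (simp add: cong_def)
    also have "\<dots> \<longleftrightarrow> i' + m' * k = ?a" using a by (simp add: cong_def)
    also have "\<dots> \<longleftrightarrow> i' = i \<and> m' = m"
    proof
      assume eq: "i' + m' * k = ?a"
      have "(i' + m' * k) mod k = i'" "(i' + m' * k) div k = m'" "?a mod k = i" "?a div k = m"
        using that i k_pos by simp_all
      then show "i' = i \<and> m' = m" using eq by metis
    qed simp
    finally show ?thesis by (simp add: sum_\<theta> flip: \<theta>_add)
  qed
  have "(\<Sum>x\<in>UNIV - {0}. expand c x * \<theta> (n - ?a) x)
     = (\<Sum>x\<in>UNIV. (\<Sum>i'<k. \<Sum>m'<l. c (i', m') * \<theta> (i' + m' * k) x) * \<theta> (n - ?a) x)"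
    by (rule sum.mono_neutral_cong_left) (auto simp: expand_nonzero)
  also have "\<dots> = (\<Sum>x\<in>UNIV. \<Sum>i'<k. \<Sum>m'<l. c (i', m') * (\<theta> (i' + m' * k) x * \<theta> (n - ?a) x))"
    by (simp add: sum_distrib_right mult.assoc)
  also have "\<dots> = (\<Sum>i'<k. \<Sum>x\<in>UNIV. \<Sum>m'<l. c (i', m') * (\<theta> (i' + m' * k) x * \<theta> (n - ?a) x))"
    by (rule sum.swap)
  also have "\<dots> = (\<Sum>i'<k. \<Sum>m'<l. \<Sum>x\<in>UNIV. c (i', m') * (\<theta> (i' + m' * k) x * \<theta> (n - ?a) x))"
    by (intro sum.cong refl sum.swap)
  also have "\<dots> = (\<Sum>i'<k. \<Sum>m'<l. if i' = i \<and> m' = m then of_nat n * c (i, m) else 0)"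
    by (intro sum.cong refl) (auto simp: orth simp flip: sum_distrib_left)
  also have "\<dots> = (\<Sum>i'<k. if i' = i then of_nat n * c (i, m) else 0)"
    using m by (intro sum.cong refl) auto
  also have "\<dots> = of_nat n * c (i, m)" using i by simp
  finally show ?thesis ..
qed

lemma unit_n: "of_nat n \<in> ring" "residue (of_nat n) \<noteq> 0"
  by (simp_all add: of_nat_closed \<phi>_of_nat of_nat_n)

lemma index_cases: "a \<in> index \<Longrightarrow> (\<exists>i<k. \<exists>m<l. a = (i, m)) \<or> a = (0, l)"
  by (auto simp: index_def)

text \<open>The change of basis is invertible over \<open>ring\<close>, because \<open>n\<close> has
  residue -1 and is a unit.\<close>

lemma expand_pdiv: "(\<forall>x\<in>UNIV. pdiv j (expand c x)) \<longleftrightarrow> (\<forall>a\<in>index. pdiv j (c a))"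
proof
  assume c: "\<forall>a\<in>index. pdiv j (c a)"
  have bool: "of_bool b \<in> ring" for b by (cases b) (simp_all add: zero_closed one_closed)
  have "pdiv j (basis i m x * c (i, m))" if "i < k" "m < l" for i m x
    using c that by (intro pdiv_mult basis_in_ring) (auto simp: index_def)
  moreover have "pdiv j (of_bool (x = 0) * c (0, l))" for x :: 'k
    using c by (intro pdiv_mult bool) (auto simp: index_def)
  ultimately have "pdiv j (expand c x)" for x
    unfolding expand_def by (intro pdiv_add pdiv_sum) (simp_all add: mult.commute)
  then show "\<forall>x\<in>UNIV. pdiv j (expand c x)" by blast
next
  assume e: "\<forall>x\<in>UNIV. pdiv j (expand c x)"
  have c: "pdiv j (c (i, m))" if "i < k" "m < l" for i m
  proof -
    have "pdiv j (\<Sum>x\<in>UNIV - {0}. \<theta> (n - (i + m * k)) x * expand c x)"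
      using e by (intro pdiv_sum pdiv_mult \<theta>_in_ring) auto
    then have "pdiv j (of_nat n * c (i, m))"
      using fourier_coefficient[OF that, of c] by (simp add: mult.commute)
    then show ?thesis using pdiv_unit_mult[OF unit_n] by blast
  qed
  have "c (0, l) = expand c 0 - c (0, 0)" by (simp add: expand_zero)
  then have "pdiv j (c (0, l))" using e c[of 0 0] k_pos l2 by (simp add: pdiv_diff)
  then show "\<forall>a\<in>index. pdiv j (c a)" using c index_cases by blast
qed

lemma expand_surj: "\<exists>c. y = expand c"
proof -
  \<comment> \<open>Fourier inversion on the nonzero elements. At 0 only the constant function and
    the indicator contribute, so \<open>y 0 - z 0\<close> is the coefficient of the
    indicator.\<close>
  define z where "z = (\<lambda>a. (\<Sum>w\<in>UNIV. y w * \<theta> (n - a) w) / of_nat n)"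
  define c where "c = (\<lambda>(i, m). if m = l then y 0 - z 0 else z (i + m * k))"
  have "y x = expand c x" for x
  proof (cases "x = 0")
    case True
    then show ?thesis using l2 by (simp add: expand_zero) (simp add: c_def)
  next
    case False
    have orth: "(\<Sum>a<n. \<theta> (n - a) w * \<theta> a x) = (if w = x then of_nat n else 0)" for w
    proof (cases "w = 0")
      case False
      have "\<theta> (n - a) w * \<theta> a x = \<theta> a (x / w)" if "a < n" for a
      proof -
        have "\<theta> (n - a) w * \<theta> a w = 1" using False that by (simp add: \<theta>_trivial flip: \<theta>_add)
        then have "\<theta> (n - a) w = 1 / \<theta> a w" using False by (simp add: field_simps)
        then show ?thesis using False by (simp add: \<theta>_divide)
      qed
      then have "(\<Sum>a<n. \<theta> (n - a) w * \<theta> a x) = (\<Sum>a<n. \<theta> a (x / w))" by simp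
      then show ?thesis using False \<open>x \<noteq> 0\<close> by (simp add: sum_all_\<theta>)
    qed (use \<open>x \<noteq> 0\<close> in simp)
    have "expand c x = (\<Sum>i<k. \<Sum>m<l. z (i + m * k) * \<theta> (i + m * k) x)"
      using False by (simp add: expand_nonzero c_def)
    also have "\<dots> = (\<Sum>a<n. z a * \<theta> a x)" by (rule sum_pairs)
    also have "\<dots> = (\<Sum>a<n. \<Sum>w\<in>UNIV. y w * (\<theta> (n - a) w * \<theta> a x)) / of_nat n"
      by (simp add: z_def sum_distrib_right sum_divide_distrib mult.assoc)
    also have "\<dots> = (\<Sum>w\<in>UNIV. \<Sum>a<n. y w * (\<theta> (n - a) w * \<theta> a x)) / of_nat n"
      by (subst sum.swap) simp
    also have "\<dots> = (\<Sum>w\<in>UNIV. y w * (\<Sum>a<n. \<theta> (n - a) w * \<theta> a x)) / of_nat n"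
      by (simp add: sum_distrib_left)
    also have "\<dots> = (\<Sum>w\<in>UNIV. if w = x then y x * of_nat n else 0) / of_nat n"
      by (intro arg_cong[of _ _ "\<lambda>s. s / of_nat n"] sum.cong refl) (simp add: orth)
    also have "\<dots> = y x" using n_pos by simp
    finally show ?thesis ..
  qed
  then show ?thesis by blast
qed

section \<open>The Laplacian as a sum of convolutions\<close>

definition laplace :: "('k \<Rightarrow> 'b) \<Rightarrow> 'k \<Rightarrow> 'b" where
  "laplace y x = of_nat k * y x - (\<Sum>w\<in>UNIV. of_bool (in_S (x - w)) * y w)"

text \<open>This is \<open>l\<close> times the adjacency operator, with the indicator of the
  connection set written as a sum of characters.\<close>

definition conv :: "('k \<Rightarrow> 'b) \<Rightarrow> 'k \<Rightarrow> 'b" where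
  "conv y x = (\<Sum>m<l. \<Sum>w\<in>UNIV. y w * \<theta> (m * k) (x - w))"

lemma laplace_conv: "of_nat l * laplace y x = of_nat n * y x - conv y x"
proof -
  have "conv y x = (\<Sum>w\<in>UNIV. y w * (\<Sum>m<l. \<theta> (m * k) (x - w)))"
    unfolding conv_def by (subst sum.swap) (simp add: sum_distrib_left)
  also have "\<dots> = (\<Sum>w\<in>UNIV. of_nat l * (of_bool (in_S (x - w)) * y w))"
    by (intro sum.cong refl) (simp add: sum_\<theta>_k)
  also have "\<dots> = of_nat l * (\<Sum>w\<in>UNIV. of_bool (in_S (x - w)) * y w)"
    by (rule sum_distrib_left[symmetric])
  finally show ?thesis by (simp add: laplace_def kl algebra_simps)
qed

lemma conv_sum: "conv (\<lambda>w. \<Sum>a\<in>A. c a * f a w) x = (\<Sum>a\<in>A. c a * conv (f a) x)"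
  by (induction A rule: infinite_finite_induct)
    (simp_all add: conv_def sum.distrib sum_distrib_left algebra_simps)

lemma conv_add: "conv (\<lambda>w. f w + h w) x = conv f x + conv h x"
  by (simp add: conv_def sum.distrib algebra_simps)

lemma conv_scale: "conv (\<lambda>w. c * f w) x = c * conv f x"
  by (simp add: conv_def sum_distrib_left algebra_simps)

lemma jacobi_trivial: "\<not> n dvd a \<Longrightarrow> jacobi a 0 = -1"
proof -
  assume a: "\<not> n dvd a"
  have "jacobi a 0 = (\<Sum>x\<in>UNIV - {1}. \<theta> a x)"
    unfolding jacobi_def by (rule sum.mono_neutral_cong_right) (auto simp: \<theta>_0)
  also have "\<dots> = -1" using a by (simp add: sum_diff1 sum_\<theta>)
  finally show ?thesis .
qed

lemma jacobi_mult_k: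
  assumes "\<not> n dvd a + m * k" "\<not> l dvd m"
  shows "jacobi a (m * k) = \<gamma> * gauss a / gauss (a + m * k)"
  using gauss_mult[OF assms(1)] gauss_mult_k[OF assms(2)] gauss_nonzero[of "a + m * k"]
  by (simp add: field_simps)

lemma cong_periodic: "[a + (m + l) * k = a + m * k] (mod n)"
proof -
  have eq: "a + (m + l) * k = (a + m * k) + l * k" by (simp add: algebra_simps)
  show ?thesis unfolding eq cong_def kl by (rule mod_add_self2)
qed

lemma \<theta>_periodic: "\<theta> (a + (m + l) * k) x = \<theta> (a + m * k) x"
  by (rule \<theta>_cong[OF cong_periodic])

lemma gauss_periodic: "gauss (a + (m + l) * k) = gauss (a + m * k)"
  by (rule gauss_cong[OF cong_periodic])

lemma sum_lessThan_l: "(\<Sum>m<l. f m) = f 0 + (\<Sum>m\<in>{1..<l}. f m)" for f :: "nat \<Rightarrow> 'b"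
proof -
  have "{..<l} = insert 0 {1..<l}" using l2 by auto
  then show ?thesis by simp
qed

text \<open>The trivial character contributes the Jacobi sum -1, each of the others a quotient
  \<open>\<gamma> * G i m / G i j\<close>. The missing index \<open>j = m\<close> is added to
  complete the sum, at the cost of a further \<open>- \<gamma>\<close> on the diagonal.\<close>

lemma conv_nontrivial:
  assumes i: "0 < i" "i < k"
  shows "conv (\<theta> (i + m * k)) x = - (1 + \<gamma>) * \<theta> (i + m * k) x
     + \<gamma> * G i m * (\<Sum>j<l. \<theta> (i + j * k) x / G i j)"
proof -
  let ?a = "i + m * k"
  have nd: "\<not> n dvd i + j * k" for j
  proof
    assume "n dvd i + j * k"
    then have "k dvd i + j * k" using kl by (metis dvd_mult_right)
    then have "k dvd i" by (simp add: dvd_add_left_iff)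
    then show False using i by (auto dest: dvd_imp_le)
  qed
  have split: "?a + m' * k = i + (m + m') * k" for m' by (simp add: algebra_simps)
  have summand: "(\<Sum>w\<in>UNIV. \<theta> ?a w * \<theta> (m' * k) (x - w)) = \<theta> (?a + m' * k) x * jacobi ?a (m' * k)" for m'
    unfolding sum_\<theta>_convolution using nd[of "m + m'"] by (simp add: split sum_\<theta>)
  have "conv (\<theta> ?a) x = (\<Sum>m'<l. \<theta> (?a + m' * k) x * jacobi ?a (m' * k))"
    by (simp only: conv_def summand)
  also have "\<dots> = - \<theta> ?a x + (\<Sum>m'\<in>{1..<l}. \<theta> (?a + m' * k) x * jacobi ?a (m' * k))"
    unfolding sum_lessThan_l using nd[of m] by (simp add: jacobi_trivial)
  also have "(\<Sum>m'\<in>{1..<l}. \<theta> (?a + m' * k) x * jacobi ?a (m' * k))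
     = (\<Sum>m'\<in>{1..<l}. \<gamma> * G i m * (\<theta> (?a + m' * k) x / gauss (?a + m' * k)))"
  proof (rule sum.cong)
    fix m' assume "m' \<in> {1..<l}"
    then have "\<not> l dvd m'" by (auto dest: dvd_imp_le)
    then show "\<theta> (?a + m' * k) x * jacobi ?a (m' * k) = \<gamma> * G i m * (\<theta> (?a + m' * k) x / gauss (?a + m' * k))"
      using nd[of "m + m'"] by (simp add: jacobi_mult_k split)
  qed simp
  also have "\<dots> = \<gamma> * G i m * (\<Sum>m'\<in>{1..<l}. \<theta> (?a + m' * k) x / gauss (?a + m' * k))"
    by (simp add: sum_distrib_left)
  also have "(\<Sum>m'\<in>{1..<l}. \<theta> (?a + m' * k) x / gauss (?a + m' * k))
     = (\<Sum>m'<l. \<theta> (?a + m' * k) x / gauss (?a + m' * k)) - \<theta> ?a x / G i m"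
    unfolding sum_lessThan_l by simp
  also have "(\<Sum>m'<l. \<theta> (?a + m' * k) x / gauss (?a + m' * k))
     = (\<Sum>m'<l. \<theta> (i + (m + m') * k) x / G i (m + m'))"
    by (simp only: split)
  also have "\<dots> = (\<Sum>j<l. \<theta> (i + j * k) x / G i j)"
    by (rule sum_periodic_shift[of "\<lambda>j. \<theta> (i + j * k) x / G i j"]) (simp only: \<theta>_periodic gauss_periodic)
  finally show ?thesis using gauss_nonzero[of ?a] by (simp add: algebra_simps)
qed

lemma conv_constant: "conv (\<lambda>_. 1) x = of_nat n"
proof -
  have "(\<Sum>w\<in>UNIV. \<theta> a (x - w)) = (\<Sum>w\<in>UNIV. \<theta> a w)" for a
    by (rule sum.reindex_bij_witness[of _ "\<lambda>w. x - w" "\<lambda>w. x - w"]) auto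
  then have "conv (\<lambda>_. 1) x = (\<Sum>m<l. if l dvd m then of_nat n else 0)"
    by (simp add: conv_def sum_\<theta> n_dvd_mult_k_iff)
  also have "\<dots> = (\<Sum>m<l. if m = 0 then of_nat n else 0)"
    by (intro sum.cong) (auto dest: dvd_imp_le)
  finally show ?thesis using l2 by simp
qed

lemma conv_delta: "conv (\<lambda>w. of_bool (w = 0)) x = 1 - of_bool (x = 0) + (\<Sum>m\<in>{1..<l}. \<theta> (m * k) x)"
proof -
  have "(\<Sum>w\<in>UNIV. of_bool (w = 0) * \<theta> a (x - w)) = (\<Sum>w\<in>UNIV. if w = (0 :: 'k) then \<theta> a x else 0)" for a
    by (intro sum.cong) auto
  then have "conv (\<lambda>w. of_bool (w = 0)) x = (\<Sum>m<l. \<theta> (m * k) x)"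
    by (simp add: conv_def)
  then show ?thesis unfolding sum_lessThan_l by (simp add: \<theta>_0)
qed

lemma conv_\<theta>_k:
  assumes m: "m \<in> {1..<l}"
  shows "conv (\<theta> (m * k)) x = \<gamma>\<^sup>2 * of_bool (x = 0) - 1 + \<gamma> * (\<Sum>j\<in>{1..<l}. \<theta> (j * k) x)
     - (1 + \<gamma>) * \<theta> (m * k) x"
proof -
  let ?h = "\<lambda>j. \<theta> (j * k) x"
  have split: "m * k + m' * k = (m + m') * k" for m' by (simp add: algebra_simps)
  have ml: "\<not> l dvd m" using m by (auto dest: dvd_imp_le)
  have per: "?h (j + l) = ?h j" for j using \<theta>_periodic[of 0 j x] by simp
  \<comment> \<open>The value for a generic \<open>m'\<close> is used throughout, with corrections
    at the two exceptional values 0 and \<open>l - m\<close>; the main term can then be summed over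
    a full period.\<close>
  have summand: "(\<Sum>w\<in>UNIV. \<theta> (m * k) w * \<theta> (m' * k) (x - w)) =
      \<gamma> * ?h (m + m') + (if m' = 0 then - (1 + \<gamma>) * ?h m else 0)
      + (if m' = l - m then \<gamma>\<^sup>2 * of_bool (x = 0) - 1 - \<gamma> * ?h 0 else 0)" if m': "m' < l" for m'
  proof -
    consider "m' = 0" | "m' = l - m" | "m' \<noteq> 0" "m' \<noteq> l - m" by blast
    then show ?thesis
    proof cases
      case 1
      have "\<not> n dvd m * k" using ml by (simp add: n_dvd_mult_k_iff)
      then show ?thesis unfolding sum_\<theta>_convolution using 1 m
        by (simp add: sum_\<theta> jacobi_trivial) (simp add: algebra_simps)
    next
      case 2
      then have mm: "m + m' = l" "m' \<noteq> 0" using m by auto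
      have nd: "n dvd m * k + m' * k" unfolding split mm by (simp add: kl)
      have "\<not> n dvd m * k" using ml by (simp add: n_dvd_mult_k_iff)
      then have j: "jacobi (m * k) (m' * k) = -1" using jacobi_opposite[OF nd] by (simp add: sign_k)
      have "?h (m + m') = ?h 0" using per[of 0] mm by simp
      moreover have "(\<Sum>w\<in>UNIV. \<theta> (m * k) w * \<theta> (m' * k) (x - w)) = \<gamma>\<^sup>2 * of_bool (x = 0) - 1"
        unfolding sum_\<theta>_convolution using nd
        by (simp add: sum_\<theta> sign_k j \<gamma>_square \<theta>_trivial)
      ultimately show ?thesis using 2 mm(2) by simp
    next
      case 3
      have "\<not> l dvd m + m'"
      proof
        assume "l dvd m + m'"
        then obtain r where r: "m + m' = l * r" ..
        have "0 < l * r" "l * r < l * 2" using m m' unfolding r[symmetric] by simp_all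
        then have "r = 1" by (auto simp: mult_less_cancel1)
        then show False using r 3 by simp
      qed
      then have nd: "\<not> n dvd m * k + m' * k" unfolding split by (simp add: n_dvd_mult_k_iff)
      have "\<not> l dvd m'" using 3 m' by (auto dest: dvd_imp_le)
      then have "jacobi (m * k) (m' * k) = \<gamma>"
        using jacobi_mult_k[OF nd] gauss_mult_k[OF ml] gauss_mult_k[OF \<open>\<not> l dvd m + m'\<close>]
          gauss_nonzero[of "(m + m') * k"] by (simp add: split)
      then have "(\<Sum>w\<in>UNIV. \<theta> (m * k) w * \<theta> (m' * k) (x - w)) = \<gamma> * ?h (m + m')"
        unfolding sum_\<theta>_convolution using nd by (simp add: sum_\<theta> split)
      then show ?thesis using 3 by simp
    qed
  qed
  have "conv (\<theta> (m * k)) x = (\<Sum>m'<l. \<gamma> * ?h (m + m') + (if m' = 0 then - (1 + \<gamma>) * ?h m else 0)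
      + (if m' = l - m then \<gamma>\<^sup>2 * of_bool (x = 0) - 1 - \<gamma> * ?h 0 else 0))"
    unfolding conv_def by (intro sum.cong refl) (simp only: summand lessThan_iff)
  also have "\<dots> = \<gamma> * (\<Sum>m'<l. ?h (m + m')) - (1 + \<gamma>) * ?h m + (\<gamma>\<^sup>2 * of_bool (x = 0) - 1 - \<gamma> * ?h 0)"
    using m l2 by (simp add: sum.distrib sum_distrib_left) (simp add: algebra_simps)
  also have "(\<Sum>m'<l. ?h (m + m')) = (\<Sum>j<l. ?h j)" by (rule sum_periodic_shift[of ?h]) (rule per)
  finally show ?thesis unfolding sum_lessThan_l by (simp add: algebra_simps)
qed

text \<open>The matrix of \<open>l\<close> times the Laplacian in the chosen basis. The coefficient
  \<open>c (0, 0)\<close> does not occur because constants lie in the kernel, and row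
  \<open>(0, l)\<close> is a multiple of row \<open>(0, 0)\<close>.\<close>

definition laplace_coeff :: "(nat \<times> nat \<Rightarrow> 'b) \<Rightarrow> nat \<times> nat \<Rightarrow> 'b" where
  "laplace_coeff c = (\<lambda>(i, m). if i = 0 then
      let Y = (\<Sum>j\<in>{1..<l}. c (0, j)) in
        if m = 0 then Y - c (0, l) else if m = l then - \<gamma>\<^sup>2 * (Y - c (0, l))
        else (\<gamma>\<^sup>2 + \<gamma>) * c (0, m) - \<gamma> * Y - c (0, l)
      else (\<gamma>\<^sup>2 + \<gamma>) * c (i, m) - \<gamma> / G i m * (\<Sum>j<l. G i j * c (i, j)))"

definition block :: "(nat \<times> nat \<Rightarrow> 'b) \<Rightarrow> nat \<Rightarrow> 'k \<Rightarrow> 'b" where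
  "block c i x = (\<Sum>m<l. c (i, m) * basis i m x)"

lemma block_nontrivial:
  assumes i: "0 < i" "i < k"
  shows "of_nat n * block c i x - conv (block c i) x = block (laplace_coeff c) i x"
proof -
  let ?H = "\<Sum>j<l. \<theta> (i + j * k) x / G i j"
  let ?T = "\<Sum>j<l. G i j * c (i, j)"
  have bs: "block c' i = (\<lambda>x. \<Sum>m<l. c' (i, m) * \<theta> (i + m * k) x)" for c'
    using i by (simp add: block_def basis_def fun_eq_iff)
  have "conv (block c i) x = (\<Sum>m<l. c (i, m) * (- (1 + \<gamma>) * \<theta> (i + m * k) x + \<gamma> * G i m * ?H))"
    unfolding bs by (simp only: conv_sum conv_nontrivial[OF i])
  also have "\<dots> = - (1 + \<gamma>) * (\<Sum>m<l. c (i, m) * \<theta> (i + m * k) x) + \<gamma> * ?H * ?T"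
    by (rule sum_linear_split)
  finally have 1: "of_nat n * block c i x - conv (block c i) x =
      (of_nat n + 1 + \<gamma>) * (\<Sum>m<l. c (i, m) * \<theta> (i + m * k) x) - \<gamma> * ?H * ?T"
    unfolding bs by (simp add: algebra_simps)
  have "block (laplace_coeff c) i x =
     (\<Sum>m<l. (\<gamma>\<^sup>2 + \<gamma>) * (c (i, m) * \<theta> (i + m * k) x) - \<gamma> * ?T * (\<theta> (i + m * k) x / G i m))"
    unfolding bs using i by (intro sum.cong refl) (simp add: laplace_coeff_def left_diff_distrib)
  also have "\<dots> = (\<gamma>\<^sup>2 + \<gamma>) * (\<Sum>m<l. c (i, m) * \<theta> (i + m * k) x) - \<gamma> * ?T * ?H"
    by (simp only: sum_subtractf sum_distrib_left[symmetric])
  finally show ?thesis unfolding 1 using \<gamma>_square by (simp add: algebra_simps)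
qed

lemma block_trivial:
  "of_nat n * (block c 0 x + c (0, l) * of_bool (x = 0)) - conv (\<lambda>x. block c 0 x + c (0, l) * of_bool (x = 0)) x
    = block (laplace_coeff c) 0 x + laplace_coeff c (0, l) * of_bool (x = 0)"
proof -
  let ?Y = "\<Sum>j\<in>{1..<l}. c (0, j)"
  let ?Z = "\<Sum>j\<in>{1..<l}. c (0, j) * \<theta> (j * k) x"
  let ?H = "\<Sum>j\<in>{1..<l}. \<theta> (j * k) x"
  have bs: "block c' 0 = (\<lambda>x. c' (0, 0) * 1 + (\<Sum>m\<in>{1..<l}. c' (0, m) * \<theta> (m * k) x))" for c'
    by (simp add: block_def basis_def fun_eq_iff sum_lessThan_l)
  have "conv (\<lambda>x. block c 0 x + c (0, l) * of_bool (x = 0)) x =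
     c (0, 0) * of_nat n + (\<Sum>m\<in>{1..<l}. c (0, m) * conv (\<theta> (m * k)) x)
      + c (0, l) * (1 - of_bool (x = 0) + ?H)"
    unfolding bs by (simp only: conv_add conv_scale conv_sum conv_constant conv_delta)
  also have "(\<Sum>m\<in>{1..<l}. c (0, m) * conv (\<theta> (m * k)) x) =
     (\<Sum>m\<in>{1..<l}. (\<gamma>\<^sup>2 * of_bool (x = 0) - 1 + \<gamma> * ?H) * c (0, m) - (1 + \<gamma>) * (c (0, m) * \<theta> (m * k) x))"
    by (intro sum.cong refl) (simp add: conv_\<theta>_k algebra_simps)
  also have "\<dots> = (\<gamma>\<^sup>2 * of_bool (x = 0) - 1 + \<gamma> * ?H) * ?Y - (1 + \<gamma>) * ?Z"
    by (simp add: sum_subtractf flip: sum_distrib_left)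
  finally have 1: "conv (\<lambda>x. block c 0 x + c (0, l) * of_bool (x = 0)) x =
     c (0, 0) * of_nat n + ((\<gamma>\<^sup>2 * of_bool (x = 0) - 1 + \<gamma> * ?H) * ?Y - (1 + \<gamma>) * ?Z)
     + c (0, l) * (1 - of_bool (x = 0) + ?H)" .
  have "(\<Sum>m\<in>{1..<l}. laplace_coeff c (0, m) * \<theta> (m * k) x) =
     (\<Sum>m\<in>{1..<l}. (\<gamma>\<^sup>2 + \<gamma>) * (c (0, m) * \<theta> (m * k) x) - (\<gamma> * ?Y + c (0, l)) * \<theta> (m * k) x)"
    by (intro sum.cong refl) (simp add: laplace_coeff_def Let_def algebra_simps)
  also have "\<dots> = (\<gamma>\<^sup>2 + \<gamma>) * ?Z - (\<gamma> * ?Y + c (0, l)) * ?H"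
    by (simp add: sum_subtractf flip: sum_distrib_left)
  finally have 2: "(\<Sum>m\<in>{1..<l}. laplace_coeff c (0, m) * \<theta> (m * k) x) =
     (\<gamma>\<^sup>2 + \<gamma>) * ?Z - (\<gamma> * ?Y + c (0, l)) * ?H" .
  have 3: "laplace_coeff c (0, 0) = ?Y - c (0, l)" "laplace_coeff c (0, l) = - \<gamma>\<^sup>2 * (?Y - c (0, l))"
    using l2 by (simp_all add: laplace_coeff_def Let_def)
  have q: "of_nat n = \<gamma>\<^sup>2 - 1" using \<gamma>_square by simp
  show ?thesis unfolding 1 unfolding bs 2 3 unfolding q by (simp add: algebra_simps)
qed

lemma laplace_expand: "of_nat l * laplace (expand c) x = expand (laplace_coeff c) x"
proof -
  have split: "{..<k} = insert 0 {1..<k}" using k_pos by auto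
  have ex: "expand c' = (\<lambda>x. (\<Sum>i\<in>{1..<k}. 1 * block c' i x) + (block c' 0 x + c' (0, l) * of_bool (x = 0)))" for c'
    unfolding expand_def split by (simp add: block_def fun_eq_iff)
  have "of_nat l * laplace (expand c) x = of_nat n * expand c x - conv (expand c) x"
    by (rule laplace_conv)
  also have "conv (expand c) x = (\<Sum>i\<in>{1..<k}. 1 * conv (block c i) x)
     + conv (\<lambda>x. block c 0 x + c (0, l) * of_bool (x = 0)) x"
    unfolding ex by (simp only: conv_add[of "\<lambda>x. \<Sum>i\<in>{1..<k}. 1 * block c i x"] conv_sum)
  also have "of_nat n * expand c x - \<dots> = (\<Sum>i\<in>{1..<k}. of_nat n * block c i x - conv (block c i) x)
     + (of_nat n * (block c 0 x + c (0, l) * of_bool (x = 0))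
     - conv (\<lambda>x. block c 0 x + c (0, l) * of_bool (x = 0)) x)"
    unfolding ex by (simp add: distrib_left sum_subtractf sum_distrib_left)
  also have "\<dots> = expand (laplace_coeff c) x"
    unfolding ex block_trivial using block_nontrivial by simp
  finally show ?thesis .
qed

lemma unit_l: "of_nat l \<in> ring" "residue (of_nat l) \<noteq> 0"
proof -
  have "of_nat l * of_nat k = (of_nat n :: 'k)" by (simp add: kl)
  then show "residue (of_nat l) \<noteq> 0" using of_nat_n by (auto simp: \<phi>_of_nat)
qed (rule of_nat_closed)

text \<open>The factor \<open>l\<close> does not affect divisibility, being a divisor of the unit
  \<open>n\<close>.\<close>

lemma laplace_corresponds:
  "corresponds UNIV (\<lambda>j y. \<forall>x\<in>UNIV. pdiv j (laplace y x))
     index (\<lambda>j c. \<forall>a\<in>index. pdiv j (laplace_coeff c a))"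
proof (rule correspondsI_pdiv[where R = "\<lambda>y c. y = expand c"])
  fix y z j assume y: "y = expand z"
  have "(\<forall>x\<in>UNIV. pdiv j (laplace y x)) \<longleftrightarrow> (\<forall>x\<in>UNIV. pdiv j (of_nat l * laplace y x))"
    by (simp add: pdiv_unit_mult[OF unit_l])
  also have "\<dots> \<longleftrightarrow> (\<forall>a\<in>index. pdiv j (laplace_coeff z a))"
    unfolding y laplace_expand by (rule expand_pdiv)
  finally show "(\<forall>x\<in>UNIV. pdiv j (laplace y x)) \<longleftrightarrow> (\<forall>a\<in>index. pdiv j (laplace_coeff z a))" .
qed (use expand_surj in \<open>auto simp: expand_diff expand_pdiv[simplified] fun_eq_iff\<close>)

end

section \<open>Smith invariants of the Laplacian\<close>

context unramified
begin

section \<open>Integer matrices acting over the local ring\<close>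

definition act :: "int^'n::finite^'m::finite \<Rightarrow> ('n \<Rightarrow> 'b) \<Rightarrow> 'm \<Rightarrow> 'b" where
  "act M y x = (\<Sum>w\<in>UNIV. of_int (M $ x $ w) * y w)"

lemma act_mult: "act (A ** B) y = act A (act B y)"
proof
  fix x
  have "act (A ** B) y x = (\<Sum>w\<in>UNIV. \<Sum>v\<in>UNIV. of_int (A $ x $ v) * (of_int (B $ v $ w) * y w))"
    by (simp add: act_def matrix_matrix_mult_def sum_distrib_right mult.assoc)
  also have "\<dots> = (\<Sum>v\<in>UNIV. \<Sum>w\<in>UNIV. of_int (A $ x $ v) * (of_int (B $ v $ w) * y w))"
    by (rule sum.swap)
  also have "\<dots> = act A (act B y) x" by (simp add: act_def sum_distrib_left)
  finally show "act (A ** B) y x = act A (act B y) x" .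
qed

lemma act_diagonal: "act (\<chi> i j. if i = j then d i else 0) y x = of_int (d x) * y x"
proof -
  have "act (\<chi> i j. if i = j then d i else 0) y x = (\<Sum>w\<in>UNIV. if x = w then of_int (d x) * y x else 0)"
    unfolding act_def by (intro sum.cong) auto
  then show ?thesis by simp
qed

lemma act_one: "act (mat 1) y = y"
  using act_diagonal[of "\<lambda>_. 1" y] by (simp add: mat_def fun_eq_iff)

lemma act_diff: "act M (\<lambda>x. y x - y' x) = (\<lambda>x. act M y x - act M y' x)"
  by (simp add: act_def right_diff_distrib sum_subtractf fun_eq_iff)

lemma pdiv_act: "\<forall>x\<in>UNIV. pdiv n (y x) \<Longrightarrow> \<forall>x\<in>UNIV. pdiv n (act M y x)"
  unfolding act_def by (intro ballI pdiv_sum pdiv_mult of_int_closed) auto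

lemma pdiv_act_iff:
  assumes "P' ** P = mat 1"
  shows "(\<forall>x\<in>UNIV. pdiv n (act P y x)) \<longleftrightarrow> (\<forall>x\<in>UNIV. pdiv n (y x))"
  using pdiv_act[of n y P] pdiv_act[of n "act P y" P'] assms by (auto simp: act_one simp flip: act_mult)

lemma diagonalized_corresponds:
  assumes "diagonalized L P P' Q Q' d"
  shows "corresponds UNIV (diagonal UNIV (\<lambda>x. of_int (d x))) UNIV (\<lambda>n y. \<forall>x\<in>UNIV. pdiv n (act L y x))"
proof -
  interpret diagonalized L P P' Q Q' d by (rule assms)
  show ?thesis
  proof (rule correspondsI_pdiv[where R = "\<lambda>z y. y = act Q z"])
    show "\<exists>z. y = act Q z" for y
      by (rule exI[of _ "act Q' y"]) (simp add: inv act_one flip: act_mult)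
    fix z y n assume y: "y = act Q z"
    show "(\<forall>i\<in>UNIV. pdiv n (z i)) \<longleftrightarrow> (\<forall>j\<in>UNIV. pdiv n (y j))"
      unfolding y by (rule pdiv_act_iff[OF inv(4), symmetric])
    have "act P (act L y) = act (P ** L ** Q) z" by (simp add: y act_mult)
    then have eq: "act P (act L y) x = of_int (d x) * z x" for x
      by (simp add: act_diagonal flip: diag)
    have "(\<forall>x\<in>UNIV. pdiv n (act L y x)) \<longleftrightarrow> (\<forall>x\<in>UNIV. pdiv n (act P (act L y) x))"
      by (rule pdiv_act_iff[OF inv(2), symmetric])
    then show "diagonal UNIV (\<lambda>x. of_int (d x)) n z \<longleftrightarrow> (\<forall>x\<in>UNIV. pdiv n (act L y x))"
      by (simp add: eq diagonal_def)
  qed (auto simp: act_diff)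
qed

end

context compatible_roots
begin

text \<open>Zero entries are divisible by every power of \<open>p\<close> and so appear in both
  divisibility counts; their difference sees the nonzero entries of valuation \<open>j\<close>
  only.\<close>

lemma card_pdiv_split:
  assumes "finite I" "\<And>a. a \<in> I \<Longrightarrow> D a = 0 \<or> fraction (D a)"
  shows "card {a\<in>I. pdiv j (D a)} = card {a\<in>I. pdiv (Suc j) (D a)} + card {a\<in>I. D a \<noteq> 0 \<and> val (D a) = int j}"
proof -
  have "pdiv j (D a) \<longleftrightarrow> pdiv (Suc j) (D a) \<or> (D a \<noteq> 0 \<and> val (D a) = int j)"
    "\<not> (pdiv (Suc j) (D a) \<and> D a \<noteq> 0 \<and> val (D a) = int j)" if "a \<in> I" for a
    using assms(2)[OF that] by (auto simp: pdiv_zero pdiv_iff_val)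
  then have "{a\<in>I. pdiv j (D a)} = {a\<in>I. pdiv (Suc j) (D a)} \<union> {a\<in>I. D a \<noteq> 0 \<and> val (D a) = int j}"
    "{a\<in>I. pdiv (Suc j) (D a)} \<inter> {a\<in>I. D a \<noteq> 0 \<and> val (D a) = int j} = {}"
    by blast+
  then show ?thesis using assms(1) by (simp add: card_Un_disjoint)
qed

lemma fraction_of_int: "a \<noteq> 0 \<Longrightarrow> fraction (of_int a)"
  by (intro fraction_ring of_int_closed) simp

lemma val_of_int: "a \<noteq> 0 \<Longrightarrow> val (of_int a) = int (multiplicity (int p) a)"
proof -
  assume a: "a \<noteq> 0"
  have p1: "p > 1" using p by (rule prime_gt_1_nat)
  have iff: "int j \<le> val (of_int a) \<longleftrightarrow> j \<le> multiplicity (int p) a" for j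
    using pdiv_iff_val[OF fraction_of_int[OF a]] power_dvd_iff_le_multiplicity[of a "int p" j] a p1
    by (simp add: pdiv_of_int)
  have "val (of_int a) \<ge> 0" using iff[of 0] by simp
  then obtain v where v: "val (of_int a) = int v" by (metis nonneg_int_cases)
  then show ?thesis using iff[of v] iff[of "multiplicity (int p) a"] by simp
qed

lemma card_multiplicity_eq:
  fixes d :: "'m::finite \<Rightarrow> int" and D :: "'i \<Rightarrow> 'b"
  assumes "corresponds UNIV (diagonal UNIV (\<lambda>x. of_int (d x))) I (diagonal I D)"
    and "finite I" "\<And>a. a \<in> I \<Longrightarrow> D a = 0 \<or> fraction (D a)"
  shows "card {x. d x \<noteq> 0 \<and> multiplicity (int p) (d x) = j} = card {a\<in>I. D a \<noteq> 0 \<and> val (D a) = int j}"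
proof -
  have eq: "card {x\<in>UNIV. pdiv j (of_int (d x))} = card {a\<in>I. pdiv j (D a)}" for j
    using assms(2) by (intro diagonal_invariant assms(1)) simp_all
  have "(of_int (d x) = (0::'b)) \<or> fraction (of_int (d x))" for x
    using fraction_of_int by (cases "d x = 0") auto
  then have "card {x\<in>UNIV. pdiv j (of_int (d x))} = card {x\<in>UNIV. pdiv (Suc j) (of_int (d x))}
     + card {x\<in>UNIV. of_int (d x) \<noteq> (0::'b) \<and> val (of_int (d x)) = int j}"
    by (intro card_pdiv_split) simp_all
  then have "card {x\<in>UNIV. of_int (d x) \<noteq> (0::'b) \<and> val (of_int (d x)) = int j}
     = card {a\<in>I. D a \<noteq> 0 \<and> val (D a) = int j}"
    using card_pdiv_split[OF assms(2,3), where j = j] unfolding eq by simp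
  moreover have "{x\<in>UNIV. of_int (d x) \<noteq> (0::'b) \<and> val (of_int (d x)) = int j}
     = {x. d x \<noteq> 0 \<and> multiplicity (int p) (d x) = j}"
    by (auto simp: val_of_int)
  ultimately show ?thesis by simp
qed

end

section \<open>Valuations in the blocks\<close>

locale van_lint_schrijver = semiprimitive \<zeta> g n p N \<omega> l k
  for \<zeta> :: "'b::field_char_0" and g :: "'k::{finite,field}" and n p N \<omega> l k +
  fixes h d :: nat
  assumes N: "N = 2 * h" and l_less: "l - 1 < p ^ h" and d: "d = multiplicity p (l - 1)"
begin

lemma p1: "p > 1"
  using p by (rule prime_gt_1_nat)

lemma h_pos: "h > 0"
  using N N_pos by simp

lemma d_less_h: "d < h"
proof -
  have "p ^ d dvd l - 1" unfolding d by (rule multiplicity_dvd)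
  then have "p ^ d \<le> l - 1" using l2 by (intro dvd_imp_le) simp_all
  then have "p ^ d < p ^ h" using l_less by simp
  then show ?thesis using p1 by simp
qed

lemma \<gamma>_cases: "\<gamma> = of_nat p ^ h \<or> \<gamma> = - (of_nat p ^ h)"
proof -
  have "\<gamma>\<^sup>2 = of_nat p ^ N" unfolding \<gamma>_square of_nat_q ..
  also have "\<dots> = (of_nat p ^ h)\<^sup>2" by (simp add: N mult.commute flip: power_mult)
  finally show ?thesis by (rule power2_eq_iff[THEN iffD1])
qed

lemma \<gamma>_in_ring: "\<gamma> \<in> ring"
  using \<gamma>_cases p_power_closed uminus_closed by metis

lemma fraction_\<gamma>: "fraction \<gamma>"
  using \<gamma>_cases fraction_uminus[OF fraction_power[OF fraction_p]] fraction_power[OF fraction_p] by metis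

lemma val_uminus: "fraction x \<Longrightarrow> val (- x) = val x"
proof -
  assume "fraction x"
  have "unit (-1)"
    by (rule unit_if_mult_eq_one[of _ "-1"]) (simp_all add: uminus_closed one_closed)
  then show ?thesis using val_mult[OF fraction_unit \<open>fraction x\<close>, of "-1"] by (simp add: val_unit)
qed

lemma val_\<gamma>: "val \<gamma> = int h"
  using \<gamma>_cases by (auto simp: val_uminus fraction_power fraction_p val_power val_p)

lemma unit_\<gamma>_plus_1: "unit (\<gamma> + 1)"
proof -
  have "pdiv 1 \<gamma>" using h_pos by (simp add: pdiv_iff_val fraction_\<gamma> val_\<gamma>)
  then have "residue \<gamma> = 0" using \<phi>_eq_0_iff_pdiv[OF \<gamma>_in_ring] by simp
  then show ?thesis by (simp add: unit_def add_closed \<gamma>_in_ring one_closed \<phi>_add \<phi>_one)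
qed

text \<open>Because \<open>d < h\<close>, the power \<open>p ^ Suc d\<close> divides
  \<open>\<gamma>\<close> but not \<open>l - 1\<close>, so \<open>l - 1\<close> alone decides the
  valuation, whatever the sign of \<open>\<gamma>\<close>.\<close>

lemma fraction_\<gamma>_l: "fraction (\<gamma> + 1 - of_nat l)" and val_\<gamma>_l: "val (\<gamma> + 1 - of_nat l) = int d"
proof -
  obtain e :: int where e: "\<gamma> = of_int e" "e = int p ^ h \<or> e = - (int p ^ h)"
    using \<gamma>_cases by (metis of_int_minus of_int_of_nat_eq of_int_power)
  define a where "a = e - int (l - 1)"
  have a: "\<gamma> + 1 - of_nat l = of_int a" using l2 by (simp add: e a_def of_nat_diff)
  have dvd_e: "int p ^ j dvd e" if "j \<le> h" for j using e(2) that by (auto simp: le_imp_power_dvd)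
  have "int p ^ d dvd int (l - 1)" unfolding d by (metis multiplicity_dvd of_nat_dvd_iff of_nat_power)
  then have 1: "int p ^ d dvd a" unfolding a_def using dvd_e d_less_h by (intro dvd_diff) simp_all
  have 2: "\<not> int p ^ Suc d dvd a"
  proof
    assume "int p ^ Suc d dvd a"
    then have "int p ^ Suc d dvd e - a" using dvd_e[of "Suc d"] d_less_h by (intro dvd_diff) simp_all
    then have "p ^ Suc d dvd l - 1" by (simp add: a_def) (metis of_nat_dvd_iff of_nat_power power_Suc of_nat_mult)
    then have "Suc d \<le> multiplicity p (l - 1)" using l2 p1 by (intro multiplicity_geI) auto
    then show False by (simp add: d)
  qed
  have "a \<noteq> 0" using 2 by auto
  then show "fraction (\<gamma> + 1 - of_nat l)" unfolding a by (rule fraction_of_int)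
  show "val (\<gamma> + 1 - of_nat l) = int d"
    unfolding a val_of_int[OF \<open>a \<noteq> 0\<close>] using 1 2 by (simp add: multiplicity_eqI)
qed

text \<open>For \<open>a \<noteq> b\<close> let \<open>m\<close> represent \<open>b - a\<close>
  modulo \<open>l\<close>. The ratio is the cocycle of \<open>i + a * k\<close> and
  \<open>m * k\<close>, divided by \<open>\<gamma> = gauss (m * k)\<close>.\<close>

lemma fraction_gauss_ratio:
  assumes "a < l" "b < l"
  shows "fraction (G i a / G i b)"
proof (cases "a = b")
  case True
  then show ?thesis by (simp add: gauss_nonzero fraction_unit unit_one)
next
  case False
  define m where "m = (b + (l - a)) mod l"
  have "\<not> l dvd m"
  proof
    assume "l dvd m"
    then have "[b + (l - a) + a = 0 + a] (mod l)" by (intro cong_add) (simp_all add: m_def cong_def dvd_eq_mod_eq_0)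
    then show False using False assms by (simp add: cong_def)
  qed
  have "[i + a * k + m * k = i + b * k] (mod n)"
  proof -
    have "[m = b + (l - a)] (mod l)" by (simp add: m_def cong_def)
    then have "[m * k = (b + (l - a)) * k] (mod l * k)" by (simp add: cong_def mod_mult_mult2)
    then have "[i + a * k + m * k = i + a * k + (b + (l - a)) * k] (mod n)" unfolding kl by (intro cong_add) simp_all
    also have "i + a * k + (b + (l - a)) * k = i + (b + l) * k"
    proof -
      have "a + (b + (l - a)) = b + l" using assms by simp
      then show ?thesis by (metis add.assoc add_mult_distrib)
    qed
    also have "[i + (b + l) * k = i + b * k] (mod n)" by (rule cong_periodic)
    finally show ?thesis .
  qed
  then have "gauss (i + a * k + m * k) = G i b" by (rule gauss_cong)
  then have "fraction (G i a * \<gamma> / G i b)"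
    using gauss_cocycle_fraction[of "i + a * k" "m * k"] gauss_mult_k[OF \<open>\<not> l dvd m\<close>] by simp
  then have "fraction (G i a * \<gamma> / G i b / \<gamma>)" using fraction_\<gamma> by (rule fraction_divide)
  then show ?thesis using fraction_nonzero[OF fraction_\<gamma>] by (simp add: field_simps)
qed

lemma val_gauss_ratio:
  assumes "a < l" "b < l"
  shows "real_of_int (val (G i a / G i b)) = gval (i + a * k) - gval (i + b * k)"
  using rval_fraction[OF fraction_gauss_ratio[OF assms]] by (simp add: gval_def rval_divide radical_gauss)

definition min_c :: "nat \<Rightarrow> nat" where
  "min_c i = Min {carries p N (i + m * k) (r * k) | m r. m \<le> l - 1 \<and> 0 < r \<and> r \<le> l - 1}"

lemma k_not_dvd: "0 < i \<Longrightarrow> i < k \<Longrightarrow> \<not> n dvd i + m * k"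
proof
  assume i: "0 < i" "i < k" and "n dvd i + m * k"
  then have "k dvd i + m * k" using kl by (metis dvd_mult_right)
  then have "k dvd i" by (simp add: dvd_add_left_iff)
  then show False using i by (auto dest: dvd_imp_le)
qed

lemma carries_block:
  assumes i: "0 < i" "i < k" and r: "0 < r" "r < l"
  shows "real (carries p N (i + m * k) (r * k)) = gval (i + m * k) + h - gval (i + ((m + r) mod l) * k)"
proof -
  have lr: "\<not> l dvd r" using r by (auto dest: dvd_imp_le)
  have sum: "i + m * k + r * k = i + (m + r) * k" by (simp add: algebra_simps)
  have "[(m + r) * k = ((m + r) mod l) * k] (mod l * k)" by (simp add: cong_def mod_mult_mult2)
  then have "[i + (m + r) * k = i + ((m + r) mod l) * k] (mod n)" unfolding kl by (intro cong_add) simp_all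
  then have "gval (i + m * k + r * k) = gval (i + ((m + r) mod l) * k)" unfolding sum by (rule gval_cong)
  moreover have "gval (r * k) = h" using gval_mult_k[OF lr] by (simp add: N)
  moreover have "\<not> n dvd i + m * k + r * k" unfolding sum by (rule k_not_dvd[OF i])
  ultimately show ?thesis
    using k_not_dvd[OF i] lr by (simp add: carries_eq n_dvd_mult_k_iff)
qed

text \<open>By \<open>carries_block\<close> the carries are \<open>h\<close> plus differences of two
  valuations within the block, and as \<open>r\<close> runs through the nonzero residues these are
  all pairs of distinct indices. The least difference therefore joins a smallest valuation to a
  greatest one. The indices are distinct even when all valuations in the block agree.\<close>

lemma min_c_attained:
  assumes i: "0 < i" "i < k"
  shows "\<exists>a b. a < l \<and> b < l \<and> a \<noteq> b \<and> real (min_c i) = gval (i + a * k) + h - gval (i + b * k) \<and>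
     (\<forall>m<l. gval (i + a * k) \<le> gval (i + m * k) \<and> gval (i + m * k) \<le> gval (i + b * k))"
proof -
  let ?C = "{carries p N (i + m * k) (r * k) | m r. m \<le> l - 1 \<and> 0 < r \<and> r \<le> l - 1}"
  have eq: "?C = (\<lambda>(m, r). carries p N (i + m * k) (r * k)) ` ({..<l} \<times> {1..<l})"
  proof -
    have "m \<le> l - 1 \<and> 0 < r \<and> r \<le> l - 1 \<longleftrightarrow> (m, r) \<in> {..<l} \<times> {1..<l}" for m r
      using l2 by auto
    moreover have "{f m r | m r. (m, r) \<in> A} = (\<lambda>(m, r). f m r) ` A" for f :: "nat \<Rightarrow> nat \<Rightarrow> nat" and A
      by force
    ultimately show ?thesis by (simp only:)
  qed
  have fin: "finite ?C" unfolding eq by simp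
  have "(0, 1) \<in> {..<l} \<times> {1..<l}" using l2 by simp
  then have "?C \<noteq> {}" unfolding eq by blast
  then have "min_c i \<in> ?C" unfolding min_c_def using fin by (rule Min_in[rotated])
  then obtain x where x: "x \<in> {..<l} \<times> {1..<l}" "min_c i = (\<lambda>(m, r). carries p N (i + m * k) (r * k)) x"
    unfolding eq by (rule imageE)
  define a r where "a = fst x" and "r = snd x"
  have ar: "a < l" "0 < r" "r < l" "min_c i = carries p N (i + a * k) (r * k)"
    using x by (auto simp: a_def r_def)
  define b where "b = (a + r) mod l"
  let ?f = "\<lambda>m. gval (i + m * k)"
  have min: "real (min_c i) = ?f a + h - ?f b"
    unfolding ar(4) b_def by (rule carries_block[OF i ar(2,3)])
  have b: "b < l" "a \<noteq> b"
  proof -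
    show "b < l" using l2 by (simp add: b_def)
    show "a \<noteq> b"
    proof
      assume "a = b"
      then have "[a + r = a + 0] (mod l)" using ar(1) by (simp add: b_def cong_def)
      then have "[r = 0] (mod l)" by (rule cong_add_lcancel_nat[THEN iffD1])
      then show False using ar by (auto simp: cong_0_iff dest: dvd_imp_le)
    qed
  qed
  have least: "?f a - ?f b \<le> ?f m - ?f m'" if "m < l" "m' < l" "m \<noteq> m'" for m m'
  proof -
    define r' where "r' = (m' + (l - m)) mod l"
    have mm: "(m + r') mod l = m'"
    proof -
      have "(m + r') mod l = (m + (m' + (l - m))) mod l" by (simp add: r'_def mod_add_right_eq)
      also have "m + (m' + (l - m)) = m' + l" using that by simp
      finally show ?thesis using that by simp
    qed
    have r': "0 < r'" "r' < l"
    proof -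
      show "r' < l" using l2 by (simp add: r'_def)
      show "0 < r'" using mm that by (cases "r' = 0") auto
    qed
    have "carries p N (i + m * k) (r' * k) \<in> ?C" unfolding eq using that r' by (intro image_eqI[of _ _ "(m, r')"]) auto
    then have "min_c i \<le> carries p N (i + m * k) (r' * k)" unfolding min_c_def using fin by (intro Min_le)
    then have "real (min_c i) \<le> ?f m + h - ?f m'"
      using carries_block[OF i r', of m] by (simp add: mm)
    then show ?thesis using min by simp
  qed
  have ab: "?f a \<le> ?f b" using least[of b a] b ar by simp
  have "?f a \<le> ?f m \<and> ?f m \<le> ?f b" if "m < l" for m
    using least[of m b] least[of a m] ab that b ar by (cases "m = a"; cases "m = b") auto
  then show ?thesis using ar b min by blast
qed

definition extremes :: "nat \<Rightarrow> nat \<times> nat" where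
  "extremes i = (SOME (a, b). a < l \<and> b < l \<and> a \<noteq> b \<and> real (min_c i) = gval (i + a * k) + h - gval (i + b * k) \<and>
     (\<forall>m<l. gval (i + a * k) \<le> gval (i + m * k) \<and> gval (i + m * k) \<le> gval (i + b * k)))"

abbreviation "lo i \<equiv> fst (extremes i)"
abbreviation "hi i \<equiv> snd (extremes i)"

lemma extremes:
  assumes "0 < i" "i < k"
  shows "lo i < l" "hi i < l" "lo i \<noteq> hi i"
    "real (min_c i) = gval (i + lo i * k) + h - gval (i + hi i * k)"
    "\<And>m. m < l \<Longrightarrow> gval (i + lo i * k) \<le> gval (i + m * k)"
    "\<And>m. m < l \<Longrightarrow> gval (i + m * k) \<le> gval (i + hi i * k)"
proof -
  let ?P = "\<lambda>(a, b). a < l \<and> b < l \<and> a \<noteq> b \<and> real (min_c i) = gval (i + a * k) + h - gval (i + b * k) \<and>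
     (\<forall>m<l. gval (i + a * k) \<le> gval (i + m * k) \<and> gval (i + m * k) \<le> gval (i + b * k))"
  have "\<exists>x. ?P x" using min_c_attained[OF assms] by auto
  then have "?P (extremes i)" unfolding extremes_def by (rule someI_ex)
  then show "lo i < l" "hi i < l" "lo i \<noteq> hi i"
    "real (min_c i) = gval (i + lo i * k) + h - gval (i + hi i * k)"
    "\<And>m. m < l \<Longrightarrow> gval (i + lo i * k) \<le> gval (i + m * k)"
    "\<And>m. m < l \<Longrightarrow> gval (i + m * k) \<le> gval (i + hi i * k)"
    by (simp_all add: case_prod_beta)
qed

text \<open>The smallest valuation does not exceed the greatest. Consequently the pivot also divides
  the scalar \<open>\<gamma>\<^sup>2 + \<gamma>\<close>, whose valuation is
  \<open>h\<close>.\<close>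

lemma min_c_le_h: "0 < i \<Longrightarrow> i < k \<Longrightarrow> min_c i \<le> h"
  using extremes(1,4,6)[of i] extremes(1)[of i] by (smt (verit) of_nat_le_iff)

definition pivot :: "nat \<Rightarrow> 'b" where
  "pivot i = \<gamma> * (G i (lo i) / G i (hi i))"

lemma fraction_pivot: "0 < i \<Longrightarrow> i < k \<Longrightarrow> fraction (pivot i)"
  unfolding pivot_def by (intro fraction_mult fraction_\<gamma> fraction_gauss_ratio extremes)

lemma val_pivot:
  assumes i: "0 < i" "i < k"
  shows "val (pivot i) = int (min_c i)"
proof -
  have "val (pivot i) = val \<gamma> + val (G i (lo i) / G i (hi i))"
    unfolding pivot_def by (intro val_mult fraction_\<gamma> fraction_gauss_ratio extremes i)
  then have "real_of_int (val (pivot i)) = real h + (gval (i + lo i * k) - gval (i + hi i * k))"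
    using val_gauss_ratio[OF extremes(1,2)[OF i], of i] by (simp add: val_\<gamma>)
  then have "real_of_int (val (pivot i)) = real_of_int (int (min_c i))" using extremes(4)[OF i] by simp
  then show ?thesis by (simp only: of_int_eq_iff)
qed

text \<open>The entries come from \<open>trivial_block\<close> for \<open>i = 0\<close> and
  otherwise from \<open>rank_one_perturbation\<close> with
  \<open>s = \<gamma>\<^sup>2 + \<gamma>\<close> and \<open>c = pivot i\<close>, where the trace of
  the rank one part is \<open>l * \<gamma>\<close>.\<close>

definition smith :: "nat \<times> nat \<Rightarrow> 'b" where
  "smith = (\<lambda>(i, m). if i = 0 then
      if m = 0 then 0 else if m = l then 1 else if m = 1 then \<gamma> + 1
      else if m = 2 then \<gamma> * (\<gamma> + 1) * (\<gamma> + 1 - of_nat l) else \<gamma>\<^sup>2 + \<gamma>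
    else if m = lo i then pivot i
      else if m = hi i then (\<gamma>\<^sup>2 + \<gamma>) * (\<gamma>\<^sup>2 + \<gamma> - of_nat l * \<gamma>) / pivot i else \<gamma>\<^sup>2 + \<gamma>)"

definition block_index :: "nat \<Rightarrow> (nat \<times> nat) set" where
  "block_index i = Pair i ` (if i = 0 then {..l} else {..<l})"

lemma \<gamma>_factor: "\<gamma>\<^sup>2 + \<gamma> = \<gamma> * (\<gamma> + 1)" "\<gamma>\<^sup>2 + \<gamma> - of_nat l * \<gamma> = \<gamma> * (\<gamma> + 1 - of_nat l)"
  by (simp_all add: power2_eq_square algebra_simps)

lemma fraction_s: "fraction (\<gamma>\<^sup>2 + \<gamma>)" and val_s: "val (\<gamma>\<^sup>2 + \<gamma>) = int h"
  unfolding \<gamma>_factor by (simp_all add: fraction_mult val_mult fraction_\<gamma> fraction_unit unit_\<gamma>_plus_1 val_\<gamma> val_unit)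

lemma diagonal_cong:
  "(\<And>i. i \<in> I \<Longrightarrow> D i = D' i) \<Longrightarrow> diagonal I D = diagonal I D'"
  by (auto simp: diagonal_def fun_eq_iff)

lemma block_corresponds:
  assumes "i < k"
  shows "corresponds (block_index i) (\<lambda>j c. \<forall>a\<in>block_index i. pdiv j (laplace_coeff c a))
    (block_index i) (diagonal (block_index i) smith)"
proof (cases "i = 0")
  case True
  let ?Y = "\<lambda>c :: nat \<times> nat \<Rightarrow> 'b. \<Sum>m\<in>{1..<l}. c (0, m)"
  have inj: "inj_on (Pair 0) {..l}" by (simp add: inj_on_def)
  have V: "(\<forall>a\<in>block_index 0. pdiv j (laplace_coeff c a)) \<longleftrightarrow>
     pdiv j (?Y c - c (0, l)) \<and> (\<forall>m\<in>{1..<l}. pdiv j ((\<gamma>\<^sup>2 + \<gamma>) * c (0, m) - \<gamma> * ?Y c - c (0, l)))" for j c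
  proof -
    have "{..l} = insert 0 (insert l {1..<l})" using l2 by auto
    then have "(\<forall>a\<in>block_index 0. pdiv j (laplace_coeff c a)) \<longleftrightarrow>
       pdiv j (laplace_coeff c (0, 0)) \<and> pdiv j (laplace_coeff c (0, l)) \<and> (\<forall>m\<in>{1..<l}. pdiv j (laplace_coeff c (0, m)))"
      by (simp add: block_index_def)
    moreover have "laplace_coeff c (0, 0) = ?Y c - c (0, l)" using l2 by (simp add: laplace_coeff_def Let_def)
    moreover have "laplace_coeff c (0, l) = - \<gamma>\<^sup>2 * (?Y c - c (0, l))" using l2 by (simp add: laplace_coeff_def Let_def)
    \<comment> \<open>Row \<open>(0, l)\<close> is a multiple of row \<open>(0, 0)\<close> over
      \<open>ring\<close> and adds no condition.\<close>
    moreover have "pdiv j (- \<gamma>\<^sup>2 * (?Y c - c (0, l)))" if "pdiv j (?Y c - c (0, l))"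
      using that by (intro pdiv_mult uminus_closed power_closed \<gamma>_in_ring)
    moreover have "laplace_coeff c (0, m) = (\<gamma>\<^sup>2 + \<gamma>) * c (0, m) - \<gamma> * ?Y c - c (0, l)" if "m \<in> {1..<l}" for m
      using that by (simp add: laplace_coeff_def Let_def)
    ultimately show ?thesis by auto
  qed
  have B: "block_index 0 = Pair 0 ` {..l}" by (simp add: block_index_def)
  have D: "diagonal (block_index 0) smith = diagonal (Pair 0 ` {..l}) (\<lambda>a. if a = (0, 0) then 0 else if a = (0, l) then 1
       else if a = (0, 1) then \<gamma> + 1 else if a = (0, 2) then \<gamma> * (\<gamma> + 1) * (\<gamma> + 1 - of_nat l) else \<gamma>\<^sup>2 + \<gamma>)"
    unfolding B by (rule diagonal_cong) (auto simp: smith_def split: if_splits)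
  show ?thesis unfolding True V D unfolding B by (rule trivial_block[OF l2 \<gamma>_in_ring inj])
next
  case False
  then have i: "0 < i" "i < k" using assms by auto
  \<comment> \<open>The rank one matrix \<open>\<gamma> * G i b / G i a\<close> is factored as
    \<open>pivot i * w a * u b\<close>. The normalization gives \<open>u\<close> the value 1 at
    \<open>lo i\<close> and \<open>w\<close> the value 1 at \<open>hi i\<close>, and the extremality
    of these two indices is what makes \<open>u\<close> and \<open>w\<close> integral.\<close>
  define u where "u = (\<lambda>a :: nat \<times> nat. G i (snd a) / G i (lo i))"
  define w where "w = (\<lambda>a :: nat \<times> nat. G i (hi i) / G i (snd a))"
  have B: "block_index i = Pair i ` {..<l}" using False by (simp add: block_index_def)
  have sum: "(\<Sum>a\<in>block_index i. f a) = (\<Sum>m<l. f (i, m))" for f :: "nat \<times> nat \<Rightarrow> 'b"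
    unfolding B by (subst sum.reindex) (simp_all add: inj_on_def)
  note ex = extremes[OF i]
  have nz: "G i m \<noteq> 0" for m by (rule gauss_nonzero)
  have ratio_ring: "G i a / G i b \<in> ring" if "a < l" "b < l" "gval (i + b * k) \<le> gval (i + a * k)" for a b
  proof -
    have "0 \<le> real_of_int (val (G i a / G i b))" using val_gauss_ratio[OF that(1,2)] that(3) by simp
    then show ?thesis using in_ring_iff_val[OF fraction_gauss_ratio[OF that(1,2)]] by simp
  qed
  have p0: "pivot i \<noteq> 0" using fraction_nonzero[OF fraction_pivot[OF i]] .
  have base: "corresponds (block_index i) (\<lambda>j y. \<forall>a\<in>block_index i. pdiv j ((\<gamma>\<^sup>2 + \<gamma>) * y a - pivot i * w a * (\<Sum>b\<in>block_index i. u b * y b)))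
    (block_index i) (diagonal (block_index i) (\<lambda>a. if a = (i, lo i) then pivot i else if a = (i, hi i)
      then (\<gamma>\<^sup>2 + \<gamma>) * ((\<gamma>\<^sup>2 + \<gamma>) - pivot i * (\<Sum>b\<in>block_index i. u b * w b)) / pivot i else (\<gamma>\<^sup>2 + \<gamma>)))"
  proof (rule rank_one_perturbation)
    show "finite (block_index i)" by (simp add: block_index_def)
    show "(i, lo i) \<in> block_index i" "(i, hi i) \<in> block_index i" using ex by (auto simp: B)
    show "(i, lo i) \<noteq> (i, hi i)" using ex by simp
    show "u a \<in> ring" if "a \<in> block_index i" for a using that ex by (auto simp: B u_def intro!: ratio_ring)
    show "w a \<in> ring" if "a \<in> block_index i" for a using that ex by (auto simp: B w_def intro!: ratio_ring)
    show "u (i, lo i) = 1" "w (i, hi i) = 1" using nz by (simp_all add: u_def w_def)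
    show "pivot i \<noteq> 0" by (rule p0)
    have "0 \<le> val ((\<gamma>\<^sup>2 + \<gamma>) / pivot i)"
      using min_c_le_h[OF i] fraction_pivot[OF i]
      by (simp add: divide_inverse val_mult fraction_s fraction_inverse val_inverse val_s val_pivot[OF i])
    then show "(\<gamma>\<^sup>2 + \<gamma>) / pivot i \<in> ring"
      by (simp add: in_ring_iff_val fraction_divide fraction_s fraction_pivot[OF i])
  qed
  have row: "(\<gamma>\<^sup>2 + \<gamma>) * y a - pivot i * w a * (\<Sum>b\<in>block_index i. u b * y b) = laplace_coeff y a"
    if a: "a \<in> block_index i" for y a
  proof -
    obtain m where m: "a = (i, m)" using a by (auto simp: B)
    have "pivot i * w a * (\<Sum>b\<in>block_index i. u b * y b) = (\<Sum>j<l. pivot i * w a * (u (i, j) * y (i, j)))"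
      unfolding sum by (simp add: sum_distrib_left)
    also have "\<dots> = (\<Sum>j<l. \<gamma> / G i m * (G i j * y (i, j)))"
      by (intro sum.cong refl) (simp add: m pivot_def u_def w_def nz)
    also have "\<dots> = \<gamma> / G i m * (\<Sum>j<l. G i j * y (i, j))" by (rule sum_distrib_left[symmetric])
    finally show ?thesis using False by (simp add: laplace_coeff_def m)
  qed
  \<comment> \<open>Every product \<open>u b * w b\<close> equals
    \<open>G i (hi i) / G i (lo i)\<close>, so each of the \<open>l\<close> summands contributes
    \<open>\<gamma>\<close>.\<close>
  have trace: "pivot i * (\<Sum>b\<in>block_index i. u b * w b) = of_nat l * \<gamma>"
    unfolding sum using nz by (simp add: u_def w_def pivot_def)
  have diag: "diagonal (block_index i) (\<lambda>a. if a = (i, lo i) then pivot i else if a = (i, hi i)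
      then (\<gamma>\<^sup>2 + \<gamma>) * ((\<gamma>\<^sup>2 + \<gamma>) - of_nat l * \<gamma>) / pivot i else (\<gamma>\<^sup>2 + \<gamma>)) = diagonal (block_index i) smith"
    by (rule diagonal_cong) (use False in \<open>auto simp: B smith_def split: if_splits\<close>)
  show ?thesis using base unfolding trace diag by (simp add: row)
qed

lemma index_blocks: "index = (\<Union>i\<in>{..<k}. block_index i)"
  using k_pos l2 by (auto simp: index_def block_index_def split: if_splits)

lemma laplace_diagonal:
  "corresponds UNIV (\<lambda>j y. \<forall>x\<in>UNIV. pdiv j (laplace y x)) index (diagonal index smith)"
proof -
  have disj: "disjoint_family_on block_index {..<k}"
    by (auto simp: disjoint_family_on_def block_index_def split: if_splits)
  have "corresponds (\<Union>i\<in>{..<k}. block_index i) (\<lambda>j c. \<forall>i\<in>{..<k}. \<forall>a\<in>block_index i. pdiv j (laplace_coeff c a))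
    (\<Union>i\<in>{..<k}. block_index i) (\<lambda>j z. \<forall>i\<in>{..<k}. diagonal (block_index i) smith j z)"
  proof (rule corresponds_glue[OF _ disj disj])
    fix i j and c c' :: "nat \<times> nat \<Rightarrow> 'b" assume eq: "\<And>a. a \<in> block_index i \<Longrightarrow> c a = c' a"
    show "diagonal (block_index i) smith j c = diagonal (block_index i) smith j c'"
      using eq by (auto simp: diagonal_def)
    have "laplace_coeff c a = laplace_coeff c' a" if "a \<in> block_index i" for a
    proof (cases "i = 0")
      case True
      then have "c (0, m) = c' (0, m)" if "m \<le> l" for m using eq that by (auto simp: block_index_def)
      moreover from this have "(\<Sum>j\<in>{1..<l}. c (0, j)) = (\<Sum>j\<in>{1..<l}. c' (0, j))"
        by (intro sum.cong) auto
      ultimately show ?thesis using that True by (auto simp: block_index_def laplace_coeff_def Let_def)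
    next
      case False
      then have "c (i, m) = c' (i, m)" if "m < l" for m using eq that by (auto simp: block_index_def)
      moreover from this have "(\<Sum>j<l. G i j * c (i, j)) = (\<Sum>j<l. G i j * c' (i, j))"
        by (intro sum.cong) auto
      ultimately show ?thesis using that False by (auto simp: block_index_def laplace_coeff_def)
    qed
    then show "(\<forall>a\<in>block_index i. pdiv j (laplace_coeff c a)) = (\<forall>a\<in>block_index i. pdiv j (laplace_coeff c' a))"
      by simp
  qed (simp add: block_corresponds)
  moreover have "(\<lambda>j c. \<forall>i\<in>{..<k}. \<forall>a\<in>block_index i. pdiv j (laplace_coeff c a)) =
     (\<lambda>j c. \<forall>a\<in>index. pdiv j (laplace_coeff c a))"
    unfolding index_blocks by (intro ext) blast
  moreover have "(\<lambda>j z. \<forall>i\<in>{..<k}. diagonal (block_index i) smith j z) = diagonal index smith"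
    unfolding index_blocks diagonal_def by (intro ext) blast
  ultimately have "corresponds index (\<lambda>j c. \<forall>a\<in>index. pdiv j (laplace_coeff c a)) index (diagonal index smith)"
    unfolding index_blocks[symmetric] by (simp only:)
  then show ?thesis by (rule corresponds_trans[OF laplace_corresponds])
qed

end

section \<open>Counting invariants\<close>

lemma card_filter_eq_sum: "finite A \<Longrightarrow> card {x\<in>A. P x} = (\<Sum>x\<in>A. of_bool (P x))"
  by (simp add: Int_def)

context van_lint_schrijver
begin

lemma smith_cases:
  assumes "a \<in> index"
  shows "smith a = 0 \<or> fraction (smith a)"
proof -
  have s: "fraction (\<gamma>\<^sup>2 + \<gamma> - of_nat l * \<gamma>)" "fraction (\<gamma> + 1)"
    unfolding \<gamma>_factor(2) by (simp_all add: fraction_mult fraction_\<gamma> fraction_\<gamma>_l fraction_unit unit_\<gamma>_plus_1)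
  obtain i m where a: "a = (i, m)" by force
  show ?thesis
  proof (cases "i = 0")
    case True
    then show ?thesis
      by (auto simp: a smith_def fraction_unit unit_one fraction_mult fraction_\<gamma> fraction_\<gamma>_l fraction_s s)
  next
    case False
    then have "0 < i" "i < k" using assms by (auto simp: a index_def)
    then show ?thesis
      by (auto simp: a smith_def fraction_pivot fraction_mult fraction_divide fraction_s s)
  qed
qed

abbreviation has_val :: "nat \<times> nat \<Rightarrow> nat \<Rightarrow> bool" where
  "has_val a j \<equiv> smith a \<noteq> 0 \<and> val (smith a) = int j"

lemma has_val_trivial:
  "\<not> has_val (0, 0) j" "has_val (0, 1) j \<longleftrightarrow> j = 0" "has_val (0, l) j \<longleftrightarrow> j = 0"
  "has_val (0, 2) j \<longleftrightarrow> j = h + d" "m \<in> {3..<l} \<Longrightarrow> has_val (0, m) j \<longleftrightarrow> j = h"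
proof -
  have nz: "\<gamma> \<noteq> 0" "\<gamma> + 1 \<noteq> 0" "\<gamma> + 1 - of_nat l \<noteq> 0" "\<gamma>\<^sup>2 + \<gamma> \<noteq> 0"
    using fraction_nonzero fraction_\<gamma> fraction_\<gamma>_l fraction_s unit_nonzero[OF unit_\<gamma>_plus_1] by blast+
  have 2: "val (\<gamma> * (\<gamma> + 1) * (\<gamma> + 1 - of_nat l)) = int (h + d)"
    by (simp add: val_mult fraction_mult fraction_\<gamma> fraction_\<gamma>_l fraction_unit unit_\<gamma>_plus_1 val_\<gamma> val_\<gamma>_l val_unit)
  have s: "smith (0, 0) = 0" "smith (0, 1) = \<gamma> + 1" "smith (0, l) = 1"
    "smith (0, 2) = \<gamma> * (\<gamma> + 1) * (\<gamma> + 1 - of_nat l)"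
    using l2 by (simp_all add: smith_def)
  show "\<not> has_val (0, 0) j" by (simp add: s)
  show "has_val (0, 1) j \<longleftrightarrow> j = 0" unfolding s using nz by (simp add: val_unit unit_\<gamma>_plus_1)
  show "has_val (0, l) j \<longleftrightarrow> j = 0" unfolding s by (simp add: val_unit unit_one)
  show "has_val (0, 2) j \<longleftrightarrow> j = h + d" unfolding s 2 using nz by auto
  show "has_val (0, m) j \<longleftrightarrow> j = h" if "m \<in> {3..<l}"
  proof -
    have "smith (0, m) = \<gamma>\<^sup>2 + \<gamma>" using that by (simp add: smith_def)
    then show ?thesis using nz by (auto simp: val_s)
  qed
qed

lemma has_val_nontrivial:
  assumes i: "0 < i" "i < k"
  shows "has_val (i, lo i) j \<longleftrightarrow> j = min_c i" "has_val (i, hi i) j \<longleftrightarrow> j = 2 * h + d - min_c i"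
    "m \<noteq> lo i \<Longrightarrow> m \<noteq> hi i \<Longrightarrow> has_val (i, m) j \<longleftrightarrow> j = h"
proof -
  note ex = extremes[OF i]
  have s: "smith (i, lo i) = pivot i" "smith (i, hi i) = (\<gamma>\<^sup>2 + \<gamma>) * (\<gamma> * (\<gamma> + 1 - of_nat l)) / pivot i"
    using i ex(3) by (simp_all add: smith_def \<gamma>_factor(2))
  show "has_val (i, lo i) j \<longleftrightarrow> j = min_c i"
    unfolding s using fraction_nonzero[OF fraction_pivot[OF i]] by (auto simp: val_pivot[OF i])
  have f: "fraction ((\<gamma>\<^sup>2 + \<gamma>) * (\<gamma> * (\<gamma> + 1 - of_nat l)))"
    by (intro fraction_mult fraction_s fraction_\<gamma> fraction_\<gamma>_l)
  have "val ((\<gamma>\<^sup>2 + \<gamma>) * (\<gamma> * (\<gamma> + 1 - of_nat l)) / pivot i) = int h + (int h + int d) - int (min_c i)"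
    unfolding divide_inverse
    by (subst val_mult[OF f fraction_inverse[OF fraction_pivot[OF i]]])
      (simp add: val_mult fraction_mult fraction_s fraction_\<gamma> fraction_\<gamma>_l val_s val_\<gamma> val_\<gamma>_l
        val_inverse fraction_pivot[OF i] val_pivot[OF i])
  also have "\<dots> = int (2 * h + d - min_c i)" using min_c_le_h[OF i] by simp
  finally show "has_val (i, hi i) j \<longleftrightarrow> j = 2 * h + d - min_c i"
    unfolding s using fraction_nonzero[OF fraction_divide[OF f fraction_pivot[OF i]]] by auto
  show "has_val (i, m) j \<longleftrightarrow> j = h" if "m \<noteq> lo i" "m \<noteq> hi i"
  proof -
    have "smith (i, m) = \<gamma>\<^sup>2 + \<gamma>" using that i by (simp add: smith_def)
    then show ?thesis using fraction_nonzero[OF fraction_s] by (auto simp: val_s)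
  qed
qed

definition min_count :: "nat \<Rightarrow> nat" where
  "min_count j = card {i\<in>{1..<k}. min_c i = j}"

text \<open>Counts the entries at \<open>hi i\<close>, whose valuation complements that of the pivot
  to \<open>2 * h + d\<close>.\<close>

definition dual_count :: "nat \<Rightarrow> nat" where
  "dual_count j = card {i\<in>{1..<k}. 2 * h + d - min_c i = j}"

text \<open>The block of 0 contributes two units, one entry of valuation \<open>h + d\<close>,
  \<open>l - 3\<close> entries of valuation \<open>h\<close> and a zero. Each of the
  \<open>k - 1\<close> other blocks contributes its two exceptional entries and \<open>l - 2\<close>
  entries of valuation \<open>h\<close>.\<close>

lemma card_has_val:
  "card {a\<in>index. has_val a j} = 2 * of_bool (j = 0) + of_bool (j = h + d) + (l - 3) * of_bool (j = h)
     + (k - 1) * (l - 2) * of_bool (j = h) + min_count j + dual_count j"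
proof -
  let ?F = "\<lambda>a. of_bool (has_val a j) :: nat"
  have fin: "finite index" by (simp add: index_def)
  have "card {a\<in>index. has_val a j} = (\<Sum>a\<in>index. ?F a)" by (rule card_filter_eq_sum[OF fin])
  also have "\<dots> = (\<Sum>a\<in>{..<k} \<times> {..<l}. ?F a) + ?F (0, l)"
    unfolding index_def by (subst sum.union_disjoint) simp_all
  also have "(\<Sum>a\<in>{..<k} \<times> {..<l}. ?F a) = (\<Sum>i<k. \<Sum>m<l. ?F (i, m))"
    by (subst sum.cartesian_product) (intro sum.cong refl, auto)
  also have "{..<k} = insert 0 {1..<k}" using k_pos by auto
  also have "(\<Sum>i\<in>insert 0 {1..<k}. \<Sum>m<l. ?F (i, m)) = (\<Sum>m<l. ?F (0, m)) + (\<Sum>i\<in>{1..<k}. \<Sum>m<l. ?F (i, m))"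
    by simp
  also have "(\<Sum>m<l. ?F (0, m)) = of_bool (j = 0) + of_bool (j = h + d) + (l - 3) * of_bool (j = h)"
  proof -
    have "{..<l} = insert 0 (insert 1 (insert 2 {3..<l}))" using l2 by auto
    then have "(\<Sum>m<l. ?F (0, m)) = ?F (0, 0) + (?F (0, 1) + (?F (0, 2) + (\<Sum>m\<in>{3..<l}. ?F (0, m))))"
      by simp
    also have "(\<Sum>m\<in>{3..<l}. ?F (0, m)) = (\<Sum>m\<in>{3..<l}. of_bool (j = h))"
      by (intro sum.cong refl) (simp only: has_val_trivial)
    finally show ?thesis by (simp only: has_val_trivial) simp
  qed
  also have "?F (0, l) = of_bool (j = 0)" by (simp only: has_val_trivial)
  also have "(\<Sum>i\<in>{1..<k}. \<Sum>m<l. ?F (i, m)) =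
     (\<Sum>i\<in>{1..<k}. of_bool (min_c i = j) + of_bool (2 * h + d - min_c i = j) + (l - 2) * of_bool (j = h))"
  proof (rule sum.cong)
    fix i assume "i \<in> {1..<k}"
    then have i: "0 < i" "i < k" by auto
    let ?R = "{..<l} - {lo i, hi i}"
    have "{..<l} = insert (lo i) (insert (hi i) ?R)" using extremes[OF i] by auto
    moreover have "(\<Sum>m\<in>insert (lo i) (insert (hi i) ?R). ?F (i, m)) = ?F (i, lo i) + (?F (i, hi i) + (\<Sum>m\<in>?R. ?F (i, m)))"
      using extremes(3)[OF i] by simp
    moreover have "(\<Sum>m\<in>?R. ?F (i, m)) = (\<Sum>m\<in>?R. of_bool (j = h))"
      by (intro sum.cong refl) (use has_val_nontrivial(3)[OF i] in simp)
    moreover have "card ?R = l - 2" using extremes(1-3)[OF i] by (simp add: card_Diff_subset)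
    ultimately have "(\<Sum>m<l. ?F (i, m)) = ?F (i, lo i) + (?F (i, hi i) + (l - 2) * of_bool (j = h))"
      by simp
    then show "(\<Sum>m<l. ?F (i, m)) = of_bool (min_c i = j) + of_bool (2 * h + d - min_c i = j) + (l - 2) * of_bool (j = h)"
      unfolding has_val_nontrivial(1,2)[OF i] by (simp only: eq_commute[of j] add.assoc)
  qed simp
  also have "\<dots> = min_count j + dual_count j + (k - 1) * (l - 2) * of_bool (j = h)"
  proof -
    have "(\<Sum>i\<in>{1..<k}. of_bool (min_c i = j)) = min_count j"
      unfolding min_count_def by (rule card_filter_eq_sum[symmetric]) (rule finite_atLeastLessThan)
    moreover have "(\<Sum>i\<in>{1..<k}. of_bool (2 * h + d - min_c i = j)) = dual_count j"
      unfolding dual_count_def by (rule card_filter_eq_sum[symmetric]) (rule finite_atLeastLessThan)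
    ultimately show ?thesis by (simp only: sum.distrib sum_constant card_atLeastLessThan) simp
  qed
  finally show ?thesis by simp
qed

lemma laplace_eq_act:
  assumes S: "S = {x. in_S x}"
  shows "laplace y x = act (regular_laplacian k (adjacent S)) y x"
proof -
  have "act (regular_laplacian k (adjacent S)) y x
     = (\<Sum>w\<in>UNIV. (if x = w then of_nat k * y x else 0) - of_bool (in_S (x - w)) * y w)"
    unfolding act_def
    by (intro sum.cong refl)
      (auto simp: regular_laplacian_def adjacency_matrix_def adjacent_def mat_def S left_diff_distrib)
  then show ?thesis by (simp add: sum_subtractf laplace_def)
qed

theorem card_smith_invariants:
  fixes e :: "'k \<Rightarrow> int"
  assumes S: "S = {x. in_S x}" and diag: "diagonalized (regular_laplacian k (adjacent S)) P P' Q Q' e"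
  shows "card {x. e x \<noteq> 0 \<and> multiplicity (int p) (e x) = j} = card {a\<in>index. has_val a j}"
proof (rule card_multiplicity_eq)
  have "corresponds UNIV (diagonal UNIV (\<lambda>x. of_int (e x))) UNIV (\<lambda>j y. \<forall>x\<in>UNIV. pdiv j (laplace y x))"
    using diagonalized_corresponds[OF diag] by (simp add: laplace_eq_act[OF S])
  then show "corresponds UNIV (diagonal UNIV (\<lambda>x. of_int (e x))) index (diagonal index smith)"
    using laplace_diagonal by (rule corresponds_trans)
qed (simp_all add: index_def smith_cases[unfolded index_def])

lemma sum_min_count: "(\<Sum>j<h. min_count j) + min_count h = k - 1"
proof -
  have "(\<Sum>j<h. min_count j) + min_count h = (\<Sum>j<Suc h. min_count j)" by simp
  also have "\<dots> = (\<Sum>i\<in>{1..<k}. \<Sum>j<Suc h. of_bool (min_c i = j))"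
    by (subst sum.swap, intro sum.cong refl)
      (simp only: min_count_def card_filter_eq_sum[OF finite_atLeastLessThan])
  also have "\<dots> = (\<Sum>i\<in>{1..<k}. 1)"
  proof (rule sum.cong)
    fix i assume "i \<in> {1..<k}"
    then have "min_c i < Suc h" using min_c_le_h[of i] by auto
    have "(\<Sum>j<Suc h. of_bool (min_c i = j) :: nat) = (\<Sum>j<Suc h. if min_c i = j then 1 else 0)"
      by (intro sum.cong) auto
    then show "(\<Sum>j<Suc h. of_bool (min_c i = j)) = (1::nat)" using \<open>min_c i < Suc h\<close> by (simp del: sum.lessThan_Suc)
  qed simp
  finally show ?thesis by simp
qed

lemma min_count_above: "j > h \<Longrightarrow> min_count j = 0"
proof -
  assume "j > h"
  then have "min_c i \<noteq> j" if "i \<in> {1..<k}" for i using min_c_le_h[of i] that by auto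
  then have "{i\<in>{1..<k}. min_c i = j} = {}" by blast
  then show ?thesis by (simp add: min_count_def)
qed

lemma dual_count_eq: "j \<le> 2 * h + d \<Longrightarrow> dual_count j = min_count (2 * h + d - j)"
proof -
  assume "j \<le> 2 * h + d"
  then have "2 * h + d - min_c i = j \<longleftrightarrow> min_c i = 2 * h + d - j" if "i \<in> {1..<k}" for i
    using min_c_le_h[of i] that by auto
  then have "{i\<in>{1..<k}. 2 * h + d - min_c i = j} = {i\<in>{1..<k}. min_c i = 2 * h + d - j}"
    by (intro Collect_cong conj_cong refl)
  then show ?thesis unfolding dual_count_def min_count_def by (rule arg_cong)
qed

lemma dual_count_above: "j > 2 * h + d \<Longrightarrow> dual_count j = 0"
  unfolding dual_count_def by auto

text \<open>Below \<open>h\<close> only pivots and the two units occur, and the entries at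
  \<open>hi i\<close> mirror the pivots. The cases differ at \<open>h\<close>: the entry of
  valuation \<open>h + d\<close> in the block of 0, and the entries at \<open>hi i\<close> of the
  blocks with \<open>min_c i = h\<close>, fall on \<open>h\<close> itself if \<open>d = 0\<close>
  and sit apart at \<open>h + d\<close> if \<open>d > 0\<close>. The number of such blocks is
  eliminated by counting all \<open>k - 1\<close> blocks.\<close>

theorem multiplicities:
  assumes e: "\<And>j. e j = card {a\<in>index. has_val a j}"
  shows "(e 0 = min_count 0 + 2 \<and> e (2 * h + d) = min_count 0) \<and>
     (\<forall>j. 0 < j \<and> j < h \<longrightarrow> e j = min_count j) \<and>
     (\<forall>j. 0 < j \<and> j < h \<longrightarrow> e j = e (2 * h + d - j)) \<and>
     (d = 0 \<longrightarrow> int (e h) = int (l * k + 1) + 1 - 2 * (\<Sum>j<h. int (e j))) \<and>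
     (d > 0 \<longrightarrow>
        int (e (h + d)) = int k + 2 - (\<Sum>j<h. int (e j)) \<and>
        int (e h) = int (l - 1) * int k - (\<Sum>j<h. int (e j))) \<and>
     (\<forall>j. j \<notin> {0..h} \<union> {h + d..2 * h + d} \<longrightarrow> e j = 0)"
proof -
  note e' = e[unfolded card_has_val]
  have low: "e j = 2 * of_bool (j = 0) + min_count j" if "j < h" for j
    using that min_count_above[of "2 * h + d - j"] by (simp add: e' dual_count_eq)
  have high: "e (2 * h + d - j) = min_count j" if "j < h" for j
  proof -
    have "2 * h + d - j > h" "2 * h + d - j \<noteq> h + d" "2 * h + d - j \<noteq> h" "2 * h + d - j \<noteq> 0"
      "2 * h + d - (2 * h + d - j) = j"
      using that by auto
    then show ?thesis
      using min_count_above[of "2 * h + d - j"] dual_count_eq[of "2 * h + d - j"] by (simp add: e')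
  qed
  have "(\<Sum>j<h. e j) = (\<Sum>j<h. if j = 0 then 2 else 0) + (\<Sum>j<h. min_count j)"
    unfolding sum.distrib[symmetric] by (intro sum.cong refl) (simp add: low)
  then have "(\<Sum>j<h. e j) = 2 + (\<Sum>j<h. min_count j)" using h_pos by simp
  then have "(\<Sum>j<h. e j) + min_count h = k + 1" using sum_min_count k_pos by simp
  then have sum: "(\<Sum>j<h. int (e j)) = int k + 1 - int (min_count h)"
    by (simp flip: of_nat_sum)
  have l3: "int (l - 3) = int l - 3" "int (l - 2) = int l - 2" "int (l - 1) = int l - 1" "int (k - 1) = int k - 1"
    using l2 k_pos by (simp_all add: of_nat_diff)
  have part4: "int (e h) = int (l * k + 1) + 1 - 2 * (\<Sum>j<h. int (e j))" if "d = 0"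
  proof -
    have "(h = h + d) = True" "(h = 0) = False" "2 * h + d - h = h" using that h_pos by simp_all
    moreover have "dual_count h = min_count (2 * h + d - h)" by (rule dual_count_eq) simp
    ultimately have eh: "e h = 1 + (l - 3) + (k - 1) * (l - 2) + min_count h + min_count h"
      using e'[of h] by (simp only:) simp
    show ?thesis unfolding sum eh of_nat_add of_nat_mult l3 by (simp add: algebra_simps)
  qed
  have part5: "int (e (h + d)) = int k + 2 - (\<Sum>j<h. int (e j))"
     "int (e h) = int (l - 1) * int k - (\<Sum>j<h. int (e j))" if "d > 0"
  proof -
    have "e (h + d) = 1 + min_count h"
      using that h_pos min_count_above[of "h + d"] by (simp add: e' dual_count_eq)
    then show "int (e (h + d)) = int k + 2 - (\<Sum>j<h. int (e j))" unfolding sum by simp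
    have eh: "e h = (l - 3) + (k - 1) * (l - 2) + min_count h"
      using that h_pos min_count_above[of "h + d"] by (simp add: e' dual_count_eq)
    show "int (e h) = int (l - 1) * int k - (\<Sum>j<h. int (e j))"
      unfolding sum eh of_nat_add of_nat_mult l3 by (simp add: algebra_simps)
  qed
  have part6: "e j = 0" if "j \<notin> {0..h} \<union> {h + d..2 * h + d}" for j
  proof -
    have "j > h" "j \<noteq> h + d" "j \<noteq> h" "j \<noteq> 0" using that by auto
    moreover have "dual_count j = 0"
    proof (cases "j > 2 * h + d")
      case False
      then have "2 * h + d - j > h" using that by auto
      then show ?thesis using False by (simp add: dual_count_eq min_count_above)
    qed (rule dual_count_above)
    ultimately show ?thesis by (simp add: e' min_count_above)
  qed
  show ?thesis using low high part4 part5 part6 h_pos high[of 0] by auto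
qed

end

section \<open>Roots of unity, the connection set and the size bound\<close>

lemma exp_root_of_unity:
  assumes "m > 0"
  shows "exp (2 * of_real pi * \<i> / of_nat m) ^ j = (1::complex) \<longleftrightarrow> m dvd j"
  using complex_root_unity_eq_1[of m j] assms
  by (simp add: exp_of_nat_mult[symmetric] mult_ac)

text \<open>Multiplication by an element permutes \<open>S\<close>, so comparing products over
  \<open>S\<close> shows its \<open>k\<close>-th power to be 1. The polynomial
  \<open>X^k - 1\<close> has at most \<open>k\<close> roots, hence no others.\<close>

lemma subgroup_mult_group_eq:
  fixes S :: "'k::{finite,field} set"
  assumes S: "subgroup S mult_group" "card S = k"
  shows "S = {x. x \<noteq> 0 \<and> x ^ k = 1}"
proof -
  interpret subgroup S mult_group by (rule S(1))
  have nz: "x \<noteq> 0" if "x \<in> S" for x using subset that by (auto simp: mult_group_def)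
  have closed: "x * y \<in> S" if "x \<in> S" "y \<in> S" for x y using m_closed[OF that] by (simp add: mult_group_def)
  have "1 \<in> S" using one_closed by (simp add: mult_group_def)
  then have k: "k > 0" using S(2) by (auto simp: card_gt_0_iff)
  have pow: "x ^ k = 1" if x: "x \<in> S" for x
  proof -
    have "inj_on ((*) x) S" using nz[OF x] by (auto simp: inj_on_def)
    moreover have "(*) x ` S \<subseteq> S" using closed x by auto
    ultimately have "bij_betw ((*) x) S S" by (simp add: bij_betw_def endo_inj_surj)
    then have "(\<Prod>y\<in>S. x * y) = (\<Prod>y\<in>S. y)" by (rule prod.reindex_bij_betw)
    then have "x ^ k * (\<Prod>y\<in>S. y) = (\<Prod>y\<in>S. y)" by (simp add: prod.distrib S(2))
    moreover have "(\<Prod>y\<in>S. y) \<noteq> 0" using nz by simp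
    ultimately show ?thesis by simp
  qed
  let ?f = "Polynomial.monom 1 k - 1 :: 'k poly"
  have "Polynomial.coeff ?f 0 \<noteq> 0" using k by simp
  then have f0: "?f \<noteq> 0" by (metis coeff_0)
  have "{x. x \<noteq> 0 \<and> x ^ k = 1} \<subseteq> {x. poly ?f x = 0}" by (auto simp: poly_monom)
  then have "card {x :: 'k. x \<noteq> 0 \<and> x ^ k = 1} \<le> card {x. poly ?f x = 0}" by (intro card_mono) simp_all
  also have "\<dots> \<le> Polynomial.degree ?f" by (rule card_poly_roots_bound[OF f0])
  also have "\<dots> \<le> k" by (rule degree_diff_le) (simp_all add: degree_monom_le)
  finally show ?thesis using S(2) pow nz by (intro card_seteq) auto
qed

lemma double_le_two_power: "r \<ge> 1 \<Longrightarrow> 2 * r \<le> 2 ^ r" for r :: nat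
  by (induction r rule: nat_induct_at_least) auto

text \<open>With \<open>l - 1 = 2 * r\<close> and \<open>h = r * t\<close>, the chain
  \<open>2 * r \<le> 2 ^ r \<le> p ^ r \<le> p ^ h\<close> gives the weak inequality. It is strict
  for odd \<open>t\<close> by the hypothesis and for even \<open>t\<close> because then
  \<open>r < h\<close>.\<close>

lemma l_minus_one_less:
  fixes p l t h :: nat
  assumes p: "prime p" and l: "odd l" "l > 2" and t: "t \<ge> 1" and h: "2 * h = (l - 1) * t"
    and ne: "odd t \<Longrightarrow> p ^ h \<noteq> l - 1"
  shows "l - 1 < p ^ h"
proof -
  define r where "r = (l - 1) div 2"
  have r: "l - 1 = 2 * r" "r \<ge> 1" using l by (auto simp: r_def)
  have h': "h = r * t" using h r by simp
  have p2: "p \<ge> 2" using p by (rule prime_ge_2_nat)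
  have "2 * r \<le> 2 ^ r" using r(2) by (rule double_le_two_power)
  also have "\<dots> \<le> p ^ r" using p2 by (rule power_mono) simp
  finally have 1: "l - 1 \<le> p ^ r" unfolding r(1) .
  show ?thesis
  proof (cases "odd t")
    case True
    have "p ^ r \<le> p ^ h" using p2 t by (intro power_increasing) (simp_all add: h')
    then show ?thesis using 1 ne[OF True] by linarith
  next
    case False
    then have "t > 1" using t by (cases "t = 1") auto
    then have "r < h" using r by (simp add: h')
    then have "p ^ r < p ^ h" using p2 by (intro power_strict_increasing) simp_all
    then show ?thesis using 1 by linarith
  qed
qed

theorem theorem1:
  fixes p l t q k d h :: nat
    and S :: "'a::{finite,field} set"
    and L :: "int ^ 'a::{finite,field} ^ 'a::{finite,field}"
    and C :: "(int ^ 'a::{finite,field}) set monoid"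
    and e :: "nat \<Rightarrow> nat"
  assumes "prime p" and "prime l" and "l > 2"
    and "residue_primroot l p"
    and "t \<ge> 1"
    and q: "q = p ^ ((l - 1) * t)"
    and k: "k = (q - 1) div l"
    and h: "h = (l - 1) * t div 2"
    and "odd t \<longrightarrow> sqrt (real q) \<noteq> real (l - 1)"
    and d: "d = multiplicity p (l - 1)"
    and card_K: "CARD('a) = q"
    and card_F: "CARD('f::{finite,field}) = p"
    and S: "subgroup S mult_group" "card S = k"
    and L: "L = regular_laplacian k (adjacent S)"
    and C: "C = critical_group L"
    and e_0: "e 0 = rank_over TYPE('f) L"
    and e_pos: "\<forall>j>0. e j = elem_div_mult p j C"
  shows
    "(e 0 = card {i \<in> {1..k - 1}. min_carries p l t i = 0} + 2 \<and>
      e ((l - 1) * t + d) = card {i \<in> {1..k - 1}. min_carries p l t i = 0}) \<and>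
     (\<forall>j. 0 < j \<and> j < h \<longrightarrow> e j = card {i \<in> {1..k - 1}. min_carries p l t i = j}) \<and>
     (\<forall>j. 0 < j \<and> j < h \<longrightarrow> e j = e ((l - 1) * t + d - j)) \<and>
     (\<not> p dvd l - 1 \<longrightarrow> int (e h) = int q + 1 - 2 * (\<Sum>j<h. int (e j))) \<and>
     (p dvd l - 1 \<longrightarrow>
        int (e (h + d)) = int k + 2 - (\<Sum>j<h. int (e j)) \<and>
        int (e h) = int (l - 1) * int k - (\<Sum>j<h. int (e j))) \<and>
     (\<forall>j. j \<notin> {0..h} \<union> {h + d..(l - 1) * t + d} \<longrightarrow> e j = 0)"
proof -
  define N where "N = (l - 1) * t"
  define n where "n = p ^ N - 1"
  have odd_l: "odd l" using \<open>prime l\<close> \<open>l > 2\<close> prime_odd_nat by blast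
  have N: "N = 2 * h" using odd_l \<open>l > 2\<close> unfolding N_def h by auto
  have qN: "q = p ^ N" by (simp add: q N_def)
  have q2: "q \<ge> 2" using card_field_ge_2[where 'k = 'a] card_K by simp
  have n0: "n > 0" using q2 by (simp add: n_def flip: qN)
  have "coprime p l" using \<open>residue_primroot l p\<close> by (auto simp: residue_primroot_def coprime_commute)
  then have "\<not> l dvd p" using \<open>prime l\<close> \<open>l > 2\<close> by (metis coprime_absorb_right not_prime_unit)
  then have "[p ^ (l - 1) = 1] (mod l)" by (rule fermat_theorem[OF \<open>prime l\<close>])
  then have "[(p ^ (l - 1)) ^ t = 1 ^ t] (mod l)" by (rule cong_pow)
  then have "[q = 1] (mod l)" by (simp add: q power_mult)
  then have "l dvd n" using q2 by (simp add: n_def cong_altdef_nat flip: qN)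
  then have kl: "n = l * k" using k by (simp add: n_def qN)
  have "real q = (real (p ^ h))\<^sup>2" by (simp add: qN N mult.commute flip: power_mult)
  then have sqrt_q: "sqrt (real q) = real (p ^ h)" by simp
  have l_less: "l - 1 < p ^ h"
    using \<open>prime p\<close> odd_l \<open>l > 2\<close> \<open>t \<ge> 1\<close>
  proof (rule l_minus_one_less)
    show "2 * h = (l - 1) * t" using N by (simp add: N_def)
    show "p ^ h \<noteq> l - 1" if "odd t"
    proof
      assume "p ^ h = l - 1"
      then show False using assms(9) that sqrt_q by simp
    qed
  qed
  define \<zeta> \<omega> :: complex where "\<zeta> = exp (2 * of_real pi * \<i> / of_nat n)" and "\<omega> = exp (2 * of_real pi * \<i> / of_nat p)"
  have \<zeta>: "\<zeta> ^ j = 1 \<longleftrightarrow> n dvd j" for j unfolding \<zeta>_def by (rule exp_root_of_unity[OF n0])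
  have \<omega>: "\<omega> ^ j = 1 \<longleftrightarrow> p dvd j" for j
    unfolding \<omega>_def by (rule exp_root_of_unity) (simp add: \<open>prime p\<close> prime_gt_0_nat)
  have "\<exists>g :: 'a. compatible_roots \<zeta> g n p N"
    using \<open>prime p\<close> card_K \<zeta> by (intro compatible_roots_exist) (simp_all add: qN n_def)
  then obtain g :: 'a where "compatible_roots \<zeta> g n p N" ..
  then interpret van_lint_schrijver \<zeta> g n p N \<omega> l k h d
    using \<open>prime l\<close> \<open>l > 2\<close> \<open>residue_primroot l p\<close> kl N l_less d \<omega>
    by (simp add: van_lint_schrijver_def semiprimitive_def gauss_sums_def gauss_sums_axioms_def
        semiprimitive_axioms_def van_lint_schrijver_axioms_def)
  have S_eq: "S = {x. in_S x}" unfolding in_S_def by (rule subgroup_mult_group_eq[OF S])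
  obtain dd where "unimodular_equiv L (\<chi> i j. if i = j then dd i else 0)"
    using int_matrix_diagonalizable[of L] by blast
  then obtain P P' Q Q' where PQ: "diagonalized L P P' Q Q' dd"
    unfolding unimodular_equiv_def diagonalized_def by blast
  have card_inv: "card {x. dd x \<noteq> 0 \<and> multiplicity (int p) (dd x) = j} = card {a\<in>index. has_val a j}" for j
    using card_smith_invariants[OF S_eq] PQ unfolding L by blast
  \<comment> \<open>The value at 0 is a rank and the others are elementary divisor counts. Both
    count nonzero diagonal entries of the given multiplicity, so a single formula covers every
    \<open>j\<close>.\<close>
  have e: "e j = card {a\<in>index. has_val a j}" for j
  proof (cases "j = 0")
    case True
    have "e 0 = card {x. \<not> int p dvd dd x}"
      unfolding e_0 using PQ by (intro rank_over_prime_field[OF _ _ _ _ _ \<open>prime p\<close> card_F]) (auto simp: diagonalized_def)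
    also have "{x. \<not> int p dvd dd x} = {x. dd x \<noteq> 0 \<and> multiplicity (int p) (dd x) = 0}"
    proof -
      have "\<not> int p dvd a \<longleftrightarrow> a \<noteq> 0 \<and> multiplicity (int p) a = 0" for a
        using multiplicity_gt_zero_iff[of a "int p"] prime_gt_1_nat[OF \<open>prime p\<close>] by (cases "a = 0") auto
      then show ?thesis by simp
    qed
    finally show ?thesis using True card_inv by simp
  next
    case False
    then have "e j = card {x. dd x \<noteq> 0 \<and> multiplicity (int p) (dd x) = j}"
      using e_pos diagonalized.elem_div_mult_critical_group[OF PQ \<open>prime p\<close>, of j] by (simp add: C)
    then show ?thesis by (simp add: card_inv)
  qed
  have k': "(p ^ N - 1) div l = k" by (simp add: k qN)
  have mc: "min_carries p l t i = min_c i" for i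
    unfolding min_carries_def min_c_def Let_def N_def[symmetric] k' ..
  have "{1..<k} = {1..k - 1}" using k_pos by auto
  then have mcount: "min_count j = card {i \<in> {1..k - 1}. min_carries p l t i = j}" for j
    by (simp add: min_count_def mc)
  have d0: "p dvd l - 1 \<longleftrightarrow> d > 0"
    using \<open>l > 2\<close> prime_gt_1_nat[OF \<open>prime p\<close>] multiplicity_gt_zero_iff[of "l - 1" p]
    unfolding d by auto
  have q_eq: "q = l * k + 1" using kl q2 unfolding n_def qN[symmetric] by linarith
  have Nh: "(l - 1) * t = 2 * h" using N by (simp add: N_def)
  show ?thesis
    unfolding d0 not_gr_zero mcount[symmetric] q_eq Nh by (rule multiplicities[OF e])
qed

end
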